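(* Let $(\Sigma,\Omega_\Sigma)$ be a two-dimensional symplectic manifold, let $U\subset\mathbb{R}^2$ be open, and let $H_w,H_{\tilde w},H_z,H_{\tilde z}$ be smooth real functions on $U\times\Sigma$. For a function $H$ on $U\times\Sigma$ let $X_H$ denote the vector field on $U\times\Sigma$ tangent to the fibres $\{p\}\times\Sigma$ whose restriction to each fibre is the Hamiltonian vector field of $H|_{\{p\}\times\Sigma}$ with respect to $\Omega_\Sigma$. Consider either of the following two situations. (i) $U$ has coordinates $(z,\tilde z)$, $\nu=dz\wedge d\tilde z\wedge\Omega_\Sigma$, and $$W=-X_{H_w},\quad \tilde W=-X_{H_{\tilde w}},\quad Z=\partial_z-X_{H_z},\quad \tilde Z=\partial_{\tilde z}-X_{H_{\tilde z}}.$$ (ii) $U$ has coordinates $(x,z)$, $\nu=dx\wedge dz\wedge\Omega_\Sigma$, and $$W=\partial_x-X_{H_w},\quad \tilde W=\partial_x-X_{H_{\tilde w}},\quad Z=\partial_z-X_{H_z},\quad \tilde Z=-X_{H_{\tilde z}}.$$ Suppose that the reduced self-dual Yang--Mills equations hold: $$[W,Z]=0,\qquad [\tilde W,\tilde Z]=0,\qquad [W,\tilde W]-[Z,\tilde Z]=0 .$$ Put $f^2:=\nu(W,\tilde W,Z,\tilde Z)$. Then $f^2=\Omega_\Sigma(X_{H_w},X_{H_{\tilde w}})$ in case (i) and $f^2=\Omega_\Sigma(X_{H_w}-X_{H_{\tilde w}},X_{H_{\tilde z}})$ in case (ii). Moreover, on the open subset of $U\times\Sigma$ where $f^2\neq 0$,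 the vector fields $W,\tilde W,Z,\tilde Z$ form a frame, and, with $e_W,e_{\tilde W},e_Z,e_{\tilde Z}$ the dual coframe, the metric $$g=f^2\,(e_W\odot e_{\tilde W}-e_Z\odot e_{\tilde Z})$$ is half-flat (Ricci-flat with self-dual Weyl tensor).
   Context: $\odot$ is the symmetrised tensor product of one-forms (its overall constant normalisation is irrelevant). The symbol $f^2$ denotes the function $\nu(W,\tilde W,Z,\tilde Z)$, which is allowed to take negative values. The two-form $\Omega_\Sigma$ is pulled back to $U\times\Sigma$ by the projection to $\Sigma$. "Half-flat" means: the Ricci tensor of $g$ vanishes and the Weyl tensor of $g$ is self-dual, where the orientation is the one for which the two-forms $f^2 e_W\wedge e_Z$, $f^2(e_W\wedge e_{\tilde W}-e_Z\wedge e_{\tilde Z})$ and $f^2 e_{\tilde W}\wedge e_{\tilde Z}$ are anti-self-dual. The metric has ultra-hyperbolic signature $(2,2)$. The three bracket equations are equivalent to $[W-\lambda\tilde Z,\,Z-\lambda\tilde W]=0$ for all $\lambda$; they are the self-dual Yang--Mills equations on $\mathbb{R}^4$ with metric $dw\,d\tilde w-dz\,d\tilde z$, for a connection with values in Hamiltonian vector fields on $\Sigma$, reduced by the two translations $\partial_w,\partial_{\tilde w}$ (case (i)) or $\partial_w-\partial_{\tilde w},\partial_{\tilde z}$ (case (ii)). *)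

theory Defs
  imports "HOL-Analysis.Analysis" "HOL-Library.Function_Algebras"
begin

section \<open>Smooth manifolds\<close>

primrec Ck_on :: "nat \<Rightarrow> 'a::euclidean_space set \<Rightarrow> ('a \<Rightarrow> 'b::euclidean_space) \<Rightarrow> bool" where
  "Ck_on 0 S f \<longleftrightarrow> continuous_on S f"
| "Ck_on (Suc k) S f \<longleftrightarrow>
     (\<forall>x\<in>S. f differentiable (at x)) \<and> (\<forall>v. Ck_on k S (\<lambda>x. frechet_derivative f (at x) v))"

text \<open>Used for open sets only.\<close>

definition smooth_on :: "'a::euclidean_space set \<Rightarrow> ('a \<Rightarrow> 'b::euclidean_space) \<Rightarrow> bool" where
  "smooth_on S f \<longleftrightarrow> (\<forall>k. Ck_on k S f)"

text \<open>A chart is a pair of its domain and its coordinate map (the values of the latter outside the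
  domain are irrelevant). A manifold is given by an atlas; its point set is the union of the chart
  domains, an open subset of the ambient type.\<close>

type_synonym ('m, 'e) chart = "'m set \<times> ('m \<Rightarrow> 'e)"
type_synonym ('m, 'e) atlas = "('m, 'e) chart set"

definition carrier :: "('m, 'e) atlas \<Rightarrow> 'm set" where
  "carrier A = \<Union> (fst ` A)"

definition in_chart :: "('m, 'e) chart \<Rightarrow> ('m \<Rightarrow> 'b) \<Rightarrow> 'e \<Rightarrow> 'b" where
  "in_chart c f = f \<circ> inv_into (fst c) (snd c)"

definition smooth_manifold ::
  "('m::{t2_space, second_countable_topology}, 'e::euclidean_space) atlas \<Rightarrow> bool" where
  "smooth_manifold A \<longleftrightarrow>
     (\<forall>(D, \<phi>)\<in>A. open D \<and> open (\<phi> ` D) \<and> homeomorphism D (\<phi> ` D) \<phi> (inv_into D \<phi>)) \<and>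
     (\<forall>c\<in>A. \<forall>d\<in>A. smooth_on (snd c ` (fst c \<inter> fst d)) (in_chart c (snd d)))"

definition smooth_fun ::
  "('m::topological_space, 'e::euclidean_space) atlas \<Rightarrow> 'm set \<Rightarrow> ('m \<Rightarrow> real) \<Rightarrow> bool" where
  "smooth_fun A N f \<longleftrightarrow> (\<forall>c\<in>A. smooth_on (snd c ` (fst c \<inter> N)) (in_chart c f))"

definition smooth_at ::
  "('m::topological_space, 'e::euclidean_space) atlas \<Rightarrow> 'm \<Rightarrow> ('m \<Rightarrow> real) \<Rightarrow> bool" where
  "smooth_at A p f \<longleftrightarrow> (\<exists>N. open N \<and> p \<in> N \<and> N \<subseteq> carrier A \<and> smooth_fun A N f)"

definition prod_atlas :: "'a set \<Rightarrow> ('m, 'e) atlas \<Rightarrow> ('a \<times> 'm, 'a \<times> 'e) atlas" where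
  "prod_atlas U A = (\<lambda>(D, \<phi>). (U \<times> D, map_prod id \<phi>)) ` A"


section \<open>Tangent vectors and vector fields\<close>

text \<open>Tangent vectors at a point are directional derivative operators acting on the functions that
  are smooth near the point. As operators on total functions they are normalised to vanish on
  functions that are not smooth near the point, so that equality of operators is equality of
  tangent vectors.\<close>

type_synonym 'm tangent = "('m \<Rightarrow> real) \<Rightarrow> real"
type_synonym 'm field = "'m \<Rightarrow> 'm tangent"
type_synonym 'm tensor2 = "'m \<Rightarrow> 'm tangent \<Rightarrow> 'm tangent \<Rightarrow> real"

definition dir_deriv ::
  "('m::topological_space, 'e::euclidean_space) atlas \<Rightarrow> ('m, 'e) chart \<Rightarrow> 'm \<Rightarrow> 'e \<Rightarrow> 'm tangent" where
  "dir_deriv A c p w =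
     (\<lambda>f. if smooth_at A p f then frechet_derivative (in_chart c f) (at (snd c p)) w else 0)"

definition tangent_space ::
  "('m::topological_space, 'e::euclidean_space) atlas \<Rightarrow> 'm \<Rightarrow> 'm tangent set" where
  "tangent_space A p = {dir_deriv A c p w | c w. c \<in> A \<and> p \<in> fst c}"

definition scal :: "real \<Rightarrow> 'm tangent \<Rightarrow> 'm tangent" where
  "scal a v = (\<lambda>f. a * v f)"

definition lincomb :: "('i::finite \<Rightarrow> real) \<Rightarrow> ('i \<Rightarrow> 'm tangent) \<Rightarrow> 'm tangent" where
  "lincomb a b = (\<Sum>i\<in>UNIV. scal (a i) (b i))"

definition basis_at ::
  "('m::topological_space, 'e::euclidean_space) atlas \<Rightarrow> 'm \<Rightarrow> ('i::finite \<Rightarrow> 'm tangent) \<Rightarrow> bool" where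
  "basis_at A p b \<longleftrightarrow> (\<forall>i. b i \<in> tangent_space A p) \<and> (\<forall>v\<in>tangent_space A p. \<exists>!a. v = lincomb a b)"

text \<open>Differential at \<open>q\<close> of a smooth map \<open>j\<close> into the manifold with atlas \<open>B\<close>.\<close>

definition differential ::
  "('n::topological_space, 'e::euclidean_space) atlas \<Rightarrow> ('m \<Rightarrow> 'n) \<Rightarrow> 'm \<Rightarrow> 'm tangent \<Rightarrow> 'n tangent" where
  "differential B j q v = (\<lambda>f. if smooth_at B (j q) f then v (f \<circ> j) else 0)"

text \<open>Smooth vector fields on an open subset \<open>N\<close> of the manifold, extended by zero outside \<open>N\<close>.\<close>

definition vector_field ::
  "('m::topological_space, 'e::euclidean_space) atlas \<Rightarrow> 'm set \<Rightarrow> 'm field \<Rightarrow> bool" where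
  "vector_field A N X \<longleftrightarrow>
     (\<forall>p\<in>N. X p \<in> tangent_space A p) \<and> (\<forall>p. p \<notin> N \<longrightarrow> X p = 0) \<and>
     (\<forall>N' f. open N' \<and> N' \<subseteq> N \<and> smooth_fun A N' f \<longrightarrow> smooth_fun A N' (\<lambda>p. X p f))"

definition restr :: "'m set \<Rightarrow> 'm field \<Rightarrow> 'm field" where
  "restr N X = (\<lambda>p. if p \<in> N then X p else 0)"

definition fscal :: "('m \<Rightarrow> real) \<Rightarrow> 'm field \<Rightarrow> 'm field" where
  "fscal h X = (\<lambda>p. scal (h p) (X p))"

definition bracket ::
  "('m::topological_space, 'e::euclidean_space) atlas \<Rightarrow> 'm field \<Rightarrow> 'm field \<Rightarrow> 'm field" where
  "bracket A X Y = (\<lambda>p f. if smooth_at A p f then X p (\<lambda>q. Y q f) - Y p (\<lambda>q. X q f) else 0)"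

definition frame ::
  "('m::topological_space, 'e::euclidean_space) atlas \<Rightarrow> 'm set \<Rightarrow> ('i::finite \<Rightarrow> 'm field) \<Rightarrow> bool" where
  "frame A N E \<longleftrightarrow> (\<forall>i. vector_field A N (E i)) \<and> (\<forall>p\<in>N. basis_at A p (\<lambda>i. E i p))"

definition coframe :: "('i::finite \<Rightarrow> 'm field) \<Rightarrow> 'i \<Rightarrow> 'm \<Rightarrow> 'm tangent \<Rightarrow> real" where
  "coframe E i p v = (THE a. v = lincomb a (\<lambda>j. E j p)) i"


section \<open>Two-tensors and symplectic forms\<close>

definition bilinear_on :: "'m tangent set \<Rightarrow> ('m tangent \<Rightarrow> 'm tangent \<Rightarrow> real) \<Rightarrow> bool" where
  "bilinear_on T b \<longleftrightarrow>
     (\<forall>u\<in>T. \<forall>v\<in>T. \<forall>w\<in>T. \<forall>s t.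
        b (scal s u + scal t v) w = s * b u w + t * b v w \<and>
        b w (scal s u + scal t v) = s * b w u + t * b w v)"

definition nondegenerate_on :: "'m tangent set \<Rightarrow> ('m tangent \<Rightarrow> 'm tangent \<Rightarrow> real) \<Rightarrow> bool" where
  "nondegenerate_on T b \<longleftrightarrow> (\<forall>v\<in>T. (\<forall>w\<in>T. b v w = 0) \<longrightarrow> v = 0)"

definition smooth_tensor2 ::
  "('m::topological_space, 'e::euclidean_space) atlas \<Rightarrow> 'm set \<Rightarrow> 'm tensor2 \<Rightarrow> bool" where
  "smooth_tensor2 A N B \<longleftrightarrow>
     (\<forall>p\<in>N. bilinear_on (tangent_space A p) (B p)) \<and>
     (\<forall>N' X Y. open N' \<and> N' \<subseteq> N \<and> vector_field A N' X \<and> vector_field A N' Y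
        \<longrightarrow> smooth_fun A N' (\<lambda>p. B p (X p) (Y p)))"

definition closed_form2 ::
  "('m::topological_space, 'e::euclidean_space) atlas \<Rightarrow> 'm tensor2 \<Rightarrow> bool" where
  "closed_form2 A B \<longleftrightarrow>
     (\<forall>N X Y Z. open N \<and> N \<subseteq> carrier A \<and> vector_field A N X \<and> vector_field A N Y \<and> vector_field A N Z
        \<longrightarrow> (\<forall>p\<in>N. X p (\<lambda>q. B q (Y q) (Z q)) - Y p (\<lambda>q. B q (X q) (Z q)) + Z p (\<lambda>q. B q (X q) (Y q))
              - B p (bracket A X Y p) (Z p) + B p (bracket A X Z p) (Y p)
              - B p (bracket A Y Z p) (X p) = 0))"

definition symplectic_form ::
  "('m::topological_space, 'e::euclidean_space) atlas \<Rightarrow> 'm tensor2 \<Rightarrow> bool" where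
  "symplectic_form A \<Omega> \<longleftrightarrow>
     smooth_tensor2 A (carrier A) \<Omega> \<and>
     (\<forall>p\<in>carrier A. (\<forall>v\<in>tangent_space A p. \<Omega> p v v = 0) \<and> nondegenerate_on (tangent_space A p) (\<Omega> p)) \<and>
     closed_form2 A \<Omega>"

text \<open>Sign convention \<open>\<Omega>(X, \<cdot>) = dh\<close>.\<close>

definition ham_vec ::
  "('m::topological_space, 'e::euclidean_space) atlas \<Rightarrow> 'm tensor2 \<Rightarrow> 'm \<Rightarrow> ('m \<Rightarrow> real) \<Rightarrow> 'm tangent" where
  "ham_vec A \<Omega> s h =
     (THE v. v \<in> tangent_space A s \<and> (\<forall>w\<in>tangent_space A s. \<Omega> s v w = w h))"


section \<open>Pseudo-Riemannian geometry in dimension four\<close>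

text \<open>A global frame \<open>E\<close> on the open set \<open>N\<close> is used for contractions and for extending tangent
  vectors to vector fields (with constant components); the resulting tensors do not depend on it.\<close>

definition neutral_metric ::
  "('m::topological_space, 'e::euclidean_space) atlas \<Rightarrow> 'm set \<Rightarrow> 'm tensor2 \<Rightarrow> bool" where
  "neutral_metric A N g \<longleftrightarrow>
     smooth_tensor2 A N g \<and>
     (\<forall>p\<in>N. (\<forall>v\<in>tangent_space A p. \<forall>w\<in>tangent_space A p. g p v w = g p w v) \<and>
        (\<exists>b :: 4 \<Rightarrow> 'm tangent. basis_at A p b \<and>
           (\<forall>i j. g p (b i) (b j) = (if i \<noteq> j then 0 else if i = 1 \<or> i = 2 then 1 else -1))))"

definition levi_civita ::
  "('m::topological_space, 'e::euclidean_space) atlas \<Rightarrow> 'm set \<Rightarrow> 'm tensor2 \<Rightarrow>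
   ('m field \<Rightarrow> 'm field \<Rightarrow> 'm field) \<Rightarrow> bool" where
  "levi_civita A N g nab \<longleftrightarrow>
     (\<forall>X Y. vector_field A N X \<and> vector_field A N Y \<longrightarrow>
        vector_field A N (nab X Y) \<and> nab X Y - nab Y X = bracket A X Y) \<and>
     (\<forall>X Y Z. vector_field A N X \<and> vector_field A N Y \<and> vector_field A N Z \<longrightarrow>
        nab (X + Y) Z = nab X Z + nab Y Z \<and>
        nab Z (X + Y) = nab Z X + nab Z Y \<and>
        (\<forall>p\<in>N. Z p (\<lambda>q. g q (X q) (Y q)) = g p (nab Z X p) (Y p) + g p (X p) (nab Z Y p))) \<and>
     (\<forall>X Y h. vector_field A N X \<and> vector_field A N Y \<and> smooth_fun A N h \<longrightarrow>
        nab (fscal h X) Y = fscal h (nab X Y) \<and>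
        nab X (fscal h Y) = fscal h (nab X Y) + fscal (\<lambda>p. X p h) Y)"

definition extend :: "(4 \<Rightarrow> 'm field) \<Rightarrow> 'm \<Rightarrow> 'm tangent \<Rightarrow> 'm field" where
  "extend E p v = (\<lambda>q. lincomb (\<lambda>i. coframe E i p v) (\<lambda>i. E i q))"

definition curv_field ::
  "('m::topological_space, 'e::euclidean_space) atlas \<Rightarrow> ('m field \<Rightarrow> 'm field \<Rightarrow> 'm field) \<Rightarrow>
   'm field \<Rightarrow> 'm field \<Rightarrow> 'm field \<Rightarrow> 'm field" where
  "curv_field A nab X Y Z = nab X (nab Y Z) - nab Y (nab X Z) - nab (bracket A X Y) Z"

definition curv ::
  "('m::topological_space, 'e::euclidean_space) atlas \<Rightarrow> ('m field \<Rightarrow> 'm field \<Rightarrow> 'm field) \<Rightarrow>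
   (4 \<Rightarrow> 'm field) \<Rightarrow> 'm \<Rightarrow> 'm tangent \<Rightarrow> 'm tangent \<Rightarrow> 'm tangent \<Rightarrow> 'm tangent" where
  "curv A nab E p x y z = curv_field A nab (extend E p x) (extend E p y) (extend E p z) p"

definition ricci ::
  "('m::topological_space, 'e::euclidean_space) atlas \<Rightarrow> ('m field \<Rightarrow> 'm field \<Rightarrow> 'm field) \<Rightarrow>
   (4 \<Rightarrow> 'm field) \<Rightarrow> 'm tensor2" where
  "ricci A nab E p y z = (\<Sum>i\<in>UNIV. coframe E i p (curv A nab E p (E i p) y z))"

definition gram :: "(4 \<Rightarrow> 'm field) \<Rightarrow> 'm tensor2 \<Rightarrow> 'm \<Rightarrow> real^4^4" where
  "gram E g p = (\<chi> i j. g p (E i p) (E j p))"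

definition scalar_curv ::
  "('m::topological_space, 'e::euclidean_space) atlas \<Rightarrow> 'm tensor2 \<Rightarrow>
   ('m field \<Rightarrow> 'm field \<Rightarrow> 'm field) \<Rightarrow> (4 \<Rightarrow> 'm field) \<Rightarrow> 'm \<Rightarrow> real" where
  "scalar_curv A g nab E p =
     (\<Sum>i\<in>UNIV. \<Sum>j\<in>UNIV. matrix_inv (gram E g p) $ i $ j * ricci A nab E p (E i p) (E j p))"

text \<open>The coefficients are \<open>1/(n-2)\<close> and \<open>1/((n-1)(n-2))\<close> for \<open>n = 4\<close>; the signs match the
  curvature convention above, in which constant curvature \<open>K\<close> means
  \<open>R(x,y)z = K (g(y,z)x - g(x,z)y)\<close>.\<close>

definition weyl ::
  "('m::topological_space, 'e::euclidean_space) atlas \<Rightarrow> 'm tensor2 \<Rightarrow>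
   ('m field \<Rightarrow> 'm field \<Rightarrow> 'm field) \<Rightarrow> (4 \<Rightarrow> 'm field) \<Rightarrow>
   'm \<Rightarrow> 'm tangent \<Rightarrow> 'm tangent \<Rightarrow> 'm tangent \<Rightarrow> 'm tangent \<Rightarrow> real" where
  "weyl A g nab E p x y z v =
     g p (curv A nab E p x y z) v
     - 1/2 * (ricci A nab E p y z * g p x v + g p y z * ricci A nab E p x v
              - ricci A nab E p x z * g p y v - g p x z * ricci A nab E p y v)
     + scalar_curv A g nab E p / 6 * (g p y z * g p x v - g p x z * g p y v)"

text \<open>An orientation is encoded by its (locally constant) sign relative to the frame \<open>E\<close>: value 1
  where \<open>E 1, E 2, E 3, E 4\<close> is positively oriented and -1 where it is negatively oriented.\<close>

definition orientation_sign :: "'m::topological_space set \<Rightarrow> ('m \<Rightarrow> real) \<Rightarrow> bool" where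
  "orientation_sign N \<sigma> \<longleftrightarrow> continuous_on N \<sigma> \<and> (\<forall>p\<in>N. \<sigma> p = 1 \<or> \<sigma> p = -1)"

definition volume_form ::
  "(4 \<Rightarrow> 'm field) \<Rightarrow> 'm tensor2 \<Rightarrow> ('m \<Rightarrow> real) \<Rightarrow>
   'm \<Rightarrow> 'm tangent \<Rightarrow> 'm tangent \<Rightarrow> 'm tangent \<Rightarrow> 'm tangent \<Rightarrow> real" where
  "volume_form E g \<sigma> p a b c d =
     \<sigma> p * sqrt \<bar>det (gram E g p)\<bar> *
     det (\<chi> i. vector [coframe E i p a, coframe E i p b, coframe E i p c, coframe E i p d] :: real^4^4)"

text \<open>\<open>(*\<alpha>)\<^sub>c\<^sub>d = 1/2 \<alpha>\<^sup>a\<^sup>b \<epsilon>\<^sub>a\<^sub>b\<^sub>c\<^sub>d\<close>\<close>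

definition hodge ::
  "(4 \<Rightarrow> 'm field) \<Rightarrow> 'm tensor2 \<Rightarrow> ('m \<Rightarrow> real) \<Rightarrow> 'm \<Rightarrow>
   ('m tangent \<Rightarrow> 'm tangent \<Rightarrow> real) \<Rightarrow> 'm tangent \<Rightarrow> 'm tangent \<Rightarrow> real" where
  "hodge E g \<sigma> p \<alpha> x y =
     1/2 * (\<Sum>i\<in>UNIV. \<Sum>j\<in>UNIV. \<Sum>k\<in>UNIV. \<Sum>l\<in>UNIV.
       matrix_inv (gram E g p) $ i $ k * matrix_inv (gram E g p) $ j $ l *
       \<alpha> (E i p) (E j p) * volume_form E g \<sigma> p (E k p) (E l p) x y)"

definition anti_self_dual ::
  "('m::topological_space, 'e::euclidean_space) atlas \<Rightarrow> 'm set \<Rightarrow> (4 \<Rightarrow> 'm field) \<Rightarrow> 'm tensor2 \<Rightarrow>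
   ('m \<Rightarrow> real) \<Rightarrow> 'm tensor2 \<Rightarrow> bool" where
  "anti_self_dual A N E g \<sigma> \<alpha> \<longleftrightarrow>
     (\<forall>p\<in>N. \<forall>x\<in>tangent_space A p. \<forall>y\<in>tangent_space A p. hodge E g \<sigma> p (\<alpha> p) x y = - \<alpha> p x y)"

definition ricci_flat ::
  "('m::topological_space, 'e::euclidean_space) atlas \<Rightarrow> 'm set \<Rightarrow> (4 \<Rightarrow> 'm field) \<Rightarrow>
   ('m field \<Rightarrow> 'm field \<Rightarrow> 'm field) \<Rightarrow> bool" where
  "ricci_flat A N E nab \<longleftrightarrow>
     (\<forall>p\<in>N. \<forall>y\<in>tangent_space A p. \<forall>z\<in>tangent_space A p. ricci A nab E p y z = 0)"

definition weyl_self_dual ::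
  "('m::topological_space, 'e::euclidean_space) atlas \<Rightarrow> 'm set \<Rightarrow> (4 \<Rightarrow> 'm field) \<Rightarrow> 'm tensor2 \<Rightarrow>
   ('m \<Rightarrow> real) \<Rightarrow> ('m field \<Rightarrow> 'm field \<Rightarrow> 'm field) \<Rightarrow> bool" where
  "weyl_self_dual A N E g \<sigma> nab \<longleftrightarrow>
     (\<forall>p\<in>N. \<forall>x\<in>tangent_space A p. \<forall>y\<in>tangent_space A p.
        \<forall>z\<in>tangent_space A p. \<forall>v\<in>tangent_space A p.
        hodge E g \<sigma> p (\<lambda>a b. weyl A g nab E p a b z v) x y = weyl A g nab E p x y z v)"

text \<open>The Levi-Civita connection is determined by \<open>g\<close>, so the existential quantifier only names it.\<close>

definition half_flat ::
  "('m::topological_space, 'e::euclidean_space) atlas \<Rightarrow> 'm set \<Rightarrow> (4 \<Rightarrow> 'm field) \<Rightarrow> 'm tensor2 \<Rightarrow>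
   ('m \<Rightarrow> real) \<Rightarrow> bool" where
  "half_flat A N E g \<sigma> \<longleftrightarrow>
     (\<exists>nab. levi_civita A N g nab \<and> ricci_flat A N E nab \<and> weyl_self_dual A N E g \<sigma> nab)"


section \<open>The reduced self-dual Yang--Mills fields on \<open>U \<times> \<Sigma>\<close>\<close>

text \<open>Below, \<open>A\<close> is the atlas of \<open>\<Sigma>\<close>, and points of \<open>U \<times> \<Sigma>\<close> are pairs \<open>((u\<^sub>1, u\<^sub>2), s)\<close>.\<close>

definition base_field ::
  "(real \<times> real) set \<Rightarrow> ('s::topological_space, real \<times> real) atlas \<Rightarrow> real \<times> real \<Rightarrow>
   ((real \<times> real) \<times> 's) field" where
  "base_field U A d = (\<lambda>(u, s) f. if smooth_at (prod_atlas U A) (u, s) f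
     then frechet_derivative (\<lambda>x. f (x, s)) (at u) d else 0)"

definition ham_field ::
  "(real \<times> real) set \<Rightarrow> ('s::topological_space, real \<times> real) atlas \<Rightarrow> 's tensor2 \<Rightarrow>
   ((real \<times> real) \<times> 's \<Rightarrow> real) \<Rightarrow> ((real \<times> real) \<times> 's) field" where
  "ham_field U A \<Omega> H = (\<lambda>(u, s).
     differential (prod_atlas U A) (\<lambda>s'. (u, s')) s (ham_vec A \<Omega> s (\<lambda>s'. H (u, s'))))"

definition pullback_form ::
  "('s::topological_space, real \<times> real) atlas \<Rightarrow> 's tensor2 \<Rightarrow> ((real \<times> real) \<times> 's) tensor2" where
  "pullback_form A \<Omega> = (\<lambda>p v w. \<Omega> (snd p) (differential A snd p v) (differential A snd p w))"

definition wedge11 :: "('v \<Rightarrow> real) \<Rightarrow> ('v \<Rightarrow> real) \<Rightarrow> 'v \<Rightarrow> 'v \<Rightarrow> real" where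
  "wedge11 \<alpha> \<beta> v w = \<alpha> v * \<beta> w - \<alpha> w * \<beta> v"

definition wedge22 ::
  "('v \<Rightarrow> 'v \<Rightarrow> real) \<Rightarrow> ('v \<Rightarrow> 'v \<Rightarrow> real) \<Rightarrow> 'v \<Rightarrow> 'v \<Rightarrow> 'v \<Rightarrow> 'v \<Rightarrow> real" where
  "wedge22 \<alpha> \<beta> a b c d =
     \<alpha> a b * \<beta> c d - \<alpha> a c * \<beta> b d + \<alpha> a d * \<beta> b c + \<alpha> b c * \<beta> a d - \<alpha> b d * \<beta> a c + \<alpha> c d * \<beta> a b"

definition sym_prod :: "('v \<Rightarrow> real) \<Rightarrow> ('v \<Rightarrow> real) \<Rightarrow> 'v \<Rightarrow> 'v \<Rightarrow> real" where
  "sym_prod \<alpha> \<beta> v w = (\<alpha> v * \<beta> w + \<alpha> w * \<beta> v) / 2"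

text \<open>\<open>\<nu> = du\<^sub>1 \<and> du\<^sub>2 \<and> \<Omega>\<close>\<close>

definition nu ::
  "('s::topological_space, real \<times> real) atlas \<Rightarrow> 's tensor2 \<Rightarrow> (real \<times> real) \<times> 's \<Rightarrow>
   ((real \<times> real) \<times> 's) tangent \<Rightarrow> ((real \<times> real) \<times> 's) tangent \<Rightarrow>
   ((real \<times> real) \<times> 's) tangent \<Rightarrow> ((real \<times> real) \<times> 's) tangent \<Rightarrow> real" where
  "nu A \<Omega> p =
     wedge22 (wedge11 (\<lambda>v. v (\<lambda>q. fst (fst q))) (\<lambda>v. v (\<lambda>q. snd (fst q)))) (pullback_form A \<Omega> p)"

text \<open>Base coordinates \<open>(z, z\<^sup>~)\<close>.\<close>

definition situation_i where
  "situation_i U A \<Omega> Hw Hwt Hz Hzt W Wt Z Zt \<longleftrightarrow>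
     W = - ham_field U A \<Omega> Hw \<and>
     Wt = - ham_field U A \<Omega> Hwt \<and>
     Z = base_field U A (1, 0) - ham_field U A \<Omega> Hz \<and>
     Zt = base_field U A (0, 1) - ham_field U A \<Omega> Hzt"

text \<open>Base coordinates \<open>(x, z)\<close>.\<close>

definition situation_ii where
  "situation_ii U A \<Omega> Hw Hwt Hz Hzt W Wt Z Zt \<longleftrightarrow>
     W = base_field U A (1, 0) - ham_field U A \<Omega> Hw \<and>
     Wt = base_field U A (1, 0) - ham_field U A \<Omega> Hwt \<and>
     Z = base_field U A (0, 1) - ham_field U A \<Omega> Hz \<and>
     Zt = - ham_field U A \<Omega> Hzt"

definition frame4 :: "'a \<Rightarrow> 'a \<Rightarrow> 'a \<Rightarrow> 'a \<Rightarrow> 4 \<Rightarrow> 'a" where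
  "frame4 a b c d i = (if i = 1 then a else if i = 2 then b else if i = 3 then c else d)"

end

theory Submission
  imports Defs
begin

text \<open>All four fields have the form \<open>\<partial> - X\<^sub>H\<close> with \<open>\<partial>\<close> constant on the base, hence are divergence free with
  respect to \<open>\<nu>\<close>; expanding \<open>X(\<nu>(W, W\<^sup>~, Z, Z\<^sup>~))\<close> shows that the trace of \<open>ad X\<close> in the frame is
  \<open>X (log f\<^sup>2)\<close>. Write the frame as \<open>E\<^bsub>AA'\<^esub>\<close> with \<open>E\<^bsub>0A'\<^esub> = (W, Z\<^sup>~)\<close> and \<open>E\<^bsub>1A'\<^esub> = (Z, W\<^sup>~)\<close>.
  The bracket equations say that \<open>[E\<^bsub>0A'\<^esub>, E\<^bsub>1B'\<^esub>]\<close> is skew in \<open>A'B'\<close>, and this is exactly what is needed for a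
  torsion-free connection that acts on the index \<open>A\<close> alone; the trace condition makes it metric.
  Its curvature therefore acts on the index \<open>A\<close> alone and is trace free there, and the first
  Bianchi identity turns this into Ricci-flatness and self-duality.\<close>

text \<open>Up to a constant the metric is \<open>f2\<close> times the product of the area forms
  \<epsilon>_AB and \<epsilon>_A'B', so a connection on the index A is metric exactly when its trace
  is d log \<open>f2\<close>; this is where the volume form enters. Its curvature splits as
  \<epsilon>_A'B' \<psi>_AB + \<epsilon>_AB \<phi>_A'B', with values in matrices on the unprimed
  index. Bianchi kills \<phi> and makes \<psi> symmetric in all three lower unprimed indices.
  Two-forms symmetric in the primed pair are the anti-self-dual ones, so \<phi> = 0 is self-duality;
  together with the symmetry of \<psi> it removes the Ricci contraction. Divergence freedom is
  local: in a product chart \<nu> is a density times the determinant, the density depends on the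
  fibre alone, and the claim reduces to equality of mixed partial derivatives. Tangent vectors are
  operators on total functions, zero on functions not smooth at the point, and fields are zero off
  their domain; hence the many congruence lemmas and the degenerate cases. \<open>f2\<close> may be
  negative, but only its square enters the volume form, so one constant orientation sign serves
  everywhere.\<close>

section \<open>Calculus of \<open>Ck_on\<close> and \<open>smooth_on\<close>\<close>

lemma differentiable_at_cong_open:
  assumes "open S" "x \<in> S" "\<And>y. y \<in> S \<Longrightarrow> f y = g y"
  shows "f differentiable (at x) \<longleftrightarrow> g differentiable (at x)"
proof -
  have 1: "f differentiable (at x within S) \<longleftrightarrow> g differentiable (at x within S)"
    using assms by (metis differentiable_transform_within zero_less_one)
  then show ?thesis using at_within_open[OF assms(2,1)] by simp
qed

lemma frechet_derivative_cong_open: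
  assumes "open S" "x \<in> S" "\<And>y. y \<in> S \<Longrightarrow> f y = g y"
  shows "frechet_derivative f (at x) = frechet_derivative g (at x)"
proof -
  have "(f has_derivative D) (at x) \<longleftrightarrow> (g has_derivative D) (at x)" for D
    using assms has_derivative_transform_within_open[OF _ assms(1,2)] by metis
  then show ?thesis by (simp add: frechet_derivative_def)
qed

text \<open>On an open set the derivative is determined by the values there. This transfers
  smoothness to the total functions \<open>in_chart c f\<close>, whose values off the chart image
  are arbitrary.\<close>

lemma Ck_on_cong:
  assumes "open S" "\<And>x. x \<in> S \<Longrightarrow> f x = g x" "Ck_on k S f"
  shows "Ck_on k S g"
  using assms(2,3)
proof (induction k arbitrary: f g)
  case 0
  then show ?case using continuous_on_cong by (metis Ck_on.simps(1))
next
  case (Suc k)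
  have "Ck_on k S (\<lambda>x. frechet_derivative g (at x) v)" for v
  proof (rule Suc.IH)
    show "Ck_on k S (\<lambda>x. frechet_derivative f (at x) v)" using Suc.prems by simp
    show "frechet_derivative f (at x) v = frechet_derivative g (at x) v" if "x \<in> S" for x
      using frechet_derivative_cong_open[OF assms(1) that, of f g] Suc.prems(1) by simp
  qed
  moreover have "\<forall>x\<in>S. g differentiable (at x)"
    using differentiable_at_cong_open[OF assms(1)] Suc.prems by (metis Ck_on.simps(2))
  ultimately show ?case by simp
qed

lemma Ck_on_subset: "Ck_on k S f \<Longrightarrow> T \<subseteq> S \<Longrightarrow> Ck_on k T f"
proof (induction k arbitrary: f)
  case 0 then show ?case using continuous_on_subset by auto
next
  case (Suc k) then show ?case by auto
qed

text \<open>Product and chain rules mix derivatives, known at order k, with the undifferentiated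
  maps, known at order \<open>Suc k\<close>; this brings both to the same order.\<close>

lemma Ck_on_SucD: "Ck_on (Suc k) S f \<Longrightarrow> Ck_on k S f"
proof (induction k arbitrary: f)
  case 0 then show ?case
    by (auto intro!: continuous_at_imp_continuous_on differentiable_imp_continuous_within)
next
  case (Suc k)
  then show ?case by (metis Ck_on.simps(2))
qed

lemma Ck_on_local:
  assumes "\<And>x. x \<in> S \<Longrightarrow> \<exists>T. open T \<and> x \<in> T \<and> Ck_on k T f"
  shows "Ck_on k S f"
  using assms
proof (induction k arbitrary: f)
  case 0
  have "isCont f x" if "x \<in> S" for x
    using 0[OF that] continuous_on_eq_continuous_at by (metis Ck_on.simps(1))
  then show ?case by (simp add: continuous_at_imp_continuous_on)
next
  case (Suc k)
  show ?case unfolding Ck_on.simps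
  proof (intro conjI ballI allI)
    show "f differentiable (at x)" if "x \<in> S" for x using Suc.prems[OF that] by auto
    show "Ck_on k S (\<lambda>x. frechet_derivative f (at x) v)" for v
      by (rule Suc.IH) (use Suc.prems in fastforce)
  qed
qed

lemma Ck_on_const: "Ck_on k S (\<lambda>x. c)"
  by (induction k arbitrary: c) auto

lemma Ck_on_add:
  "open S \<Longrightarrow> Ck_on k S f \<Longrightarrow> Ck_on k S g \<Longrightarrow> Ck_on k S (\<lambda>x. f x + g x)"
proof (induction k arbitrary: f g)
  case 0 then show ?case by (auto intro: continuous_intros)
next
  case (Suc k)
  have d: "frechet_derivative (\<lambda>x. f x + g x) (at x) v
      = frechet_derivative f (at x) v + frechet_derivative g (at x) v" if "x \<in> S" for x v
  proof -
    have "((\<lambda>x. f x + g x) has_derivative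
        (\<lambda>v. frechet_derivative f (at x) v + frechet_derivative g (at x) v)) (at x)"
      using Suc.prems that by (intro has_derivative_add) (auto simp: frechet_derivative_works[symmetric])
    from frechet_derivative_at[OF this] show ?thesis by metis
  qed
  have "Ck_on k S (\<lambda>x. frechet_derivative (\<lambda>x. f x + g x) (at x) v)" for v
    by (rule Ck_on_cong[OF Suc.prems(1) d[symmetric]]) (use Suc in auto)
  then show ?case using Suc.prems by (auto intro: differentiable_add)
qed

lemma frechet_derivative_scaleR:
  fixes f :: "'a::real_normed_vector \<Rightarrow> real" and g :: "'a \<Rightarrow> 'b::real_normed_vector"
  assumes "f differentiable (at x)" "g differentiable (at x)"
  shows "frechet_derivative (\<lambda>x. f x *\<^sub>R g x) (at x) v
    = f x *\<^sub>R frechet_derivative g (at x) v + frechet_derivative f (at x) v *\<^sub>R g x"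
proof -
  have "((\<lambda>x. f x *\<^sub>R g x) has_derivative
      (\<lambda>v. f x *\<^sub>R frechet_derivative g (at x) v + frechet_derivative f (at x) v *\<^sub>R g x)) (at x)"
    using assms by (intro has_derivative_scaleR) (auto simp: frechet_derivative_works[symmetric])
  from frechet_derivative_at[OF this] show ?thesis by metis
qed

lemma Ck_on_scaleR:
  fixes f :: "'a::euclidean_space \<Rightarrow> real" and g :: "'a \<Rightarrow> 'b::euclidean_space"
  shows "open S \<Longrightarrow> Ck_on k S f \<Longrightarrow> Ck_on k S g \<Longrightarrow> Ck_on k S (\<lambda>x. f x *\<^sub>R g x)"
proof (induction k arbitrary: f g)
  case 0 then show ?case by (auto intro: continuous_intros)
next
  case (Suc k)
  have d: "frechet_derivative (\<lambda>x. f x *\<^sub>R g x) (at x) v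
      = f x *\<^sub>R frechet_derivative g (at x) v + frechet_derivative f (at x) v *\<^sub>R g x" if "x \<in> S" for x v
    using Suc.prems that by (intro frechet_derivative_scaleR) auto
  have "Ck_on k S (\<lambda>x. frechet_derivative (\<lambda>x. f x *\<^sub>R g x) (at x) v)" for v
    by (rule Ck_on_cong[OF Suc.prems(1) d[symmetric]])
      (use Suc.prems Ck_on_SucD[OF Suc.prems(2)] Ck_on_SucD[OF Suc.prems(3)] in
        \<open>auto intro!: Ck_on_add Suc.IH\<close>)
  then show ?case using Suc.prems by (auto intro: differentiable_scaleR)
qed

lemma Ck_on_sum:
  "open S \<Longrightarrow> (\<And>i. i \<in> I \<Longrightarrow> Ck_on k S (f i)) \<Longrightarrow> Ck_on k S (\<lambda>x. \<Sum>i\<in>I. f i x)"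
  by (induction I rule: infinite_finite_induct) (auto intro!: Ck_on_add Ck_on_const)

lemma Ck_on_linear:
  assumes "bounded_linear f" shows "Ck_on k S f"
proof (cases k)
  case 0 then show ?thesis using assms by (simp add: linear_continuous_on)
next
  case (Suc j)
  have "frechet_derivative f (at x) = f" for x
    using bounded_linear_imp_has_derivative[OF assms] frechet_derivative_at by metis
  then show ?thesis using Suc assms
    by (simp add: Ck_on_const bounded_linear_imp_differentiable)
qed

lemma Ck_on_bounded_linear_comp:
  assumes "bounded_linear L" "open S"
  shows "Ck_on k S f \<Longrightarrow> Ck_on k S (\<lambda>x. L (f x))"
proof (induction k arbitrary: f)
  case 0 then show ?case using bounded_linear.continuous_on[OF assms(1)] by auto
next
  case (Suc k)
  have D: "((\<lambda>x. L (f x)) has_derivative (\<lambda>v. L (frechet_derivative f (at x) v))) (at x)"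
    if "x \<in> S" for x
    using Suc.prems that
    by (intro bounded_linear.has_derivative[OF assms(1)]) (auto simp: frechet_derivative_works[symmetric])
  have "Ck_on k S (\<lambda>x. frechet_derivative (\<lambda>x. L (f x)) (at x) v)" for v
  proof (rule Ck_on_cong[OF assms(2)])
    show "Ck_on k S (\<lambda>x. L (frechet_derivative f (at x) v))" using Suc by simp
    show "L (frechet_derivative f (at x) v) = frechet_derivative (\<lambda>x. L (f x)) (at x) v"
      if "x \<in> S" for x using frechet_derivative_at[OF D[OF that]] by metis
  qed
  moreover have "\<forall>x\<in>S. (\<lambda>x. L (f x)) differentiable (at x)" using D by (auto simp: differentiable_def)
  ultimately show ?case by simp
qed

lemma frechet_derivative_bounded_linear:
  "f differentiable (at x) \<Longrightarrow> bounded_linear (frechet_derivative f (at x))"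
  using frechet_derivative_works has_derivative_bounded_linear by blast

text \<open>\<open>Ck_on\<close> controls derivatives in fixed directions only. Wherever the
  direction varies with the point, as in the chain rule or for vector fields, it is first expanded
  in the basis.\<close>

lemma frechet_derivative_expand:
  fixes f :: "'a::euclidean_space \<Rightarrow> 'b::real_normed_vector"
  assumes "f differentiable (at x)"
  shows "frechet_derivative f (at x) v = (\<Sum>b\<in>Basis. (v \<bullet> b) *\<^sub>R frechet_derivative f (at x) b)"
proof -
  interpret bounded_linear "frechet_derivative f (at x)"
    using assms by (rule frechet_derivative_bounded_linear)
  have "frechet_derivative f (at x) v = frechet_derivative f (at x) (\<Sum>b\<in>Basis. (v \<bullet> b) *\<^sub>R b)"
    by (simp add: euclidean_representation)
  then show ?thesis by (simp add: sum scaleR)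
qed

text \<open>By the chain rule g is differentiated in a direction that moves with the point; expanded
  in the basis, the derivative is a sum of products of a derivative of f with a partial derivative
  of g composed with f. The induction hypothesis covers the latter, since g is arbitrary in
  it.\<close>

lemma Ck_on_compose:
  fixes f :: "'a::euclidean_space \<Rightarrow> 'b::euclidean_space" and g :: "'b \<Rightarrow> 'c::euclidean_space"
  assumes "open S" "f ` S \<subseteq> T"
  shows "Ck_on k S f \<Longrightarrow> Ck_on k T g \<Longrightarrow> Ck_on k S (\<lambda>x. g (f x))"
proof (induction k arbitrary: g)
  case 0 then show ?case using assms continuous_on_compose2 by (metis Ck_on.simps(1))
next
  case (Suc k)
  have fd: "f differentiable (at x)" and gd: "g differentiable (at (f x))" if "x \<in> S" for x
    using Suc.prems that assms(2) by auto
  have D: "((\<lambda>x. g (f x)) has_derivative (\<lambda>v. frechet_derivative g (at (f x)) (frechet_derivative f (at x) v))) (at x)"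
    if "x \<in> S" for x
    using diff_chain_at[of f _ x g] fd[OF that] gd[OF that] unfolding frechet_derivative_works o_def by blast
  have "Ck_on k S (\<lambda>x. frechet_derivative (\<lambda>x. g (f x)) (at x) v)" for v
  proof (rule Ck_on_cong[OF assms(1)])
    show "Ck_on k S (\<lambda>x. \<Sum>b\<in>Basis. (frechet_derivative f (at x) v \<bullet> b) *\<^sub>R frechet_derivative g (at (f x)) b)"
      using Suc.prems Ck_on_SucD[OF Suc.prems(1)]
      by (intro Ck_on_sum Ck_on_scaleR assms Suc.IH Ck_on_bounded_linear_comp[OF bounded_linear_inner_left]) auto
    show "(\<Sum>b\<in>Basis. (frechet_derivative f (at x) v \<bullet> b) *\<^sub>R frechet_derivative g (at (f x)) b)
        = frechet_derivative (\<lambda>x. g (f x)) (at x) v"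
      if "x \<in> S" for x using frechet_derivative_at[OF D[OF that]] frechet_derivative_expand[OF gd[OF that]] by metis
  qed
  moreover have "\<forall>x\<in>S. (\<lambda>x. g (f x)) differentiable (at x)" using D by (auto simp: differentiable_def)
  ultimately show ?case by simp
qed

text \<open>The derivative - f' / f^2 contains 1/f only at one order lower, so f can stay fixed in
  the induction.\<close>

lemma Ck_on_inverse:
  fixes f :: "'a::euclidean_space \<Rightarrow> real"
  assumes "open S" "\<And>x. x \<in> S \<Longrightarrow> f x \<noteq> 0"
  shows "Ck_on k S f \<Longrightarrow> Ck_on k S (\<lambda>x. inverse (f x))"
proof (induction k)
  case 0 then show ?case using assms by (auto intro: continuous_intros)
next
  case (Suc k)
  have D: "((\<lambda>x. inverse (f x)) has_derivative
      (\<lambda>v. - (inverse (f x) * frechet_derivative f (at x) v * inverse (f x)))) (at x)"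
    if "x \<in> S" for x
    using Suc.prems assms(2)[OF that] that
    by (intro Deriv.has_derivative_inverse) (auto simp: frechet_derivative_works[symmetric])
  have "Ck_on k S (\<lambda>x. frechet_derivative (\<lambda>x. inverse (f x)) (at x) v)" for v
  proof (rule Ck_on_cong[OF assms(1)])
    have I: "Ck_on k S (\<lambda>x. inverse (f x))" using Suc.IH Ck_on_SucD[OF Suc.prems] by blast
    have J: "Ck_on k S (\<lambda>x. frechet_derivative f (at x) v)" using Suc.prems by simp
    show "Ck_on k S (\<lambda>x. (- 1) *\<^sub>R (inverse (f x) *\<^sub>R frechet_derivative f (at x) v *\<^sub>R inverse (f x)))"
      by (intro Ck_on_scaleR assms(1) I J Ck_on_const)
    show "(- 1) *\<^sub>R (inverse (f x) *\<^sub>R frechet_derivative f (at x) v *\<^sub>R inverse (f x))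
        = frechet_derivative (\<lambda>x. inverse (f x)) (at x) v"
      if "x \<in> S" for x
      unfolding frechet_derivative_at[OF D[OF that], symmetric] by (simp add: mult.assoc)
  qed
  moreover have "\<forall>x\<in>S. (\<lambda>x. inverse (f x)) differentiable (at x)" using D by (auto simp: differentiable_def)
  ultimately show ?case by simp
qed

lemma smooth_on_cong: "open S \<Longrightarrow> (\<And>x. x \<in> S \<Longrightarrow> f x = g x) \<Longrightarrow> smooth_on S f \<Longrightarrow> smooth_on S g"
  unfolding smooth_on_def using Ck_on_cong by blast

lemma smooth_on_subset: "smooth_on S f \<Longrightarrow> T \<subseteq> S \<Longrightarrow> smooth_on T f"
  unfolding smooth_on_def using Ck_on_subset by blast

lemma smooth_on_local:
  "(\<And>x. x \<in> S \<Longrightarrow> \<exists>T. open T \<and> x \<in> T \<and> smooth_on T f) \<Longrightarrow> smooth_on S f"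
  unfolding smooth_on_def by (metis Ck_on_local)

lemma smooth_on_const: "smooth_on S (\<lambda>x. c)"
  unfolding smooth_on_def using Ck_on_const by blast

lemma smooth_on_add: "open S \<Longrightarrow> smooth_on S f \<Longrightarrow> smooth_on S g \<Longrightarrow> smooth_on S (\<lambda>x. f x + g x)"
  unfolding smooth_on_def using Ck_on_add by blast

lemma smooth_on_scaleR:
  fixes f :: "'a::euclidean_space \<Rightarrow> real"
  shows "open S \<Longrightarrow> smooth_on S f \<Longrightarrow> smooth_on S g \<Longrightarrow> smooth_on S (\<lambda>x. f x *\<^sub>R g x)"
  unfolding smooth_on_def using Ck_on_scaleR by blast

lemma smooth_on_mult:
  fixes f g :: "'a::euclidean_space \<Rightarrow> real"
  shows "open S \<Longrightarrow> smooth_on S f \<Longrightarrow> smooth_on S g \<Longrightarrow> smooth_on S (\<lambda>x. f x * g x)"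
  using smooth_on_scaleR[of S f g] by simp

lemma smooth_on_inverse:
  fixes f :: "'a::euclidean_space \<Rightarrow> real"
  shows "open S \<Longrightarrow> (\<And>x. x \<in> S \<Longrightarrow> f x \<noteq> 0) \<Longrightarrow> smooth_on S f \<Longrightarrow> smooth_on S (\<lambda>x. inverse (f x))"
  unfolding smooth_on_def using Ck_on_inverse by blast

lemma smooth_on_sum:
  "open S \<Longrightarrow> (\<And>i. i \<in> I \<Longrightarrow> smooth_on S (f i)) \<Longrightarrow> smooth_on S (\<lambda>x. \<Sum>i\<in>I. f i x)"
  unfolding smooth_on_def by (metis Ck_on_sum)

lemma smooth_on_linear: "bounded_linear f \<Longrightarrow> smooth_on S f"
  unfolding smooth_on_def using Ck_on_linear by blast

lemma smooth_on_linear_comp: "bounded_linear L \<Longrightarrow> open S \<Longrightarrow> smooth_on S f \<Longrightarrow> smooth_on S (\<lambda>x. L (f x))"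
  unfolding smooth_on_def using Ck_on_bounded_linear_comp by blast

lemma smooth_on_compose:
  "open S \<Longrightarrow> f ` S \<subseteq> T \<Longrightarrow> smooth_on S f \<Longrightarrow> smooth_on T g \<Longrightarrow> smooth_on S (\<lambda>x. g (f x))"
  unfolding smooth_on_def using Ck_on_compose by blast

lemma smooth_on_deriv: "smooth_on S f \<Longrightarrow> smooth_on S (\<lambda>x. frechet_derivative f (at x) v)"
  unfolding smooth_on_def by (metis Ck_on.simps(2))

lemma smooth_on_differentiable: "smooth_on S f \<Longrightarrow> x \<in> S \<Longrightarrow> f differentiable (at x)"
  unfolding smooth_on_def by (metis Ck_on.simps(2))

lemma smooth_on_continuous: "smooth_on S f \<Longrightarrow> continuous_on S f"
  unfolding smooth_on_def by (metis Ck_on.simps(1))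

lemma smooth_on_componentwise:
  assumes "open S" "\<And>b. b \<in> Basis \<Longrightarrow> smooth_on S (\<lambda>x. f x \<bullet> b)"
  shows "smooth_on S f"
proof (rule smooth_on_cong[OF assms(1)])
  show "smooth_on S (\<lambda>x. \<Sum>b\<in>Basis. (f x \<bullet> b) *\<^sub>R b)"
    by (intro smooth_on_sum smooth_on_scaleR assms smooth_on_const)
  show "(\<Sum>b\<in>Basis. (f x \<bullet> b) *\<^sub>R b) = f x" for x by (rule euclidean_representation)
qed

section \<open>Symmetry of second derivatives\<close>

lemma has_real_derivative_along:
  fixes f :: "'a::euclidean_space \<Rightarrow> real"
  assumes "f differentiable (at (x + t *\<^sub>R v))"
  shows "((\<lambda>t. f (x + t *\<^sub>R v)) has_real_derivative frechet_derivative f (at (x + t *\<^sub>R v)) v) (at t)"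
proof -
  have 1: "((\<lambda>t. x + t *\<^sub>R v) has_derivative (\<lambda>s. s *\<^sub>R v)) (at t)"
    by (auto intro!: derivative_eq_intros)
  have 2: "(f has_derivative frechet_derivative f (at (x + t *\<^sub>R v))) (at (x + t *\<^sub>R v))"
    using assms frechet_derivative_works by blast
  have 3: "((\<lambda>t. f (x + t *\<^sub>R v)) has_derivative (\<lambda>s. frechet_derivative f (at (x + t *\<^sub>R v)) (s *\<^sub>R v))) (at t)"
    using diff_chain_at[OF 1 2] by (simp add: o_def)
  interpret bounded_linear "frechet_derivative f (at (x + t *\<^sub>R v))"
    using assms by (rule frechet_derivative_bounded_linear)
  have "(\<lambda>s. s * c) = (*) c" for c :: real by (auto simp: mult.commute)
  then show ?thesis using 3 unfolding has_field_derivative_def by (simp add: scaleR)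
qed

text \<open>Two applications of the mean value theorem to the second difference of \<open>f\<close>.\<close>

lemma second_difference:
  fixes f :: "'a::euclidean_space \<Rightarrow> real"
  assumes S: "\<And>a b. 0 \<le> a \<Longrightarrow> a \<le> t \<Longrightarrow> 0 \<le> b \<Longrightarrow> b \<le> t \<Longrightarrow> x + a *\<^sub>R v + b *\<^sub>R w \<in> S"
    and f: "smooth_on S f" and t: "t > 0"
  obtains a b where "0 \<le> a" "a \<le> t" "0 \<le> b" "b \<le> t"
    "f (x + t *\<^sub>R v + t *\<^sub>R w) - f (x + t *\<^sub>R v) - f (x + t *\<^sub>R w) + f x
     = t * t * frechet_derivative (\<lambda>y. frechet_derivative f (at y) v) (at (x + a *\<^sub>R v + b *\<^sub>R w)) w"
proof -
  let ?g = "\<lambda>a. f (x + t *\<^sub>R w + a *\<^sub>R v) - f (x + a *\<^sub>R v)"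
  let ?Dv = "\<lambda>y. frechet_derivative f (at y) v"
  have S2: "x + b *\<^sub>R w + a *\<^sub>R v \<in> S" if "0 \<le> a" "a \<le> t" "0 \<le> b" "b \<le> t" for a b
    using S[OF that] by (simp add: ac_simps)
  have "(?g has_real_derivative (?Dv (x + t *\<^sub>R w + a *\<^sub>R v) - ?Dv (x + a *\<^sub>R v))) (at a)"
    if "0 \<le> a" "a \<le> t" for a
    using S2[OF that, of t] S2[OF that, of 0] t f
    by (intro DERIV_diff has_real_derivative_along smooth_on_differentiable[OF f]) auto
  from MVT2[OF t this] obtain a where a: "0 < a" "a < t"
    "?g t - ?g 0 = t * (?Dv (x + t *\<^sub>R w + a *\<^sub>R v) - ?Dv (x + a *\<^sub>R v))" by auto
  let ?h = "\<lambda>b. ?Dv (x + a *\<^sub>R v + b *\<^sub>R w)"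
  have "(?h has_real_derivative frechet_derivative ?Dv (at (x + a *\<^sub>R v + b *\<^sub>R w)) w) (at b)"
    if "0 \<le> b" "b \<le> t" for b
    using S[of a b] that a
    by (intro has_real_derivative_along[where f = ?Dv] smooth_on_differentiable[OF smooth_on_deriv[OF f]]) auto
  from MVT2[OF t this] obtain b where b: "0 < b" "b < t"
    "?h t - ?h 0 = t * frechet_derivative ?Dv (at (x + a *\<^sub>R v + b *\<^sub>R w)) w" by auto
  have "?g t - ?g 0 = t * (?h t - ?h 0)" unfolding a(3) by (simp add: ac_simps)
  with a b show ?thesis by (intro that[of a b]) (auto simp: ac_simps)
qed

text \<open>The second difference over the parallelogram with sides t v and t w does not change when
  v and w are swapped, and it is t^2 times either mixed derivative at some point of the
  parallelogram. For small t continuity brings both values close to those at x.\<close>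

theorem symmetric_second_derivatives:
  fixes f :: "'a::euclidean_space \<Rightarrow> real"
  assumes S: "open S" "x \<in> S" and f: "smooth_on S f"
  shows "frechet_derivative (\<lambda>y. frechet_derivative f (at y) v) (at x) w
       = frechet_derivative (\<lambda>y. frechet_derivative f (at y) w) (at x) v"
proof -
  define A where "A v w = (\<lambda>y. frechet_derivative (\<lambda>y. frechet_derivative f (at y) v) (at y) w)" for v w
  have cont: "isCont (A v w) x" for v w
    using smooth_on_continuous[OF smooth_on_deriv[OF smooth_on_deriv[OF f, of v], of w]] S
    unfolding A_def by (simp add: continuous_on_eq_continuous_at)
  have "\<bar>A v w x - A w v x\<bar> \<le> e" if e: "e > 0" for e
  proof -
    from cont[of v w] e obtain d1 where d1: "d1 > 0" "\<And>y. dist y x < d1 \<Longrightarrow> dist (A v w y) (A v w x) < e/2"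
      unfolding continuous_at_eps_delta by (metis half_gt_zero)
    from cont[of w v] e obtain d2 where d2: "d2 > 0" "\<And>y. dist y x < d2 \<Longrightarrow> dist (A w v y) (A w v x) < e/2"
      unfolding continuous_at_eps_delta by (metis half_gt_zero)
    from S obtain d3 where d3: "d3 > 0" "ball x d3 \<subseteq> S" using open_contains_ball by blast
    define d where "d = min d1 (min d2 d3)"
    have d: "d > 0" using d1 d2 d3 by (simp add: d_def)
    \<comment> \<open>With this t the whole parallelogram stays within d/2 of x; the summand 1 keeps
      the denominator positive when v = w = 0.\<close>
    define t where "t = d / (2 * (1 + norm v + norm w))"
    have half: "d / (2 * c) * c = d / 2" if "c > 0" for c using that by simp
    have np: "1 + norm v + norm w > 0" by (smt (verit) norm_ge_zero)
    have t: "t > 0" using d np by (simp add: t_def)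
    have near: "dist (x + a *\<^sub>R v + b *\<^sub>R w) x < d" if "0 \<le> a" "a \<le> t" "0 \<le> b" "b \<le> t" for a b v' w'
    proof -
      have "dist (x + a *\<^sub>R v + b *\<^sub>R w) x = norm (a *\<^sub>R v + b *\<^sub>R w)" by (simp add: dist_norm add.assoc)
      also have "\<dots> \<le> norm (a *\<^sub>R v) + norm (b *\<^sub>R w)" by (rule norm_triangle_ineq)
      also have "\<dots> \<le> t * norm v + t * norm w" using that by (auto intro!: add_mono mult_right_mono)
      also have "\<dots> \<le> t * (1 + norm v + norm w)" using t by (simp add: algebra_simps)
      also have "\<dots> = d / 2" unfolding t_def by (rule half[OF np])
      also have "\<dots> < d" using d by simp
      finally show ?thesis .
    qed
    have near': "dist (x + a *\<^sub>R w + b *\<^sub>R v) x < d" if "0 \<le> a" "a \<le> t" "0 \<le> b" "b \<le> t" for a b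
      using near[OF that(3,4,1,2)] by (simp add: ac_simps)
    have inS: "y \<in> S" if "dist y x < d" for y using that d3 by (auto simp: d_def subset_iff dist_commute)
    obtain a b where ab: "0 \<le> a" "a \<le> t" "0 \<le> b" "b \<le> t"
      "f (x + t *\<^sub>R v + t *\<^sub>R w) - f (x + t *\<^sub>R v) - f (x + t *\<^sub>R w) + f x
       = t * t * A v w (x + a *\<^sub>R v + b *\<^sub>R w)"
      using second_difference[of t x v w S f] near inS t f unfolding A_def by metis
    obtain a' b' where ab': "0 \<le> a'" "a' \<le> t" "0 \<le> b'" "b' \<le> t"
      "f (x + t *\<^sub>R w + t *\<^sub>R v) - f (x + t *\<^sub>R w) - f (x + t *\<^sub>R v) + f x
       = t * t * A w v (x + a' *\<^sub>R w + b' *\<^sub>R v)"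
      using second_difference[of t x w v S f] near' inS t f unfolding A_def by metis
    have sw: "x + t *\<^sub>R w + t *\<^sub>R v = x + t *\<^sub>R v + t *\<^sub>R w" by simp
    have "t * t * A v w (x + a *\<^sub>R v + b *\<^sub>R w) = t * t * A w v (x + a' *\<^sub>R w + b' *\<^sub>R v)"
      using ab(5) ab'(5)[unfolded sw] by linarith
    then have eq: "A v w (x + a *\<^sub>R v + b *\<^sub>R w) = A w v (x + a' *\<^sub>R w + b' *\<^sub>R v)" using t by simp
    have "dist (A v w (x + a *\<^sub>R v + b *\<^sub>R w)) (A v w x) < e/2"
      using near[OF ab(1-4)] by (intro d1) (simp add: d_def)
    moreover have "dist (A w v (x + a' *\<^sub>R w + b' *\<^sub>R v)) (A w v x) < e/2"
      using near'[OF ab'(1-4)] by (intro d2) (simp add: d_def)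
    ultimately show ?thesis using eq unfolding dist_real_def by linarith
  qed
  then have "\<bar>A v w x - A w v x\<bar> \<le> 0" by (rule field_le_epsilon[of _ 0, simplified])
  then show ?thesis by (simp add: A_def)
qed

section \<open>Tangent vectors and vector fields in charts\<close>

lemma in_chart_eq: "in_chart c f = (\<lambda>x. f (inv_into (fst c) (snd c) x))"
  by (simp add: in_chart_def fun_eq_iff)

lemma scal_simps [simp]: "scal 1 v = v" "scal 0 v = 0" "scal a v + scal b v = scal (a + b) v"
  "scal a (scal b v) = scal (a * b) v"
  by (auto simp: scal_def fun_eq_iff algebra_simps)

definition crd :: "('m, 'e::euclidean_space) chart \<Rightarrow> 'e \<Rightarrow> 'm \<Rightarrow> real" where
  "crd c b = (\<lambda>q. snd c q \<bullet> b)"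

text \<open>The components of a tangent operator are recovered by applying it to the coordinate
  functions \<open>crd c b\<close>. These are total functions, but only their germs at points of the
  chart domain matter, and there they are smooth.\<close>

definition coords :: "('m, 'e::euclidean_space) chart \<Rightarrow> 'm tangent \<Rightarrow> 'e" where
  "coords c v = (\<Sum>b\<in>Basis. v (crd c b) *\<^sub>R b)"

lemma coords_inner: "b \<in> Basis \<Longrightarrow> coords c v \<bullet> b = v (crd c b)"
  by (simp add: coords_def inner_sum_left inner_Basis if_distrib cong: if_cong)

lemma coords_lincomb2: "coords c (scal a v + scal b w) = a *\<^sub>R coords c v + b *\<^sub>R coords c w"
  by (simp add: coords_def scal_def scaleR_sum_right sum.distrib scaleR_left_distrib)

lemma frame4_simps [simp]: "frame4 a b c d 1 = a" "frame4 a b c d 2 = b" "frame4 a b c d 3 = c" "frame4 a b c d 4 = d"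
  by (simp_all add: frame4_def)

locale manifold =
  fixes A :: "('m::{t2_space, second_countable_topology}, 'e::euclidean_space) atlas"
  assumes manifold: "smooth_manifold A"
begin

lemma chart_homeo:
  assumes "c \<in> A"
  shows "open (fst c)" "open (snd c ` fst c)"
    "homeomorphism (fst c) (snd c ` fst c) (snd c) (inv_into (fst c) (snd c))"
  using manifold assms unfolding smooth_manifold_def by (auto simp: case_prod_beta)

lemma chart_inj: "c \<in> A \<Longrightarrow> inj_on (snd c) (fst c)"
  using chart_homeo(3) unfolding homeomorphism_def by (metis inj_on_inverseI)

lemma chart_transition:
  "c \<in> A \<Longrightarrow> d \<in> A \<Longrightarrow> smooth_on (snd c ` (fst c \<inter> fst d)) (in_chart c (snd d))"
  using manifold unfolding smooth_manifold_def by blast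

lemma chart_sub_carrier: "c \<in> A \<Longrightarrow> fst c \<subseteq> carrier A"
  unfolding carrier_def by blast

lemma carrier_chart: "p \<in> carrier A \<Longrightarrow> \<exists>c\<in>A. p \<in> fst c"
  unfolding carrier_def by blast

lemma open_carrier: "open (carrier A)"
  unfolding carrier_def using chart_homeo(1) by auto

lemma chart_open_image:
  assumes "c \<in> A" "open N" shows "open (snd c ` (fst c \<inter> N))"
proof -
  have "openin (top_of_set (fst c)) (fst c \<inter> N)" using assms(2) by (simp add: openin_open_Int)
  from homeomorphism_imp_open_map[OF chart_homeo(3)[OF assms(1)] this]
  show ?thesis using chart_homeo(2)[OF assms(1)] openin_open_trans by blast
qed

lemma chart_open_image': "c \<in> A \<Longrightarrow> open N \<Longrightarrow> N \<subseteq> fst c \<Longrightarrow> open (snd c ` N)"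
  using chart_open_image by (metis inf.absorb_iff2)

lemma in_chart_at [simp]: "c \<in> A \<Longrightarrow> p \<in> fst c \<Longrightarrow> in_chart c f (snd c p) = f p"
  using chart_inj by (simp add: in_chart_def)

section \<open>Smooth functions on a manifold\<close>

lemma smooth_fun_subset: "smooth_fun A N f \<Longrightarrow> N' \<subseteq> N \<Longrightarrow> smooth_fun A N' f"
  unfolding smooth_fun_def using smooth_on_subset by (metis Int_mono image_mono subset_refl)

lemma smooth_fun_cong:
  assumes "open N" "\<And>p. p \<in> N \<Longrightarrow> f p = g p" "smooth_fun A N f"
  shows "smooth_fun A N g"
  unfolding smooth_fun_def
proof
  fix c assume c: "c \<in> A"
  show "smooth_on (snd c ` (fst c \<inter> N)) (in_chart c g)"
    by (rule smooth_on_cong[OF chart_open_image[OF c assms(1)], of "in_chart c f"])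
      (use assms c in \<open>auto simp: smooth_fun_def\<close>)
qed

lemma smooth_fun_local:
  assumes "\<And>p. p \<in> N \<Longrightarrow> \<exists>N'. open N' \<and> p \<in> N' \<and> smooth_fun A N' f"
  shows "smooth_fun A N f"
  unfolding smooth_fun_def
proof
  fix c assume c: "c \<in> A"
  show "smooth_on (snd c ` (fst c \<inter> N)) (in_chart c f)"
  proof (rule smooth_on_local)
    fix x assume "x \<in> snd c ` (fst c \<inter> N)"
    then obtain p where p: "p \<in> fst c" "p \<in> N" "x = snd c p" by blast
    then obtain N' where "open N'" "p \<in> N'" "smooth_fun A N' f" using assms by blast
    then show "\<exists>T. open T \<and> x \<in> T \<and> smooth_on T (in_chart c f)"
      using chart_open_image[OF c] p c unfolding smooth_fun_def
      by (intro exI[of _ "snd c ` (fst c \<inter> N')"]) blast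
  qed
qed

text \<open>\<open>smooth_fun\<close> tests every chart of the atlas; the expression in a chart d is
  the one in c composed with the smooth transition from d to c.\<close>

lemma smooth_fun_chartI:
  assumes c: "c \<in> A" and N: "open N" "N \<subseteq> fst c" and f: "smooth_on (snd c ` N) (in_chart c f)"
  shows "smooth_fun A N f"
  unfolding smooth_fun_def
proof
  fix d assume d: "d \<in> A"
  have op: "open (snd d ` (fst d \<inter> N))" using chart_open_image[OF d N(1)] .
  show "smooth_on (snd d ` (fst d \<inter> N)) (in_chart d f)"
  proof (rule smooth_on_cong[OF op])
    show "smooth_on (snd d ` (fst d \<inter> N)) (\<lambda>x. in_chart c f (in_chart d (snd c) x))"
      by (rule smooth_on_compose[OF op _ _ f])
        (use N d chart_transition[OF d c] in \<open>auto intro: smooth_on_subset\<close>)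
    show "in_chart c f (in_chart d (snd c) x) = in_chart d f x" if "x \<in> snd d ` (fst d \<inter> N)" for x
      using that N c d by auto
  qed
qed

lemma smooth_funD:
  "smooth_fun A N f \<Longrightarrow> c \<in> A \<Longrightarrow> N \<subseteq> fst c \<Longrightarrow> smooth_on (snd c ` N) (in_chart c f)"
  unfolding smooth_fun_def by (metis inf.absorb_iff2)

lemma smooth_fun_const: "smooth_fun A N (\<lambda>p. a)"
  unfolding smooth_fun_def in_chart_eq by (auto intro: smooth_on_const)

lemma smooth_fun_add:
  "open N \<Longrightarrow> smooth_fun A N f \<Longrightarrow> smooth_fun A N g \<Longrightarrow> smooth_fun A N (\<lambda>p. f p + g p)"
  using chart_open_image[of _ N] unfolding smooth_fun_def in_chart_eq by (auto intro: smooth_on_add)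

lemma smooth_fun_mult:
  "open N \<Longrightarrow> smooth_fun A N f \<Longrightarrow> smooth_fun A N g \<Longrightarrow> smooth_fun A N (\<lambda>p. f p * g p)"
  using chart_open_image[of _ N] unfolding smooth_fun_def in_chart_eq by (auto intro: smooth_on_mult)

lemma smooth_fun_minus: "open N \<Longrightarrow> smooth_fun A N f \<Longrightarrow> smooth_fun A N (\<lambda>p. - f p)"
  using smooth_fun_mult[OF _ smooth_fun_const[of N "-1"], of f] by simp

lemma smooth_fun_diff:
  "open N \<Longrightarrow> smooth_fun A N f \<Longrightarrow> smooth_fun A N g \<Longrightarrow> smooth_fun A N (\<lambda>p. f p - g p)"
  using smooth_fun_add[OF _ _ smooth_fun_minus, of N f g] by simp

lemma smooth_fun_sum:
  "open N \<Longrightarrow> (\<And>i. i \<in> I \<Longrightarrow> smooth_fun A N (f i)) \<Longrightarrow> smooth_fun A N (\<lambda>p. \<Sum>i\<in>I. f i p)"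
  by (induction I rule: infinite_finite_induct) (auto intro: smooth_fun_add smooth_fun_const)

lemma smooth_fun_inverse:
  assumes "open N" "smooth_fun A N f" "\<And>p. p \<in> N \<Longrightarrow> f p \<noteq> 0"
  shows "smooth_fun A N (\<lambda>p. inverse (f p))"
  unfolding smooth_fun_def
proof
  fix c assume c: "c \<in> A"
  have "smooth_on (snd c ` (fst c \<inter> N)) (\<lambda>x. inverse (in_chart c f x))"
    by (rule smooth_on_inverse[OF chart_open_image[OF c assms(1)]])
      (use assms c in \<open>auto simp: smooth_fun_def\<close>)
  then show "smooth_on (snd c ` (fst c \<inter> N)) (in_chart c (\<lambda>p. inverse (f p)))"
    by (simp add: in_chart_eq)
qed

lemma smooth_fun_divide:
  "open N \<Longrightarrow> smooth_fun A N f \<Longrightarrow> smooth_fun A N g \<Longrightarrow> (\<And>p. p \<in> N \<Longrightarrow> g p \<noteq> 0)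
    \<Longrightarrow> smooth_fun A N (\<lambda>p. f p / g p)"
  unfolding divide_inverse by (intro smooth_fun_mult smooth_fun_inverse)

lemma smooth_fun_continuous:
  assumes "smooth_fun A N f" "open N" "N \<subseteq> carrier A"
  shows "continuous_on N f"
proof (rule continuous_at_imp_continuous_on, rule ballI)
  fix p assume p: "p \<in> N"
  obtain c where c: "c \<in> A" "p \<in> fst c" using carrier_chart assms(3) p by blast
  let ?N = "fst c \<inter> N"
  have op: "open ?N" using c assms(2) chart_homeo(1) by blast
  have "continuous_on (snd c ` ?N) (in_chart c f)"
    using assms(1) c(1) smooth_on_continuous unfolding smooth_fun_def by blast
  moreover have "continuous_on ?N (snd c)"
    using chart_homeo(3)[OF c(1)] unfolding homeomorphism_def by (metis continuous_on_subset inf_le1)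
  ultimately have "continuous_on ?N (\<lambda>q. in_chart c f (snd c q))"
    by (rule continuous_on_compose2) auto
  then have "continuous_on ?N f" by (rule continuous_on_eq) (use c in auto)
  then show "isCont f p" using op p c continuous_on_eq_continuous_at by blast
qed

lemma smooth_atI:
  "open N \<Longrightarrow> p \<in> N \<Longrightarrow> N \<subseteq> carrier A \<Longrightarrow> smooth_fun A N f \<Longrightarrow> smooth_at A p f"
  unfolding smooth_at_def by blast

text \<open>The case distinction in \<open>dir_deriv\<close> and \<open>bracket\<close> asks for
  smoothness at p, so this has to be a property of the germ before tangent vectors can be local
  operators.\<close>

lemma smooth_at_cong:
  assumes "open N" "p \<in> N" "\<And>q. q \<in> N \<Longrightarrow> f q = g q"
  shows "smooth_at A p f \<longleftrightarrow> smooth_at A p g"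
proof -
  have *: "smooth_at A p g" if "smooth_at A p f" "\<And>q. q \<in> N \<Longrightarrow> f q = g q" for f g
  proof -
    obtain N' where N': "open N'" "p \<in> N'" "N' \<subseteq> carrier A" "smooth_fun A N' f"
      using \<open>smooth_at A p f\<close> unfolding smooth_at_def by blast
    have "smooth_fun A (N \<inter> N') g"
      by (rule smooth_fun_cong[OF _ _ smooth_fun_subset[OF N'(4)]]) (use N' assms(1) that(2) in auto)
    then show ?thesis using N' assms by (intro smooth_atI[of "N \<inter> N'"]) auto
  qed
  show ?thesis using *[of f g] *[of g f] assms(3) by metis
qed

lemma smooth_at_chart:
  assumes "smooth_at A p f" "c \<in> A" "p \<in> fst c"
  obtains N where "open N" "p \<in> N" "N \<subseteq> fst c" "smooth_fun A N f" "smooth_on (snd c ` N) (in_chart c f)"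
proof -
  obtain N where N: "open N" "p \<in> N" "smooth_fun A N f"
    using assms(1) unfolding smooth_at_def by blast
  have N2: "smooth_fun A (N \<inter> fst c) f" using smooth_fun_subset[OF N(3)] by blast
  show ?thesis
    by (rule that[of "N \<inter> fst c"]) (use N N2 assms chart_homeo(1)[OF assms(2)] smooth_funD[OF N2 assms(2)] in auto)
qed

lemma smooth_at_carrier: "smooth_at A p f \<Longrightarrow> p \<in> carrier A"
  unfolding smooth_at_def by blast

lemma smooth_at_differentiable:
  "smooth_at A p f \<Longrightarrow> c \<in> A \<Longrightarrow> p \<in> fst c \<Longrightarrow> in_chart c f differentiable (at (snd c p))"
  by (metis imageI smooth_at_chart smooth_on_differentiable)

lemma smooth_at_const: "p \<in> carrier A \<Longrightarrow> smooth_at A p (\<lambda>q. a)"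
  using smooth_atI[OF open_carrier] smooth_fun_const by blast

lemma smooth_at_add:
  assumes "smooth_at A p f" "smooth_at A p g" shows "smooth_at A p (\<lambda>q. f q + g q)"
proof -
  obtain N1 N2 where "open N1" "p \<in> N1" "N1 \<subseteq> carrier A" "smooth_fun A N1 f"
    "open N2" "p \<in> N2" "N2 \<subseteq> carrier A" "smooth_fun A N2 g"
    using assms unfolding smooth_at_def by blast
  then show ?thesis
    by (intro smooth_atI[of "N1 \<inter> N2"] smooth_fun_add) (auto intro: smooth_fun_subset)
qed

lemma smooth_at_mult:
  assumes "smooth_at A p f" "smooth_at A p g" shows "smooth_at A p (\<lambda>q. f q * g q)"
proof -
  obtain N1 N2 where "open N1" "p \<in> N1" "N1 \<subseteq> carrier A" "smooth_fun A N1 f"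
    "open N2" "p \<in> N2" "N2 \<subseteq> carrier A" "smooth_fun A N2 g"
    using assms unfolding smooth_at_def by blast
  then show ?thesis
    by (intro smooth_atI[of "N1 \<inter> N2"] smooth_fun_mult) (auto intro: smooth_fun_subset)
qed

section \<open>Tangent spaces and derivations\<close>

lemma dir_deriv_apply:
  "smooth_at A p f \<Longrightarrow> dir_deriv A c p w f = frechet_derivative (in_chart c f) (at (snd c p)) w"
  by (simp add: dir_deriv_def)

lemma dir_deriv_cong:
  assumes "c \<in> A" "p \<in> fst c" "open N" "p \<in> N" "\<And>q. q \<in> N \<Longrightarrow> f q = g q"
  shows "dir_deriv A c p w f = dir_deriv A c p w g"
proof -
  have "frechet_derivative (in_chart c f) (at (snd c p)) = frechet_derivative (in_chart c g) (at (snd c p))"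
    by (rule frechet_derivative_cong_open[of "snd c ` (fst c \<inter> N)"])
      (use assms chart_open_image in auto)
  then show ?thesis unfolding dir_deriv_def using smooth_at_cong[OF assms(3-5)] by simp
qed

lemma dir_deriv_lincomb:
  assumes "c \<in> A" "p \<in> fst c"
  shows "scal a (dir_deriv A c p w) + scal b (dir_deriv A c p w') = dir_deriv A c p (a *\<^sub>R w + b *\<^sub>R w')"
proof
  fix f
  show "(scal a (dir_deriv A c p w) + scal b (dir_deriv A c p w')) f = dir_deriv A c p (a *\<^sub>R w + b *\<^sub>R w') f"
  proof (cases "smooth_at A p f")
    case True
    interpret bounded_linear "frechet_derivative (in_chart c f) (at (snd c p))"
      by (intro frechet_derivative_bounded_linear smooth_at_differentiable True assms)
    show ?thesis using True by (simp add: scal_def dir_deriv_apply add scaleR)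
  qed (simp add: scal_def dir_deriv_def)
qed

text \<open>The chain rule for the transition map. It lets any one chart around p represent the
  whole tangent space, although \<open>tangent_space\<close> collects derivatives from all
  charts.\<close>

lemma dir_deriv_change:
  assumes c: "c \<in> A" "p \<in> fst c" and d: "d \<in> A" "p \<in> fst d"
  shows "dir_deriv A d p w = dir_deriv A c p (frechet_derivative (in_chart d (snd c)) (at (snd d p)) w)"
proof
  fix f
  show "dir_deriv A d p w f = dir_deriv A c p (frechet_derivative (in_chart d (snd c)) (at (snd d p)) w) f"
  proof (cases "smooth_at A p f")
    case True
    have t: "in_chart d (snd c) differentiable (at (snd d p))"
      using smooth_on_differentiable[OF chart_transition[OF d(1) c(1)]] c d by blast
    have f: "in_chart c f differentiable (at (in_chart d (snd c) (snd d p)))"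
      using smooth_at_differentiable[OF True c] d by simp
    have "frechet_derivative (in_chart d f) (at (snd d p))
        = frechet_derivative (\<lambda>x. in_chart c f (in_chart d (snd c) x)) (at (snd d p))"
      by (rule frechet_derivative_cong_open[of "snd d ` (fst d \<inter> fst c)"])
        (use c d chart_open_image[OF d(1)] chart_homeo(1)[OF c(1)] in auto)
    also have "\<dots> = frechet_derivative (in_chart c f) (at (in_chart d (snd c) (snd d p)))
        \<circ> frechet_derivative (in_chart d (snd c)) (at (snd d p))"
      using frechet_derivative_compose[OF t f] by (simp add: o_def)
    finally show ?thesis using True d by (simp add: dir_deriv_apply)
  qed (simp add: dir_deriv_def)
qed

lemma tangent_space_chart:
  assumes "c \<in> A" "p \<in> fst c" shows "tangent_space A p = range (dir_deriv A c p)"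
proof
  show "tangent_space A p \<subseteq> range (dir_deriv A c p)"
    unfolding tangent_space_def using dir_deriv_change[OF assms] by blast
  show "range (dir_deriv A c p) \<subseteq> tangent_space A p" unfolding tangent_space_def using assms by blast
qed

lemma tangent_carrier: "v \<in> tangent_space A p \<Longrightarrow> p \<in> carrier A"
  unfolding tangent_space_def using chart_sub_carrier by blast

lemma tangentE:
  assumes "v \<in> tangent_space A p"
  obtains c w where "c \<in> A" "p \<in> fst c" "v = dir_deriv A c p w"
  using assms unfolding tangent_space_def by blast

lemma tangent_lincomb2:
  assumes "v \<in> tangent_space A p" "w \<in> tangent_space A p"
  shows "scal a v + scal b w \<in> tangent_space A p"
proof -
  obtain c v' where c: "c \<in> A" "p \<in> fst c" "v = dir_deriv A c p v'" using assms(1) by (rule tangentE)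
  obtain w' where "w = dir_deriv A c p w'" using assms(2) tangent_space_chart[OF c(1,2)] by blast
  then show ?thesis using c dir_deriv_lincomb[OF c(1,2)] tangent_space_chart[OF c(1,2)] by simp
qed

lemma tangent_add: "v \<in> tangent_space A p \<Longrightarrow> w \<in> tangent_space A p \<Longrightarrow> v + w \<in> tangent_space A p"
  using tangent_lincomb2[of v p w 1 1] by simp

lemma tangent_scal: "v \<in> tangent_space A p \<Longrightarrow> scal a v \<in> tangent_space A p"
  using tangent_lincomb2[of v p v a 0] by simp

lemma tangent_zero: "p \<in> carrier A \<Longrightarrow> 0 \<in> tangent_space A p"
proof -
  assume "p \<in> carrier A"
  then obtain c where "c \<in> A" "p \<in> fst c" using carrier_chart by blast
  then have "dir_deriv A c p 0 \<in> tangent_space A p" unfolding tangent_space_def by blast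
  from tangent_scal[OF this, of 0] show ?thesis by simp
qed

lemma tangent_sum:
  "p \<in> carrier A \<Longrightarrow> (\<And>i. i \<in> I \<Longrightarrow> v i \<in> tangent_space A p) \<Longrightarrow> (\<Sum>i\<in>I. v i) \<in> tangent_space A p"
  by (induction I rule: infinite_finite_induct) (auto intro: tangent_add tangent_zero)

lemma tangent_cong:
  assumes "v \<in> tangent_space A p" "open N" "p \<in> N" "\<And>q. q \<in> N \<Longrightarrow> f q = g q"
  shows "v f = v g"
  using assms(1) by (rule tangentE) (use dir_deriv_cong assms(2-4) in metis)

lemma tangent_const: "v \<in> tangent_space A p \<Longrightarrow> v (\<lambda>q. a) = 0"
  by (erule tangentE) (simp add: dir_deriv_def in_chart_eq)

lemma tangent_fun_add:
  assumes "v \<in> tangent_space A p" "smooth_at A p f" "smooth_at A p g"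
  shows "v (\<lambda>q. f q + g q) = v f + v g"
proof -
  obtain c w where c: "c \<in> A" "p \<in> fst c" "v = dir_deriv A c p w" using assms(1) by (rule tangentE)
  have "((\<lambda>x. in_chart c f x + in_chart c g x) has_derivative (\<lambda>v. frechet_derivative (in_chart c f) (at (snd c p)) v
     + frechet_derivative (in_chart c g) (at (snd c p)) v)) (at (snd c p))"
    using assms(2,3) smooth_at_differentiable c
    by (intro has_derivative_add) (auto simp: frechet_derivative_works[symmetric])
  from fun_cong[OF frechet_derivative_at[OF this], of w, symmetric]
  show ?thesis using assms smooth_at_add[OF assms(2,3)] c
    by (simp add: dir_deriv_apply) (simp add: in_chart_eq)
qed

lemma tangent_fun_mult:
  assumes "v \<in> tangent_space A p" "smooth_at A p f" "smooth_at A p g"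
  shows "v (\<lambda>q. f q * g q) = v f * g p + f p * v g"
proof -
  obtain c w where c: "c \<in> A" "p \<in> fst c" "v = dir_deriv A c p w" using assms(1) by (rule tangentE)
  have "frechet_derivative (\<lambda>x. in_chart c f x *\<^sub>R in_chart c g x) (at (snd c p)) w
    = in_chart c f (snd c p) *\<^sub>R frechet_derivative (in_chart c g) (at (snd c p)) w
      + frechet_derivative (in_chart c f) (at (snd c p)) w *\<^sub>R in_chart c g (snd c p)"
    using assms(2,3) smooth_at_differentiable c by (intro frechet_derivative_scaleR) auto
  then show ?thesis using assms smooth_at_mult[OF assms(2,3)] c
    by (simp add: dir_deriv_apply) (simp add: in_chart_eq)
qed

lemma tangent_fun_cmult:
  "v \<in> tangent_space A p \<Longrightarrow> smooth_at A p f \<Longrightarrow> v (\<lambda>q. a * f q) = a * v f"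
  using tangent_fun_mult[OF _ smooth_at_const[OF smooth_at_carrier], of v p f f a] by (simp add: tangent_const smooth_at_carrier)

lemma tangent_fun_diff:
  assumes "v \<in> tangent_space A p" "smooth_at A p f" "smooth_at A p g"
  shows "v (\<lambda>q. f q - g q) = v f - v g"
proof -
  have "smooth_at A p (\<lambda>q. -1 * g q)"
    using smooth_at_mult[OF smooth_at_const[OF smooth_at_carrier[OF assms(2)], of "-1"] assms(3)] .
  from tangent_fun_add[OF assms(1,2) this] show ?thesis
    using tangent_fun_cmult[OF assms(1,3), of "-1"] by simp
qed

lemma smooth_at_sum:
  "p \<in> carrier A \<Longrightarrow> (\<And>i. i \<in> I \<Longrightarrow> smooth_at A p (f i)) \<Longrightarrow> smooth_at A p (\<lambda>q. \<Sum>i\<in>I. f i q)"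
  by (induction I rule: infinite_finite_induct) (auto intro: smooth_at_add smooth_at_const)

lemma tangent_fun_sum:
  assumes "v \<in> tangent_space A p" "\<And>i. i \<in> I \<Longrightarrow> smooth_at A p (f i)"
  shows "v (\<lambda>q. \<Sum>i\<in>I. f i q) = (\<Sum>i\<in>I. v (f i))"
  using assms(2)
proof (induction I rule: infinite_finite_induct)
  case (insert i I)
  then show ?case
    using tangent_fun_add[OF assms(1), of "f i" "\<lambda>q. \<Sum>i\<in>I. f i q"]
      smooth_at_sum[OF tangent_carrier[OF assms(1)], of I f] by simp
qed (simp_all add: tangent_const[OF assms(1)])

section \<open>Components of tangent vectors in a chart\<close>

lemma in_chart_crd: "c \<in> A \<Longrightarrow> x \<in> snd c ` fst c \<Longrightarrow> in_chart c (crd c b) x = x \<bullet> b"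
  by (auto simp: crd_def)

lemma smooth_crd: "c \<in> A \<Longrightarrow> smooth_fun A (fst c) (crd c b)"
  by (rule smooth_fun_chartI[of c], simp_all add: chart_homeo,
      rule smooth_on_cong[of "snd c ` fst c" "\<lambda>x. x \<bullet> b"])
    (simp_all add: in_chart_crd chart_homeo smooth_on_linear bounded_linear_inner_left)

lemma smooth_at_crd: "c \<in> A \<Longrightarrow> p \<in> fst c \<Longrightarrow> smooth_at A p (crd c b)"
  using smooth_atI[OF chart_homeo(1) _ chart_sub_carrier smooth_crd] by blast

lemma dir_deriv_crd:
  assumes "c \<in> A" "p \<in> fst c" shows "dir_deriv A c p w (crd c b) = w \<bullet> b"
proof -
  have "frechet_derivative (in_chart c (crd c b)) (at (snd c p)) = frechet_derivative (\<lambda>x. x \<bullet> b) (at (snd c p))"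
    using assms chart_homeo in_chart_crd by (intro frechet_derivative_cong_open[of "snd c ` fst c"]) auto
  also have "\<dots> = (\<lambda>x. x \<bullet> b)"
    using bounded_linear_imp_has_derivative[OF bounded_linear_inner_left] frechet_derivative_at by metis
  finally show ?thesis using smooth_at_crd[OF assms] by (simp add: dir_deriv_apply)
qed

lemma coords_dir_deriv [simp]: "c \<in> A \<Longrightarrow> p \<in> fst c \<Longrightarrow> coords c (dir_deriv A c p w) = w"
  by (simp add: coords_def dir_deriv_crd euclidean_representation)

lemma dir_deriv_coords:
  "c \<in> A \<Longrightarrow> p \<in> fst c \<Longrightarrow> v \<in> tangent_space A p \<Longrightarrow> dir_deriv A c p (coords c v) = v"
  using tangent_space_chart by auto

lemma tangent_eqI:
  "c \<in> A \<Longrightarrow> p \<in> fst c \<Longrightarrow> v \<in> tangent_space A p \<Longrightarrow> w \<in> tangent_space A p \<Longrightarrow> coords c v = coords c w \<Longrightarrow> v = w"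
  by (metis dir_deriv_coords)

section \<open>Vector fields and their local components\<close>

lemma vector_field_tangent: "vector_field A N X \<Longrightarrow> p \<in> N \<Longrightarrow> X p \<in> tangent_space A p"
  by (simp add: vector_field_def)

lemma vector_field_outside: "vector_field A N X \<Longrightarrow> p \<notin> N \<Longrightarrow> X p = 0"
  by (simp add: vector_field_def)

lemma vector_field_smooth:
  "vector_field A N X \<Longrightarrow> open N' \<Longrightarrow> N' \<subseteq> N \<Longrightarrow> smooth_fun A N' f \<Longrightarrow> smooth_fun A N' (\<lambda>p. X p f)"
  by (simp add: vector_field_def)

lemma vector_field_carrier: "vector_field A N X \<Longrightarrow> N \<subseteq> carrier A"
  using vector_field_tangent tangent_carrier by blast

lemma smooth_at_vector_field:
  assumes X: "vector_field A N X" "open N" "p \<in> N" and f: "smooth_at A p f"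
  shows "smooth_at A p (\<lambda>q. X q f)"
proof -
  obtain N' where N': "open N'" "p \<in> N'" "N' \<subseteq> carrier A" "smooth_fun A N' f"
    using f unfolding smooth_at_def by blast
  then have "smooth_fun A (N \<inter> N') (\<lambda>q. X q f)"
    using X by (intro vector_field_smooth[OF X(1)]) (auto intro: smooth_fun_subset)
  then show ?thesis using N' X by (intro smooth_atI[of "N \<inter> N'"]) auto
qed

lemma smooth_fun_at: "smooth_fun A N f \<Longrightarrow> open N \<Longrightarrow> N \<subseteq> carrier A \<Longrightarrow> p \<in> N \<Longrightarrow> smooth_at A p f"
  using smooth_atI by blast

text \<open>In a chart X f is the sum of the components of X times the partial derivatives of f, so
  smooth components suffice.\<close>

lemma vector_fieldI_chart:
  assumes N: "\<And>p. p \<notin> N \<Longrightarrow> X p = 0"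
    and loc: "\<And>p. p \<in> N \<Longrightarrow> \<exists>c N0 w. c \<in> A \<and> open N0 \<and> p \<in> N0 \<and> N0 \<subseteq> fst c \<and> smooth_on (snd c ` N0) w
      \<and> (\<forall>q\<in>N0. X q = dir_deriv A c q (w (snd c q)))"
  shows "vector_field A N X"
  unfolding vector_field_def
proof (intro conjI allI ballI impI)
  show "X p \<in> tangent_space A p" if "p \<in> N" for p
    using loc[OF that] unfolding tangent_space_def by blast
  show "X p = 0" if "p \<notin> N" for p using N that by blast
  fix N' f assume N': "open N' \<and> N' \<subseteq> N \<and> smooth_fun A N' f"
  show "smooth_fun A N' (\<lambda>p. X p f)"
  proof (rule smooth_fun_local)
    fix p assume p: "p \<in> N'"
    obtain c N0 w where c: "c \<in> A" "open N0" "p \<in> N0" "N0 \<subseteq> fst c" and w: "smooth_on (snd c ` N0) w"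
      and X: "\<forall>q\<in>N0. X q = dir_deriv A c q (w (snd c q))" using loc N' p by blast
    let ?N = "N0 \<inter> N'"
    have op: "open ?N" using c N' by blast
    have op2: "open (snd c ` ?N)" using chart_open_image'[OF c(1) op] c(4) by blast
    have f: "smooth_fun A ?N f" using N' smooth_fun_subset by blast
    have f2: "smooth_on (snd c ` ?N) (in_chart c f)" using smooth_funD[OF f c(1)] c(4) by blast
    have sub: "?N \<subseteq> carrier A" using c chart_sub_carrier by blast
    have "smooth_fun A ?N (\<lambda>p. X p f)"
    proof (rule smooth_fun_chartI[OF c(1) op])
      show "?N \<subseteq> fst c" using c by blast
      show "smooth_on (snd c ` ?N) (in_chart c (\<lambda>p. X p f))"
      proof (rule smooth_on_cong[OF op2])
        show "smooth_on (snd c ` ?N) (\<lambda>x. \<Sum>b\<in>Basis. (w x \<bullet> b) *\<^sub>R frechet_derivative (in_chart c f) (at x) b)"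
          by (intro smooth_on_sum smooth_on_scaleR op2 smooth_on_deriv f2 smooth_on_linear_comp[OF bounded_linear_inner_left]
              smooth_on_subset[OF w]) auto
        fix x assume "x \<in> snd c ` ?N"
        then obtain q where q: "q \<in> ?N" "x = snd c q" by blast
        have "in_chart c f differentiable (at x)" using smooth_on_differentiable[OF f2] q by blast
        then show "(\<Sum>b\<in>Basis. (w x \<bullet> b) *\<^sub>R frechet_derivative (in_chart c f) (at x) b) = in_chart c (\<lambda>p. X p f) x"
          using q X c(1,4) smooth_fun_at[OF f op sub q(1)] frechet_derivative_expand[of "in_chart c f" x "w x"]
          by (auto simp: dir_deriv_apply subset_iff)
      qed
    qed
    then show "\<exists>N''. open N'' \<and> p \<in> N'' \<and> smooth_fun A N'' (\<lambda>p. X p f)" using op c p by blast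
  qed
qed

text \<open>Converse of the previous criterion: a component is X applied to a coordinate function,
  which is smooth on the chart domain.\<close>

lemma coords_vector_field_smooth:
  assumes X: "vector_field A N X" and "open N" and c: "c \<in> A"
  shows "smooth_on (snd c ` (fst c \<inter> N)) (in_chart c (\<lambda>q. coords c (X q)))"
proof (rule smooth_on_componentwise)
  show op: "open (snd c ` (fst c \<inter> N))" using chart_open_image assms by blast
  fix b :: 'e assume b: "b \<in> Basis"
  have "smooth_fun A (fst c \<inter> N) (\<lambda>q. X q (crd c b))"
    using assms(2) chart_homeo(1)[OF c] smooth_fun_subset[OF smooth_crd[OF c]]
    by (intro vector_field_smooth[OF X]) auto
  from smooth_funD[OF this c]
  show "smooth_on (snd c ` (fst c \<inter> N)) (\<lambda>x. in_chart c (\<lambda>q. coords c (X q)) x \<bullet> b)"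
    by (simp add: in_chart_eq coords_inner[OF b])
qed

lemma vector_field_chart:
  assumes X: "vector_field A N X" and "open N" and c: "c \<in> A" "p \<in> fst c" "p \<in> N"
  shows "X p = dir_deriv A c p (in_chart c (\<lambda>q. coords c (X q)) (snd c p))"
  using dir_deriv_coords[OF c(1,2) vector_field_tangent[OF X c(3)]] c by simp

lemma vector_field_add: "open N \<Longrightarrow> vector_field A N X \<Longrightarrow> vector_field A N Y \<Longrightarrow> vector_field A N (X + Y)"
  unfolding vector_field_def by (auto intro: tangent_add smooth_fun_add)

lemma vector_field_fscal:
  assumes "vector_field A N X" "smooth_fun A N h" shows "vector_field A N (fscal h X)"
  using assms smooth_fun_mult smooth_fun_subset[OF assms(2)] unfolding vector_field_def
  by (auto simp: fscal_def intro: tangent_scal) (auto simp: scal_def fun_eq_iff)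

lemma vector_field_restr:
  "vector_field A N' X \<Longrightarrow> N \<subseteq> N' \<Longrightarrow> vector_field A N (restr N X)"
proof -
  assume a: "vector_field A N' X" "N \<subseteq> N'"
  show ?thesis unfolding vector_field_def
  proof (intro conjI allI ballI impI)
    fix M f assume M: "open M \<and> M \<subseteq> N \<and> smooth_fun A M f"
    show "smooth_fun A M (\<lambda>p. restr N X p f)"
      by (rule smooth_fun_cong[of M "\<lambda>p. X p f"]) (use M a vector_field_smooth[OF a(1)] in \<open>auto simp: restr_def subset_iff\<close>)
  qed (use a in \<open>auto simp: restr_def vector_field_tangent\<close>)
qed

section \<open>The Lie bracket\<close>

text \<open>The bracket at p sees only the germs of the fields. It is used to pass from fields on
  the whole product to their restrictions to the set where \<open>f2\<close> is nonzero.\<close>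

lemma bracket_cong:
  assumes N: "open N" "p \<in> N" "\<And>q. q \<in> N \<Longrightarrow> X q = X' q" "\<And>q. q \<in> N \<Longrightarrow> Y q = Y' q"
    and "X p \<in> tangent_space A p" "Y p \<in> tangent_space A p"
  shows "bracket A X Y p = bracket A X' Y' p"
proof -
  have "X p (\<lambda>q. Y q f) = X p (\<lambda>q. Y' q f)" "Y p (\<lambda>q. X q f) = Y p (\<lambda>q. X' q f)" for f
    by (rule tangent_cong[OF assms(5) N(1,2)], simp add: N(4),
        rule tangent_cong[OF assms(6) N(1,2)], simp add: N(3))
  then show ?thesis using N by (simp add: bracket_def fun_eq_iff)
qed

text \<open>The second derivatives of the test function cancel by symmetry.\<close>

lemma bracket_chart:
  assumes X: "vector_field A N X" and Y: "vector_field A N Y" and N: "open N" "p \<in> N"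
    and c: "c \<in> A" "p \<in> fst c"
  defines "\<xi> \<equiv> in_chart c (\<lambda>q. coords c (X q))" and "\<eta> \<equiv> in_chart c (\<lambda>q. coords c (Y q))"
  shows "bracket A X Y p = dir_deriv A c p (frechet_derivative \<eta> (at (snd c p)) (\<xi> (snd c p))
    - frechet_derivative \<xi> (at (snd c p)) (\<eta> (snd c p)))"
proof
  fix f
  let ?x = "snd c p"
  show "bracket A X Y p f = dir_deriv A c p (frechet_derivative \<eta> (at ?x) (\<xi> ?x)
    - frechet_derivative \<xi> (at ?x) (\<eta> ?x)) f"
  proof (cases "smooth_at A p f")
    case False then show ?thesis by (simp add: bracket_def dir_deriv_def)
  next
    case True
    obtain N1 where N1: "open N1" "p \<in> N1" "N1 \<subseteq> fst c" "smooth_fun A N1 f"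
      "smooth_on (snd c ` N1) (in_chart c f)" using smooth_at_chart[OF True c] .
    define M where "M = N \<inter> N1"
    have M: "open M" "p \<in> M" "M \<subseteq> fst c" "M \<subseteq> N" "M \<subseteq> carrier A"
      using N N1 chart_sub_carrier[OF c(1)] by (auto simp: M_def)
    define S where "S = snd c ` M"
    have S: "open S" "?x \<in> S" using chart_open_image'[OF c(1) M(1,3)] M(2) by (auto simp: S_def)
    define F where "F = in_chart c f"
    have F: "smooth_on S F" unfolding F_def S_def by (rule smooth_on_subset[OF N1(5)]) (auto simp: M_def)
    define DF where "DF v y = frechet_derivative F (at y) v" for v y
    have DF: "smooth_on S (DF v)" for v unfolding DF_def using smooth_on_deriv[OF F] by simp
    have dDF: "DF v differentiable (at ?x)" for v using smooth_on_differentiable[OF DF S(2)] .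
    have fM: "smooth_fun A M f" using smooth_fun_subset[OF N1(4)] by (auto simp: M_def)
    \<comment> \<open>Stated for a general pair so that it serves both terms of the bracket: the
      first summand survives, the double sum of second derivatives is common to both.\<close>
    have key: "V p (\<lambda>q. Y q f) = DF (frechet_derivative \<eta> (at ?x) v) ?x
        + (\<Sum>b\<in>Basis. \<Sum>a\<in>Basis. (\<eta> ?x \<bullet> b) * (v \<bullet> a) * frechet_derivative (DF b) (at ?x) a)"
      if Y: "vector_field A N Y" and V: "V p = dir_deriv A c p v" and \<eta>: "\<eta> = in_chart c (\<lambda>q. coords c (Y q))"
      for V v Y \<eta>
    proof -
      have sm: "smooth_on S \<eta>" unfolding \<eta>
        by (rule smooth_on_subset[OF coords_vector_field_smooth[OF Y N(1) c(1)]]) (use M in \<open>auto simp: S_def\<close>)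
      have d\<eta>: "\<eta> differentiable (at ?x)" using smooth_on_differentiable[OF sm S(2)] .
      have eq: "in_chart c (\<lambda>q. Y q f) y = (\<Sum>b\<in>Basis. (\<eta> y \<bullet> b) *\<^sub>R DF b y)" if "y \<in> S" for y
      proof -
        obtain q where q: "q \<in> M" "y = snd c q" using \<open>y \<in> S\<close> by (auto simp: S_def)
        have qc: "q \<in> fst c" using q M by blast
        have "Y q f = frechet_derivative F (at y) (\<eta> y)"
          using vector_field_chart[OF Y N(1) c(1) qc] q M(4) smooth_fun_at[OF fM M(1,5) q(1)]
          by (auto simp: F_def \<eta> dir_deriv_apply)
        then show ?thesis using c(1) qc q(2)
            frechet_derivative_expand[OF smooth_on_differentiable[OF F that], of "\<eta> y"]
          by (simp add: DF_def)
      qed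
      have dc: "(\<lambda>y. \<eta> y \<bullet> b) differentiable (at ?x)" for b
        using smooth_on_differentiable[OF smooth_on_linear_comp[OF bounded_linear_inner_left S(1) sm] S(2)] .
      have fc: "frechet_derivative (\<lambda>y. \<eta> y \<bullet> b) (at ?x) v = frechet_derivative \<eta> (at ?x) v \<bullet> b" for b
      proof -
        have "((\<lambda>y. \<eta> y \<bullet> b) has_derivative (\<lambda>v. frechet_derivative \<eta> (at ?x) v \<bullet> b)) (at ?x)"
          using d\<eta> by (intro has_derivative_inner_left) (simp add: frechet_derivative_works[symmetric])
        from fun_cong[OF frechet_derivative_at[OF this]] show ?thesis by simp
      qed
      have "smooth_at A p (\<lambda>q. Y q f)" using smooth_at_vector_field[OF Y N True] .
      then have "V p (\<lambda>q. Y q f) = frechet_derivative (in_chart c (\<lambda>q. Y q f)) (at ?x) v"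
        by (simp add: V dir_deriv_apply)
      also have "\<dots> = frechet_derivative (\<lambda>y. \<Sum>b\<in>Basis. (\<eta> y \<bullet> b) *\<^sub>R DF b y) (at ?x) v"
        by (rule fun_cong[OF frechet_derivative_cong_open[OF S eq]])
      also have "\<dots> = (\<Sum>b\<in>Basis. frechet_derivative (\<lambda>y. (\<eta> y \<bullet> b) *\<^sub>R DF b y) (at ?x) v)"
      proof -
        have "((\<lambda>y. \<Sum>b\<in>Basis. (\<eta> y \<bullet> b) *\<^sub>R DF b y) has_derivative
          (\<lambda>v. \<Sum>b\<in>Basis. frechet_derivative (\<lambda>y. (\<eta> y \<bullet> b) *\<^sub>R DF b y) (at ?x) v)) (at ?x)"
          using differentiable_scaleR[OF dc dDF] unfolding frechet_derivative_works
          by (intro has_derivative_sum)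
        from fun_cong[OF frechet_derivative_at[OF this]] show ?thesis by simp
      qed
      also have "\<dots> = (\<Sum>b\<in>Basis. (frechet_derivative \<eta> (at ?x) v \<bullet> b) * DF b ?x
          + (\<eta> ?x \<bullet> b) * frechet_derivative (DF b) (at ?x) v)"
        by (intro sum.cong refl, subst frechet_derivative_scaleR[OF dc dDF]) (simp add: fc)
      also have "\<dots> = DF (frechet_derivative \<eta> (at ?x) v) ?x
          + (\<Sum>b\<in>Basis. (\<eta> ?x \<bullet> b) * frechet_derivative (DF b) (at ?x) v)"
        unfolding sum.distrib DF_def
        using frechet_derivative_expand[OF smooth_on_differentiable[OF F S(2)], of "frechet_derivative \<eta> (at ?x) v"]
        by simp
      also have "(\<Sum>b\<in>Basis. (\<eta> ?x \<bullet> b) * frechet_derivative (DF b) (at ?x) v)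
          = (\<Sum>b\<in>Basis. \<Sum>a\<in>Basis. (\<eta> ?x \<bullet> b) * (v \<bullet> a) * frechet_derivative (DF b) (at ?x) a)"
        by (intro sum.cong refl, subst frechet_derivative_expand[OF dDF]) (simp add: sum_distrib_left mult.assoc)
      finally show ?thesis .
    qed
    have swap: "(\<Sum>b\<in>Basis. \<Sum>a\<in>Basis. (\<eta> ?x \<bullet> b) * (\<xi> ?x \<bullet> a) * frechet_derivative (DF b) (at ?x) a)
      = (\<Sum>b\<in>Basis. \<Sum>a\<in>Basis. (\<xi> ?x \<bullet> b) * (\<eta> ?x \<bullet> a) * frechet_derivative (DF b) (at ?x) a)"
      apply (subst sum.swap)
      using symmetric_second_derivatives[OF S F]
      by (intro sum.cong refl) (simp add: DF_def[abs_def] mult.commute)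
    have "X p (\<lambda>q. Y q f) - Y p (\<lambda>q. X q f)
        = DF (frechet_derivative \<eta> (at ?x) (\<xi> ?x)) ?x - DF (frechet_derivative \<xi> (at ?x) (\<eta> ?x)) ?x"
      using key[of Y X "\<xi> ?x" \<eta>] key[of X Y "\<eta> ?x" \<xi>] X Y swap
        vector_field_chart[OF X N(1) c N(2)] vector_field_chart[OF Y N(1) c N(2)]
      by (simp add: \<xi>_def \<eta>_def)
    also have "\<dots> = DF (frechet_derivative \<eta> (at ?x) (\<xi> ?x) - frechet_derivative \<xi> (at ?x) (\<eta> ?x)) ?x"
      unfolding DF_def using frechet_derivative_bounded_linear[OF smooth_on_differentiable[OF F S(2)]]
      by (simp add: bounded_linear.linear linear_diff)
    finally show ?thesis using True by (simp add: bracket_def dir_deriv_apply DF_def F_def)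
  qed
qed

lemma vector_field_bracket:
  assumes X: "vector_field A N X" and Y: "vector_field A N Y" and N: "open N"
  shows "vector_field A N (bracket A X Y)"
  unfolding vector_field_def
proof (intro conjI allI ballI impI)
  fix p assume p: "p \<in> N"
  then obtain c where c: "c \<in> A" "p \<in> fst c" using vector_field_carrier[OF X] carrier_chart by blast
  show "bracket A X Y p \<in> tangent_space A p"
    unfolding bracket_chart[OF X Y N p c] using tangent_space_chart[OF c] by blast
next
  fix p assume "p \<notin> N"
  then show "bracket A X Y p = 0"
    using vector_field_outside[OF X] vector_field_outside[OF Y] by (simp add: bracket_def fun_eq_iff)
next
  fix M f assume M: "open M \<and> M \<subseteq> N \<and> smooth_fun A M f"
  then have sm: "smooth_fun A M (\<lambda>p. X p (\<lambda>q. Y q f) - Y p (\<lambda>q. X q f))"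
    using vector_field_smooth[OF X] vector_field_smooth[OF Y] by (intro smooth_fun_diff) auto
  show "smooth_fun A M (\<lambda>p. bracket A X Y p f)"
    by (rule smooth_fun_cong[OF _ _ sm])
      (use M vector_field_carrier[OF X] smooth_fun_at[of M f] in \<open>auto simp: bracket_def\<close>)
qed

text \<open>On a function smooth at p the twelve triple derivatives cancel in pairs; off N and on
  other functions every term is zero.\<close>

lemma jacobi:
  assumes X: "vector_field A N X" and Y: "vector_field A N Y" and Z: "vector_field A N Z" and N: "open N"
  shows "bracket A X (bracket A Y Z) + bracket A Y (bracket A Z X) + bracket A Z (bracket A X Y) = 0"
proof (rule ext, rule ext)
  fix p f
  \<comment> \<open>The inner bracket is a commutator only at points where f is smooth, so it is
    rewritten on a neighbourhood of p before the derivation is applied.\<close>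
  have *: "U p (\<lambda>q. bracket A V W q f) = U p (\<lambda>q. V q (\<lambda>r. W r f)) - U p (\<lambda>q. W q (\<lambda>r. V r f))"
    if "vector_field A N U" "vector_field A N V" "vector_field A N W" "p \<in> N" "smooth_at A p f" for U V W
  proof -
    obtain M where M: "open M" "p \<in> M" "M \<subseteq> carrier A" "smooth_fun A M f"
      using \<open>smooth_at A p f\<close> unfolding smooth_at_def by blast
    have "U p (\<lambda>q. bracket A V W q f) = U p (\<lambda>q. V q (\<lambda>r. W r f) - W q (\<lambda>r. V r f))"
      by (rule tangent_cong[OF vector_field_tangent[OF that(1,4)] M(1,2)])
        (use smooth_fun_at[OF M(4,1,3)] in \<open>simp add: bracket_def\<close>)
    also have "\<dots> = U p (\<lambda>q. V q (\<lambda>r. W r f)) - U p (\<lambda>q. W q (\<lambda>r. V r f))"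
      by (rule tangent_fun_diff[OF vector_field_tangent[OF that(1,4)]
            smooth_at_vector_field[OF that(2) N that(4) smooth_at_vector_field[OF that(3) N that(4,5)]]
            smooth_at_vector_field[OF that(3) N that(4) smooth_at_vector_field[OF that(2) N that(4,5)]]])
    finally show ?thesis .
  qed
  show "(bracket A X (bracket A Y Z) + bracket A Y (bracket A Z X) + bracket A Z (bracket A X Y)) p f = 0 p f"
  proof (cases "p \<in> N \<and> smooth_at A p f")
    case True
    have **: "bracket A U (bracket A V W) p f = U p (\<lambda>q. V q (\<lambda>r. W r f)) - U p (\<lambda>q. W q (\<lambda>r. V r f))
      - (V p (\<lambda>q. W q (\<lambda>r. U r f)) - W p (\<lambda>q. V q (\<lambda>r. U r f)))"
      if "vector_field A N U" "vector_field A N V" "vector_field A N W" for U V W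
    proof -
      have Uf: "smooth_at A p (\<lambda>q. U q f)" using smooth_at_vector_field[OF that(1) N] True by blast
      have "bracket A U B p f = U p (\<lambda>q. B q f) - B p (\<lambda>q. U q f)" for B
        using True by (simp add: bracket_def)
      moreover have "bracket A V W p (\<lambda>q. U q f) = V p (\<lambda>q. W q (\<lambda>r. U r f)) - W p (\<lambda>q. V q (\<lambda>r. U r f))"
        using Uf by (simp add: bracket_def)
      ultimately show ?thesis using True *[OF that] by simp
    qed
    show ?thesis using **[OF X Y Z] **[OF Y Z X] **[OF Z X Y] by simp
  next
    case False
    then show ?thesis
      using vector_field_outside[OF X, of p] vector_field_outside[OF Y, of p] vector_field_outside[OF Z, of p]
      by (cases "p \<in> N") (auto simp: bracket_def)
  qed
qed

end

section \<open>The determinant on the tangent spaces of the product\<close>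

type_synonym r4 = "(real \<times> real) \<times> (real \<times> real)"

text \<open>The determinant of four vectors, written with the same wedge products as
  \<open>nu\<close>, so that the chart expression of \<nu> is obtained by unfolding alone.\<close>

definition det4 :: "r4 \<Rightarrow> r4 \<Rightarrow> r4 \<Rightarrow> r4 \<Rightarrow> real" where
  "det4 = wedge22 (wedge11 (\<lambda>v. fst (fst v)) (\<lambda>v. snd (fst v)))
     (wedge11 (\<lambda>v. fst (snd v)) (\<lambda>v. snd (snd v)))"

lemma det4_add:
  "det4 (x + y) b c d = det4 x b c d + det4 y b c d" "det4 a (x + y) c d = det4 a x c d + det4 a y c d"
  "det4 a b (x + y) d = det4 a b x d + det4 a b y d" "det4 a b c (x + y) = det4 a b c x + det4 a b c y"
  by (simp_all add: det4_def wedge11_def wedge22_def algebra_simps)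

lemma det4_scale:
  "det4 (s *\<^sub>R x) b c d = s * det4 x b c d" "det4 a (s *\<^sub>R x) c d = s * det4 a x c d"
  "det4 a b (s *\<^sub>R x) d = s * det4 a b x d" "det4 a b c (s *\<^sub>R x) = s * det4 a b c x"
  by (simp_all add: det4_def wedge11_def wedge22_def algebra_simps)

lemma det4_diff:
  "det4 (x - y) b c d = det4 x b c d - det4 y b c d"
  "det4 a (x - y) c d = det4 a x c d - det4 a y c d"
  "det4 a b (x - y) d = det4 a b x d - det4 a b y d"
  "det4 a b c (x - y) = det4 a b c x - det4 a b c y"
  by (simp_all add: det4_def wedge11_def wedge22_def algebra_simps)

lemma det4_alternating [simp]:
  "det4 a a c d = 0" "det4 a b a d = 0" "det4 a b c a = 0"
  "det4 a b b d = 0" "det4 a b c b = 0" "det4 a b c c = 0"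
  by (simp_all add: det4_def wedge11_def wedge22_def algebra_simps)

lemma det4_cramer:
  "det4 a b c d *\<^sub>R v = det4 v b c d *\<^sub>R a + det4 a v c d *\<^sub>R b + det4 a b v d *\<^sub>R c + det4 a b c v *\<^sub>R d"
  by (cases a, cases b, cases c, cases d, cases v)
    (auto simp: det4_def wedge11_def wedge22_def algebra_simps)

text \<open>Write T v as the sum of v_i t_i, with t_i the columns of T. The terms containing t_i
  then form the i-th coordinate of Cramer's identity for t_i, that is, the determinant times the
  diagonal entry of t_i.\<close>

lemma det4_trace:
  assumes "linear T"
  shows "det4 (T a) b c d + det4 a (T b) c d + det4 a b (T c) d + det4 a b c (T d)
    = (fst (fst (T ((1,0),0))) + snd (fst (T ((0,1),0))) + fst (snd (T (0,(1,0)))) + snd (snd (T (0,(0,1)))))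
      * det4 a b c d"
proof -
  have T: "T v = fst (fst v) *\<^sub>R T ((1,0),0) + snd (fst v) *\<^sub>R T ((0,1),0)
      + fst (snd v) *\<^sub>R T (0,(1,0)) + snd (snd v) *\<^sub>R T (0,(0,1))" for v
  proof -
    have "v = fst (fst v) *\<^sub>R ((1,0),0) + snd (fst v) *\<^sub>R ((0,1),0)
      + fst (snd v) *\<^sub>R (0,(1,0)) + snd (snd v) *\<^sub>R (0,(0,1))"
      by (cases v) (auto simp: zero_prod_def)
    from arg_cong[OF this, of T] show ?thesis
      unfolding linear_add[OF assms] linear_scale[OF assms] .
  qed
  obtain t1 t2 t3 t4 where t: "T ((1,0),0) = t1" "T ((0,1),0) = t2" "T (0,(1,0)) = t3" "T (0,(0,1)) = t4"
    by blast
  note cr = det4_cramer[of a b c d]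
  show ?thesis
    unfolding T[of a] T[of b] T[of c] T[of d] t det4_add det4_scale
    using arg_cong[OF cr[of t1], of "\<lambda>v. fst (fst v)"] arg_cong[OF cr[of t2], of "\<lambda>v. snd (fst v)"]
      arg_cong[OF cr[of t3], of "\<lambda>v. fst (snd v)"] arg_cong[OF cr[of t4], of "\<lambda>v. snd (snd v)"]
    by (simp add: algebra_simps)
qed

lemma has_derivative_det4:
  assumes "(a has_derivative a') F" "(b has_derivative b') F" "(c has_derivative c') F" "(d has_derivative d') F"
    and F: "F = at x"
  shows "((\<lambda>x. det4 (a x) (b x) (c x) (d x)) has_derivative
    (\<lambda>h. det4 (a' h) (b x) (c x) (d x) + det4 (a x) (b' h) (c x) (d x)
       + det4 (a x) (b x) (c' h) (d x) + det4 (a x) (b x) (c x) (d' h))) F"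
proof -
  have comps: "((\<lambda>x. fst (fst (f x))) has_derivative (\<lambda>h. fst (fst (f' h)))) F"
    "((\<lambda>x. snd (fst (f x))) has_derivative (\<lambda>h. snd (fst (f' h)))) F"
    "((\<lambda>x. fst (snd (f x))) has_derivative (\<lambda>h. fst (snd (f' h)))) F"
    "((\<lambda>x. snd (snd (f x))) has_derivative (\<lambda>h. snd (snd (f' h)))) F"
    if "(f has_derivative f') F" for f f'
    using that by (auto intro!: has_derivative_fst has_derivative_snd)
  show ?thesis
    unfolding det4_def wedge11_def wedge22_def F
    apply (rule has_derivative_eq_rhs)
     apply (rule has_derivative_add has_derivative_diff has_derivative_mult comps[unfolded F] assms(1-4)[unfolded F])+
    apply (simp add: fun_eq_iff)
    apply (simp add: algebra_simps)
    done
qed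

lemma smooth_on_det4:
  assumes S: "open S" and "smooth_on S a" "smooth_on S b" "smooth_on S c" "smooth_on S d"
  shows "smooth_on S (\<lambda>x. det4 (a x) (b x) (c x) (d x))"
proof -
  have comps: "bounded_linear (\<lambda>v :: r4. fst (fst v))" "bounded_linear (\<lambda>v :: r4. snd (fst v))"
    "bounded_linear (\<lambda>v :: r4. fst (snd v))" "bounded_linear (\<lambda>v :: r4. snd (snd v))"
    by (intro bounded_linear_intros)+
  have minus: "smooth_on S (\<lambda>x. f x - g x)" if "smooth_on S f" "smooth_on S g" for f g :: "_ \<Rightarrow> real"
    using smooth_on_add[OF S that(1) smooth_on_mult[OF S smooth_on_const[of S "-1"] that(2)]] by simp
  show ?thesis
    unfolding det4_def wedge11_def wedge22_def using assms(2-5)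
    by (intro minus smooth_on_add[OF S] smooth_on_mult[OF S]
        smooth_on_linear_comp[OF comps(1) S] smooth_on_linear_comp[OF comps(2) S]
        smooth_on_linear_comp[OF comps(3) S] smooth_on_linear_comp[OF comps(4) S])
qed

section \<open>Product charts\<close>

lemma smooth_on_Pair:
  assumes S: "open S" and "smooth_on S f" "smooth_on S g" shows "smooth_on S (\<lambda>x. (f x, g x))"
proof -
  have "smooth_on S (\<lambda>x. (f x, 0) + (0, g x))"
    using assms(2,3)
    by (intro smooth_on_add[OF S] smooth_on_linear_comp[OF bounded_linear_Pair[OF bounded_linear_ident bounded_linear_zero] S]
        smooth_on_linear_comp[OF bounded_linear_Pair[OF bounded_linear_zero bounded_linear_ident] S])
  then show ?thesis by simp
qed

lemma smooth_on_fst: "open S \<Longrightarrow> smooth_on S f \<Longrightarrow> smooth_on S (\<lambda>x. fst (f x))"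
  by (rule smooth_on_linear_comp[OF bounded_linear_fst])

lemma smooth_on_snd: "open S \<Longrightarrow> smooth_on S f \<Longrightarrow> smooth_on S (\<lambda>x. snd (f x))"
  by (rule smooth_on_linear_comp[OF bounded_linear_snd])

lemma smooth_on_ident: "smooth_on S (\<lambda>x. x)"
  by (rule smooth_on_linear[OF bounded_linear_ident])

definition prod_chart :: "'a set \<Rightarrow> ('m, 'e) chart \<Rightarrow> ('a \<times> 'm, 'a \<times> 'e) chart" where
  "prod_chart U c = (U \<times> fst c, map_prod id (snd c))"

lemma prod_atlas_eq: "prod_atlas U A = prod_chart U ` A"
  by (auto simp: prod_atlas_def prod_chart_def case_prod_beta)

lemma prod_chart_simps [simp]:
  "fst (prod_chart U c) = U \<times> fst c" "snd (prod_chart U c) = map_prod id (snd c)"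
  by (simp_all add: prod_chart_def)

lemma inv_into_prod_chart:
  assumes "inj_on f D" "u \<in> U" "y \<in> f ` D"
  shows "inv_into (U \<times> D) (map_prod id f) (u, y) = (u, inv_into D f y)"
proof (rule inv_into_f_eq)
  show "inj_on (map_prod id f) (U \<times> D)" using assms(1) by (auto simp: inj_on_def)
qed (use assms in \<open>auto simp: inv_into_into f_inv_into_f\<close>)

lemma (in manifold) smooth_manifold_prod:
  fixes U :: "'a::euclidean_space set"
  assumes U: "open U"
  shows "smooth_manifold (prod_atlas U A)"
  unfolding smooth_manifold_def prod_atlas_eq
proof (intro conjI ballI)
  fix C assume "C \<in> prod_chart U ` A"
  then obtain c where c: "c \<in> A" "C = prod_chart U c" by blast
  note h = chart_homeo[OF c(1)]
  have im: "map_prod id (snd c) ` (U \<times> fst c) = U \<times> snd c ` fst c" by force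
  have inv: "inv_into (U \<times> fst c) (map_prod id (snd c)) x = (fst x, inv_into (fst c) (snd c) (snd x))"
    if "x \<in> U \<times> snd c ` fst c" for x
    using inv_into_prod_chart[OF chart_inj[OF c(1)], of "fst x" U "snd x"] that by auto
  have "homeomorphism (U \<times> fst c) (U \<times> snd c ` fst c) (map_prod id (snd c))
      (inv_into (U \<times> fst c) (map_prod id (snd c)))"
  proof (rule homeomorphismI)
    have "continuous_on (U \<times> fst c) (\<lambda>x. (fst x, snd c (snd x)))"
      using h(3) unfolding homeomorphism_def
      by (intro continuous_intros continuous_on_compose2[of "fst c" "snd c" _ snd]) auto
    then show "continuous_on (U \<times> fst c) (map_prod id (snd c))"
      by (rule continuous_on_eq) auto
    have "continuous_on (U \<times> snd c ` fst c) (\<lambda>x. (fst x, inv_into (fst c) (snd c) (snd x)))"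
      using h(3) unfolding homeomorphism_def
      by (intro continuous_intros continuous_on_compose2[of "snd c ` fst c" "inv_into (fst c) (snd c)" _ snd]) auto
    then show "continuous_on (U \<times> snd c ` fst c) (inv_into (U \<times> fst c) (map_prod id (snd c)))"
      by (rule continuous_on_eq) (simp add: inv)
  qed (use inv chart_inj[OF c(1)] in \<open>auto simp: inv_into_into f_inv_into_f\<close>)
  then show "case C of (D, \<phi>) \<Rightarrow> open D \<and> open (\<phi> ` D) \<and> homeomorphism D (\<phi> ` D) \<phi> (inv_into D \<phi>)"
    using h U by (simp add: c case_prod_beta im open_Times)
next
  fix C C' assume "C \<in> prod_chart U ` A" "C' \<in> prod_chart U ` A"
  then obtain c d where c: "c \<in> A" "C = prod_chart U c" and d: "d \<in> A" "C' = prod_chart U d" by blast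
  let ?S = "snd c ` (fst c \<inter> fst d)"
  have im: "snd C ` (fst C \<inter> fst C') = U \<times> ?S"
    unfolding c d by force
  have op: "open ?S" by (rule chart_open_image[OF c(1) chart_homeo(1)[OF d(1)]])
  have op2: "open (U \<times> ?S)" using op U by (rule open_Times[rotated])
  show "smooth_on (snd C ` (fst C \<inter> fst C')) (in_chart C (snd C'))"
    unfolding im
  proof (rule smooth_on_cong[OF op2])
    show "smooth_on (U \<times> ?S) (\<lambda>x. (fst x, in_chart c (snd d) (snd x)))"
      by (intro smooth_on_Pair smooth_on_fst smooth_on_ident op2
          smooth_on_compose[OF op2 _ _ chart_transition[OF c(1) d(1)]] smooth_on_snd) auto
    show "(fst x, in_chart c (snd d) (snd x)) = in_chart C (snd C') x" if x_in: "x \<in> U \<times> ?S" for x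
    proof -
      obtain u s where x: "x = (u, snd c s)" "u \<in> U" "s \<in> fst c" "s \<in> fst d" using x_in by auto
      then show ?thesis using chart_inj[OF c(1)]
        by (simp add: c d in_chart_eq inv_into_prod_chart)
    qed
  qed
qed

section \<open>Hamiltonian vector fields on the product\<close>

locale reduced = manifold A
  for A :: "('s::{t2_space, second_countable_topology}, real \<times> real) atlas" +
  fixes \<Omega> :: "'s tensor2" and U :: "(real \<times> real) set"
  assumes symplectic: "symplectic_form A \<Omega>" and open_U: "open U"
begin

abbreviation "P \<equiv> prod_atlas U A"

sublocale P: manifold "prod_atlas U A"
  by unfold_locales (rule smooth_manifold_prod[OF open_U])

lemma prod_chart_in: "c \<in> A \<Longrightarrow> prod_chart U c \<in> P"
  by (simp add: prod_atlas_eq)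

lemma carrier_P: "carrier P = U \<times> carrier A"
  by (auto simp: carrier_def prod_atlas_eq)

lemma in_chart_prod:
  "c \<in> A \<Longrightarrow> u \<in> U \<Longrightarrow> y \<in> snd c ` fst c \<Longrightarrow>
    in_chart (prod_chart U c) F (u, y) = in_chart c (\<lambda>s. F (u, s)) y"
  by (simp add: in_chart_eq inv_into_prod_chart chart_inj)

text \<open>Base fields differentiate along U, Hamiltonian fields are pushed forward along a slice.
  Both become directional derivatives, in the directions (d, 0) and (0, w), of the single
  product-chart expression of F.\<close>

lemma
  assumes F: "smooth_at P (u, s) F" and c: "c \<in> A" "s \<in> fst c"
  shows smooth_at_slice: "smooth_at A s (\<lambda>s'. F (u, s'))"
    and deriv_slice: "frechet_derivative (in_chart c (\<lambda>s'. F (u, s'))) (at (snd c s)) w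
      = frechet_derivative (in_chart (prod_chart U c) F) (at (u, snd c s)) (0, w)"
    and deriv_base: "frechet_derivative (\<lambda>x. F (x, s)) (at u) d
      = frechet_derivative (in_chart (prod_chart U c) F) (at (u, snd c s)) (d, 0)"
proof -
  let ?C = "prod_chart U c"
  have u: "u \<in> U" using P.smooth_at_carrier[OF F] by (auto simp: carrier_P)
  have us: "(u, s) \<in> fst ?C" using u c by simp
  obtain N where N: "open N" "(u, s) \<in> N" "N \<subseteq> fst ?C" "smooth_on (snd ?C ` N) (in_chart ?C F)"
    using P.smooth_at_chart[OF F prod_chart_in[OF c(1)] us] .
  define M where "M = Pair u -` N"
  have M: "open M" "s \<in> M" "M \<subseteq> fst c"
    using N open_vimage[OF N(1), of "Pair u"] continuous_on_Pair[OF continuous_on_const continuous_on_id, of UNIV u]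
    by (auto simp: M_def)
  have op: "open (snd c ` M)" by (rule chart_open_image'[OF c(1) M(1,3)])
  have "smooth_on (snd c ` M) (in_chart c (\<lambda>s'. F (u, s')))"
  proof (rule smooth_on_cong[OF op])
    show "smooth_on (snd c ` M) (\<lambda>y. in_chart ?C F (u, y))"
    proof (rule smooth_on_compose[OF op _ _ N(4)])
      show "Pair u ` (snd c ` M) \<subseteq> snd ?C ` N"
        by (force simp: M_def)
    qed (intro smooth_on_Pair op smooth_on_const smooth_on_ident)
    show "in_chart ?C F (u, y) = in_chart c (\<lambda>s'. F (u, s')) y" if "y \<in> snd c ` M" for y
      using in_chart_prod[OF c(1) u] that M(3) by blast
  qed
  then have "smooth_fun A M (\<lambda>s'. F (u, s'))" by (rule smooth_fun_chartI[OF c(1) M(1,3)])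
  then show "smooth_at A s (\<lambda>s'. F (u, s'))"
    using M chart_sub_carrier[OF c(1)] by (intro smooth_atI[of M]) auto
  have df: "in_chart ?C F differentiable (at (u, snd c s))"
    using P.smooth_at_differentiable[OF F prod_chart_in[OF c(1)] us] by simp
  then have D: "(in_chart ?C F has_derivative frechet_derivative (in_chart ?C F) (at (u, snd c s))) (at (u, snd c s))"
    by (simp add: frechet_derivative_works)
  have "((\<lambda>y. in_chart ?C F (u, y)) has_derivative
      (\<lambda>w. frechet_derivative (in_chart ?C F) (at (u, snd c s)) (0, w))) (at (snd c s))"
    using diff_chain_at[OF has_derivative_Pair[OF has_derivative_const has_derivative_ident] D] by (simp add: o_def)
  from fun_cong[OF frechet_derivative_at[OF this], of w]
  have "frechet_derivative (in_chart ?C F) (at (u, snd c s)) (0, w) = frechet_derivative (\<lambda>y. in_chart ?C F (u, y)) (at (snd c s)) w" .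
  also have "\<dots> = frechet_derivative (in_chart c (\<lambda>s'. F (u, s'))) (at (snd c s)) w"
    by (rule fun_cong[OF frechet_derivative_cong_open[of "snd c ` fst c"]])
      (use in_chart_prod[OF c(1) u] chart_homeo[OF c(1)] c in auto)
  finally show "frechet_derivative (in_chart c (\<lambda>s'. F (u, s'))) (at (snd c s)) w
      = frechet_derivative (in_chart ?C F) (at (u, snd c s)) (0, w)" by simp
  have "((\<lambda>x. in_chart ?C F (x, snd c s)) has_derivative
      (\<lambda>d. frechet_derivative (in_chart ?C F) (at (u, snd c s)) (d, 0))) (at u)"
    using diff_chain_at[OF has_derivative_Pair[OF has_derivative_ident has_derivative_const] D] by (simp add: o_def)
  from fun_cong[OF frechet_derivative_at[OF this], of d]
  have "frechet_derivative (in_chart ?C F) (at (u, snd c s)) (d, 0) = frechet_derivative (\<lambda>x. in_chart ?C F (x, snd c s)) (at u) d" .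
  also have "\<dots> = frechet_derivative (\<lambda>x. F (x, s)) (at u) d"
    by (rule fun_cong[OF frechet_derivative_cong_open[OF open_U u]]) (simp add: in_chart_prod c)
  finally show "frechet_derivative (\<lambda>x. F (x, s)) (at u) d
      = frechet_derivative (in_chart ?C F) (at (u, snd c s)) (d, 0)" by simp
qed

text \<open>\<open>pullback_form\<close> pushes vectors down by \<open>differential A snd\<close>,
  which tests them on lifted functions \<open>f \<circ> snd\<close>; these do not see the base
  direction.\<close>

lemma
  assumes f: "smooth_at A s f" and u: "u \<in> U" and c: "c \<in> A" "s \<in> fst c"
  shows smooth_at_lift: "smooth_at P (u, s) (f \<circ> snd)"
    and deriv_lift: "frechet_derivative (in_chart (prod_chart U c) (f \<circ> snd)) (at (u, snd c s)) (d, w)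
      = frechet_derivative (in_chart c f) (at (snd c s)) w"
proof -
  let ?C = "prod_chart U c"
  obtain N where N: "open N" "s \<in> N" "N \<subseteq> fst c" "smooth_on (snd c ` N) (in_chart c f)"
    using smooth_at_chart[OF f c] .
  have im: "snd ?C ` (U \<times> N) = U \<times> snd c ` N" by force
  have op1: "open (U \<times> N)" using open_U N(1) by (rule open_Times)
  have op: "open (U \<times> snd c ` N)" using open_U chart_open_image'[OF c(1) N(1,3)] by (rule open_Times)
  have eq: "in_chart c f (snd x) = in_chart ?C (f \<circ> snd) x" if "x \<in> U \<times> snd c ` fst c" for x
    using in_chart_prod[OF c(1), of "fst x" "snd x" "f \<circ> snd"] that by auto
  have "smooth_on (snd ?C ` (U \<times> N)) (in_chart ?C (f \<circ> snd))"
    unfolding im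
  proof (rule smooth_on_cong[OF op])
    show "smooth_on (U \<times> snd c ` N) (\<lambda>x. in_chart c f (snd x))"
      by (rule smooth_on_compose[OF op _ _ N(4)]) (auto intro: smooth_on_snd op smooth_on_ident)
    show "in_chart c f (snd x) = in_chart ?C (f \<circ> snd) x" if "x \<in> U \<times> snd c ` N" for x
      by (rule eq) (use that N(3) in blast)
  qed
  then have "smooth_fun P (U \<times> N) (f \<circ> snd)"
    using N(3) by (intro P.smooth_fun_chartI[OF prod_chart_in[OF c(1)] op1]) auto
  then show "smooth_at P (u, s) (f \<circ> snd)"
    using N u op1 chart_sub_carrier[OF c(1)] by (intro P.smooth_atI[of "U \<times> N"]) (auto simp: carrier_P)
  have "(in_chart c f has_derivative frechet_derivative (in_chart c f) (at (snd c s))) (at (snd (u, snd c s)))"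
    using smooth_at_differentiable[OF f c] by (simp add: frechet_derivative_works)
  from diff_chain_at[OF has_derivative_snd[OF has_derivative_ident] this]
  have "((\<lambda>x. in_chart c f (snd x)) has_derivative
      (\<lambda>v. frechet_derivative (in_chart c f) (at (snd c s)) (snd v))) (at (u, snd c s))" by (simp add: o_def)
  from fun_cong[OF frechet_derivative_at[OF this], of "(d, w)"]
  have "frechet_derivative (in_chart c f) (at (snd c s)) w
      = frechet_derivative (\<lambda>x. in_chart c f (snd x)) (at (u, snd c s)) (d, w)" by simp
  also have "\<dots> = frechet_derivative (in_chart ?C (f \<circ> snd)) (at (u, snd c s)) (d, w)"
    by (rule fun_cong[OF frechet_derivative_cong_open[of "U \<times> snd c ` fst c"]])
      (use eq u c chart_homeo(2)[OF c(1)] open_U in \<open>auto intro: open_Times\<close>)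
  finally show "frechet_derivative (in_chart ?C (f \<circ> snd)) (at (u, snd c s)) (d, w)
      = frechet_derivative (in_chart c f) (at (snd c s)) w" by simp
qed

lemma base_field_chart:
  assumes "c \<in> A" "s \<in> fst c" "u \<in> U"
  shows "base_field U A d (u, s) = dir_deriv P (prod_chart U c) (u, s) (d, 0)"
  by (rule ext) (simp add: base_field_def dir_deriv_def deriv_base[OF _ assms(1,2)])

lemma differential_slice_chart:
  assumes "c \<in> A" "s \<in> fst c" "u \<in> U"
  shows "differential P (\<lambda>s'. (u, s')) s (dir_deriv A c s w) = dir_deriv P (prod_chart U c) (u, s) (0, w)"
  by (rule ext) (simp add: differential_def dir_deriv_def comp_def
      smooth_at_slice[OF _ assms(1,2)] deriv_slice[OF _ assms(1,2)])

lemma differential_snd_chart: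
  assumes "c \<in> A" "s \<in> fst c" "u \<in> U"
  shows "differential A snd (u, s) (dir_deriv P (prod_chart U c) (u, s) (d, w)) = dir_deriv A c s w"
  by (rule ext) (simp add: differential_def dir_deriv_def
      smooth_at_lift[OF _ assms(3,1,2)] deriv_lift[OF _ assms(3,1,2)])

section \<open>The symplectic form and Hamiltonian vectors in a chart\<close>

text \<open>The density of \<Omega> in the chart, \<Omega> = omega dx1 \<and> dx2. It is a function
  of the fibre point alone, which matters for the divergence.\<close>

definition omega :: "('s, real \<times> real) chart \<Rightarrow> 's \<Rightarrow> real" where
  "omega c s = \<Omega> s (dir_deriv A c s (1, 0)) (dir_deriv A c s (0, 1))"

lemma symplectic_chart:
  assumes c: "c \<in> A" "s \<in> fst c"
  shows "\<Omega> s (dir_deriv A c s a) (dir_deriv A c s b) = omega c s * (fst a * snd b - snd a * fst b)"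
proof -
  let ?T = "tangent_space A s" and ?e1 = "dir_deriv A c s (1, 0)" and ?e2 = "dir_deriv A c s (0, 1)"
  have s: "s \<in> carrier A" using c chart_sub_carrier by blast
  have bil: "bilinear_on ?T (\<Omega> s)" and alt: "\<And>v. v \<in> ?T \<Longrightarrow> \<Omega> s v v = 0"
    using symplectic s unfolding symplectic_form_def smooth_tensor2_def by auto
  have l: "\<Omega> s (scal a u + scal b v) w = a * \<Omega> s u w + b * \<Omega> s v w"
    and r: "\<Omega> s w (scal a u + scal b v) = a * \<Omega> s w u + b * \<Omega> s w v"
    if "u \<in> ?T" "v \<in> ?T" "w \<in> ?T" for a b u v w
    using bil that unfolding bilinear_on_def by auto
  have e: "dir_deriv A c s w \<in> ?T" for w using tangent_space_chart[OF c] by blast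
  have exp: "dir_deriv A c s w = scal (fst w) ?e1 + scal (snd w) ?e2" for w
    unfolding dir_deriv_lincomb[OF c] by simp
  \<comment> \<open>Skew-symmetry by polarising \<Omega> v v = 0 at e1 + e2; the factors
    \<open>scal 1\<close> give the sum the shape of the bilinearity rules.\<close>
  have "\<Omega> s (scal 1 ?e1 + scal 1 ?e2) (scal 1 ?e1 + scal 1 ?e2) = 0"
    using e alt tangent_lincomb2 by blast
  moreover have "\<Omega> s (scal 1 ?e1 + scal 1 ?e2) (scal 1 ?e1 + scal 1 ?e2)
      = \<Omega> s ?e1 ?e1 + \<Omega> s ?e1 ?e2 + (\<Omega> s ?e2 ?e1 + \<Omega> s ?e2 ?e2)"
    using e tangent_lincomb2 by (simp only: l r) simp
  ultimately have "\<Omega> s ?e2 ?e1 = - omega c s"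
    using e alt by (simp add: omega_def)
  then show ?thesis
    unfolding exp[of a] exp[of b] using e alt tangent_lincomb2
    by (simp only: l r) (simp add: omega_def algebra_simps)
qed

lemma omega_nonzero:
  assumes c: "c \<in> A" "s \<in> fst c" shows "omega c s \<noteq> 0"
proof
  assume "omega c s = 0"
  then have z: "\<forall>w\<in>tangent_space A s. \<Omega> s (dir_deriv A c s (1, 0)) w = 0"
    using tangent_space_chart[OF c] symplectic_chart[OF c] by auto
  have "nondegenerate_on (tangent_space A s) (\<Omega> s)"
    using symplectic c chart_sub_carrier unfolding symplectic_form_def by blast
  then have "dir_deriv A c s (1, 0) = 0"
    using z tangent_space_chart[OF c] unfolding nondegenerate_on_def by blast
  then have "coords c (dir_deriv A c s (1, 0)) = 0" by (simp add: coords_def)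
  then show False using coords_dir_deriv[OF c] by (simp add: zero_prod_def)
qed

text \<open>\<open>smooth_tensor2\<close> speaks of vector fields only, so the coordinate vectors
  are made into fields on the chart domain, zero outside as \<open>vector_field\<close>
  demands.\<close>

lemma omega_smooth:
  assumes c: "c \<in> A" shows "smooth_fun A (fst c) (omega c)"
proof -
  define X where "X b s = (if s \<in> fst c then dir_deriv A c s b else 0)" for b s
  have X: "vector_field A (fst c) (X b)" for b
  proof (rule vector_fieldI_chart)
    show "\<exists>c' N0 w. c' \<in> A \<and> open N0 \<and> p \<in> N0 \<and> N0 \<subseteq> fst c' \<and> smooth_on (snd c' ` N0) w
      \<and> (\<forall>q\<in>N0. X b q = dir_deriv A c' q (w (snd c' q)))" if "p \<in> fst c" for p
      by (rule exI[of _ c], rule exI[of _ "fst c"], rule exI[of _ "\<lambda>x. b"])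
        (use c chart_homeo[OF c] that smooth_on_const in \<open>auto simp: X_def\<close>)
  qed (simp add: X_def)
  have "smooth_tensor2 A (carrier A) \<Omega>" using symplectic unfolding symplectic_form_def by blast
  then have "smooth_fun A (fst c) (\<lambda>p. \<Omega> p (X (1, 0) p) (X (0, 1) p))"
    using chart_homeo(1)[OF c] chart_sub_carrier[OF c] X unfolding smooth_tensor2_def by blast
  then show ?thesis
    by (rule smooth_fun_cong[OF chart_homeo(1)[OF c], rotated]) (simp add: X_def omega_def)
qed

text \<open>In the chart \<Omega>(a, w) = omega (a1 w2 - a2 w1), so with h_1, h_2 the partial
  derivatives of h the equation \<Omega>(a, w) = dh(w) has the unique solution a = (h_2, - h_1) /
  omega.\<close>

lemma ham_vec_chart:
  assumes h: "smooth_at A s h" and c: "c \<in> A" "s \<in> fst c"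
  defines "D \<equiv> frechet_derivative (in_chart c h) (at (snd c s))"
  shows "ham_vec A \<Omega> s h = dir_deriv A c s (D (0, 1) / omega c s, - (D (1, 0) / omega c s))"
  unfolding ham_vec_def
proof (rule the_equality)
  have T: "tangent_space A s = range (dir_deriv A c s)" by (rule tangent_space_chart[OF c])
  interpret D: bounded_linear D
    unfolding D_def by (rule frechet_derivative_bounded_linear[OF smooth_at_differentiable[OF h c]])
  have Dw: "dir_deriv A c s w h = fst w * D (1, 0) + snd w * D (0, 1)" for w
  proof -
    have "w = fst w *\<^sub>R (1, 0) + snd w *\<^sub>R (0, 1)" by simp
    then have "D w = fst w *\<^sub>R D (1, 0) + snd w *\<^sub>R D (0, 1)" by (metis D.add D.scaleR)
    then show ?thesis using h by (simp add: dir_deriv_apply D_def)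
  qed
  note nz = omega_nonzero[OF c]
  show "dir_deriv A c s (D (0, 1) / omega c s, - (D (1, 0) / omega c s)) \<in> tangent_space A s \<and>
    (\<forall>w\<in>tangent_space A s. \<Omega> s (dir_deriv A c s (D (0, 1) / omega c s, - (D (1, 0) / omega c s))) w = w h)"
    unfolding T using nz by (auto simp: symplectic_chart[OF c] Dw field_simps)
  fix v assume v: "v \<in> tangent_space A s \<and> (\<forall>w\<in>tangent_space A s. \<Omega> s v w = w h)"
  then obtain a where a: "v = dir_deriv A c s a" using T by blast
  have "omega c s * fst a = D (0, 1)" "- (omega c s * snd a) = D (1, 0)"
    using v T Dw[of "(0, 1)"] Dw[of "(1, 0)"] symplectic_chart[OF c, of a "(0, 1)"] symplectic_chart[OF c, of a "(1, 0)"]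
    unfolding a by auto
  then have "a = (D (0, 1) / omega c s, - (D (1, 0) / omega c s))"
    using nz by (intro prod_eqI) (auto simp: field_simps)
  then show "v = dir_deriv A c s (D (0, 1) / omega c s, - (D (1, 0) / omega c s))" by (simp add: a)
qed

section \<open>Fields with constant base part and Hamiltonian fibre part\<close>

text \<open>All eight fields of the two situations have this form, with d = 0 where there is no base
  part; one computation of the divergence then covers them.\<close>

definition reduced_field :: "real \<times> real \<Rightarrow> ((real \<times> real) \<times> 's \<Rightarrow> real) \<Rightarrow> ((real \<times> real) \<times> 's) field" where
  "reduced_field d H = base_field U A d - ham_field U A \<Omega> H"

text \<open>The product-chart components (d, (- H_2, H_1) / omega) of
  \<open>reduced_field d H\<close>, as a function of the chart point so that it can be
  differentiated.\<close>

definition reduced_coords ::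
  "('s, real \<times> real) chart \<Rightarrow> real \<times> real \<Rightarrow> ((real \<times> real) \<times> 's \<Rightarrow> real) \<Rightarrow> r4 \<Rightarrow> r4" where
  "reduced_coords c d H x = (d,
     (- (frechet_derivative (in_chart (prod_chart U c) H) (at x) (0, (0, 1)) * inverse (in_chart c (omega c) (snd x))),
      frechet_derivative (in_chart (prod_chart U c) H) (at x) (0, (1, 0)) * inverse (in_chart c (omega c) (snd x))))"

lemma ham_field_chart:
  assumes H: "smooth_at P (u, s) H" and c: "c \<in> A" "s \<in> fst c"
  shows "ham_field U A \<Omega> H (u, s) = dir_deriv P (prod_chart U c) (u, s) (- reduced_coords c 0 H (u, snd c s))"
proof -
  have u: "u \<in> U" using P.smooth_at_carrier[OF H] by (auto simp: carrier_P)
  show ?thesis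
    using c by (simp add: ham_field_def ham_vec_chart[OF smooth_at_slice[OF H c] c] deriv_slice[OF H c]
      differential_slice_chart[OF c u] reduced_coords_def divide_inverse)
qed

lemma reduced_field_chart:
  assumes H: "smooth_at P (u, s) H" and c: "c \<in> A" "s \<in> fst c"
  shows "reduced_field d H (u, s) = dir_deriv P (prod_chart U c) (u, s) (reduced_coords c d H (u, snd c s))"
proof -
  have u: "u \<in> U" using P.smooth_at_carrier[OF H] by (auto simp: carrier_P)
  have us: "(u, s) \<in> fst (prod_chart U c)" using u c by simp
  have "reduced_field d H (u, s) = scal 1 (base_field U A d (u, s)) + scal (-1) (ham_field U A \<Omega> H (u, s))"
    by (simp add: reduced_field_def scal_def fun_eq_iff)
  then show ?thesis
    unfolding base_field_chart[OF c u] ham_field_chart[OF H c] P.dir_deriv_lincomb[OF prod_chart_in[OF c(1)] us]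
    by (simp add: reduced_coords_def)
qed

lemma open_chart_range: "c \<in> A \<Longrightarrow> open (U \<times> snd c ` fst c)"
  using open_Times[OF open_U chart_homeo(2)] .

lemma prod_chart_range: "snd (prod_chart U c) ` fst (prod_chart U c) = U \<times> snd c ` fst c"
  by force

lemma omega_chart_smooth:
  assumes c: "c \<in> A" shows "smooth_on (U \<times> snd c ` fst c) (\<lambda>x. in_chart c (omega c) (snd x))"
  by (rule smooth_on_compose[OF open_chart_range[OF c] _ _ smooth_funD[OF omega_smooth[OF c] c order_refl]])
    (auto intro: smooth_on_snd smooth_on_ident open_chart_range[OF c])

lemma omega_chart_nonzero: "c \<in> A \<Longrightarrow> y \<in> snd c ` fst c \<Longrightarrow> in_chart c (omega c) y \<noteq> 0"
  by (elim imageE) (simp add: omega_nonzero)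

lemma reduced_coords_smooth:
  assumes c: "c \<in> A" and H: "smooth_fun P (carrier P) H"
  shows "smooth_on (U \<times> snd c ` fst c) (reduced_coords c d H)"
proof -
  note op = open_chart_range[OF c]
  have "smooth_fun P (fst (prod_chart U c)) H"
    using P.smooth_fun_subset[OF H] P.chart_sub_carrier[OF prod_chart_in[OF c]] by blast
  then have H': "smooth_on (U \<times> snd c ` fst c) (in_chart (prod_chart U c) H)"
    using P.smooth_funD[OF _ prod_chart_in[OF c] order_refl] unfolding prod_chart_range by blast
  have inv: "smooth_on (U \<times> snd c ` fst c) (\<lambda>x. inverse (in_chart c (omega c) (snd x)))"
    by (intro smooth_on_inverse op omega_chart_smooth c) (auto simp: omega_chart_nonzero[OF c] simp del: in_chart_at)
  have minus: "smooth_on (U \<times> snd c ` fst c) (\<lambda>x. - f x)" if "smooth_on (U \<times> snd c ` fst c) f" for f :: "r4 \<Rightarrow> real"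
    using smooth_on_mult[OF op smooth_on_const[of _ "-1"] that] by simp
  show ?thesis
    unfolding reduced_coords_def[abs_def]
    by (intro smooth_on_Pair op smooth_on_const minus smooth_on_mult smooth_on_deriv H' inv)
qed

lemma reduced_field_vector_field:
  assumes H: "smooth_fun P (carrier P) H"
  shows "vector_field P (carrier P) (reduced_field d H)"
proof (rule P.vector_fieldI_chart)
  fix p assume "p \<notin> carrier P"
  then have "\<not> smooth_at P p f" for f using P.smooth_at_carrier by blast
  then show "reduced_field d H p = 0"
    by (cases p) (auto simp: reduced_field_def base_field_def ham_field_def differential_def fun_eq_iff)
next
  fix p assume p: "p \<in> carrier P"
  obtain u s where us: "p = (u, s)" "u \<in> U" "s \<in> carrier A" using p by (auto simp: carrier_P)
  obtain c where c: "c \<in> A" "s \<in> fst c" using carrier_chart us by blast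
  show "\<exists>C N0 w. C \<in> P \<and> open N0 \<and> p \<in> N0 \<and> N0 \<subseteq> fst C \<and> smooth_on (snd C ` N0) w
      \<and> (\<forall>q\<in>N0. reduced_field d H q = dir_deriv P C q (w (snd C q)))"
  proof (intro exI conjI ballI)
    show "prod_chart U c \<in> P" by (rule prod_chart_in[OF c(1)])
    show "open (fst (prod_chart U c))" using P.chart_homeo(1)[OF prod_chart_in[OF c(1)]] .
    show "smooth_on (snd (prod_chart U c) ` fst (prod_chart U c)) (reduced_coords c d H)"
      unfolding prod_chart_range by (rule reduced_coords_smooth[OF c(1) H])
    fix q assume "q \<in> fst (prod_chart U c)"
    then obtain u s where q: "q = (u, s)" "u \<in> U" "s \<in> fst c" by auto
    have "smooth_at P q H"
      using P.smooth_fun_at[OF H P.open_carrier order_refl, of q] q chart_sub_carrier[OF c(1)] by (auto simp: carrier_P)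
    then show "reduced_field d H q = dir_deriv P (prod_chart U c) q (reduced_coords c d H (snd (prod_chart U c) q))"
      using reduced_field_chart[OF _ c(1) q(3)] q by simp
  qed (use us c in auto)
qed

lemma pullback_chart:
  assumes c: "c \<in> A" "s \<in> fst c" "u \<in> U"
  shows "pullback_form A \<Omega> (u, s) (dir_deriv P (prod_chart U c) (u, s) a) (dir_deriv P (prod_chart U c) (u, s) b)
    = omega c s * wedge11 (\<lambda>v. fst (snd v)) (\<lambda>v. snd (snd v)) a b"
  using differential_snd_chart[OF c, of "fst a" "snd a"] differential_snd_chart[OF c, of "fst b" "snd b"]
  by (simp add: pullback_form_def symplectic_chart[OF c(1,2)] wedge11_def algebra_simps)

lemma nu_chart:
  assumes c: "c \<in> A" "s \<in> fst c" "u \<in> U"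
  shows "nu A \<Omega> (u, s) (dir_deriv P (prod_chart U c) (u, s) a) (dir_deriv P (prod_chart U c) (u, s) b)
      (dir_deriv P (prod_chart U c) (u, s) a') (dir_deriv P (prod_chart U c) (u, s) b')
    = omega c s * det4 a b a' b'"
proof -
  let ?C = "prod_chart U c"
  have us: "(u, s) \<in> fst ?C" using c by simp
  \<comment> \<open>The coordinates of U that occur in \<open>nu\<close> are coordinate functions of
    every product chart.\<close>
  have "crd ?C ((1, 0), 0) = (\<lambda>q. fst (fst q))" "crd ?C ((0, 1), 0) = (\<lambda>q. snd (fst q))"
    by (auto simp: crd_def fun_eq_iff)
  then have crd: "dir_deriv P ?C (u, s) a (\<lambda>q. fst (fst q)) = fst (fst a)"
    "dir_deriv P ?C (u, s) a (\<lambda>q. snd (fst q)) = snd (fst a)" for a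
    using P.dir_deriv_crd[OF prod_chart_in[OF c(1)] us, of a "((1, 0), 0)"]
      P.dir_deriv_crd[OF prod_chart_in[OF c(1)] us, of a "((0, 1), 0)"]
    by (cases a; auto)+
  show ?thesis
    unfolding nu_def wedge22_def pullback_chart[OF c] det4_def by (simp add: wedge11_def crd algebra_simps)
qed

lemma nu_coords:
  assumes c: "c \<in> A" "(u, s) \<in> fst (prod_chart U c)"
    and "v1 \<in> tangent_space P (u, s)" "v2 \<in> tangent_space P (u, s)"
      "v3 \<in> tangent_space P (u, s)" "v4 \<in> tangent_space P (u, s)"
  defines "X \<equiv> coords (prod_chart U c)"
  shows "nu A \<Omega> (u, s) v1 v2 v3 v4 = omega c s * det4 (X v1) (X v2) (X v3) (X v4)"
  using nu_chart[OF c(1), of s u "X v1" "X v2" "X v3" "X v4"] P.dir_deriv_coords[OF prod_chart_in[OF c(1)] c(2)] assms(2-6)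
  by (simp add: X_def)

end

section \<open>The volume form \<nu> and its invariance under the reduced fields\<close>

context reduced
begin

lemma
  assumes N: "open N" and Y: "vector_field P N Y1" "vector_field P N Y2" "vector_field P N Y3" "vector_field P N Y4"
    and c: "c \<in> A"
  defines "\<eta> Y \<equiv> in_chart (prod_chart U c) (\<lambda>q. coords (prod_chart U c) (Y q))"
    and "S \<equiv> snd (prod_chart U c) ` (fst (prod_chart U c) \<inter> N)"
  shows nu_in_chart: "y \<in> S \<Longrightarrow> in_chart (prod_chart U c) (\<lambda>q. nu A \<Omega> q (Y1 q) (Y2 q) (Y3 q) (Y4 q)) y
      = in_chart c (omega c) (snd y) * det4 (\<eta> Y1 y) (\<eta> Y2 y) (\<eta> Y3 y) (\<eta> Y4 y)"
    and nu_in_chart_smooth: "smooth_on S (in_chart (prod_chart U c) (\<lambda>q. nu A \<Omega> q (Y1 q) (Y2 q) (Y3 q) (Y4 q)))"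
proof -
  let ?C = "prod_chart U c"
  note C = prod_chart_in[OF c]
  have op: "open S" unfolding S_def by (rule P.chart_open_image[OF C N])
  have eq: "in_chart ?C (\<lambda>q. nu A \<Omega> q (Y1 q) (Y2 q) (Y3 q) (Y4 q)) y
      = in_chart c (omega c) (snd y) * det4 (\<eta> Y1 y) (\<eta> Y2 y) (\<eta> Y3 y) (\<eta> Y4 y)" if y: "y \<in> S" for y
  proof -
    obtain q where q: "q \<in> fst ?C" "q \<in> N" "y = snd ?C q" using y unfolding S_def by blast
    obtain u s where us: "q = (u, s)" by (cases q)
    have s: "s \<in> fst c" using q us by simp
    have nu: "nu A \<Omega> q (Y1 q) (Y2 q) (Y3 q) (Y4 q) = omega c s * det4 (coords ?C (Y1 q)) (coords ?C (Y2 q)) (coords ?C (Y3 q)) (coords ?C (Y4 q))"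
      using nu_coords[OF c] q(1) P.vector_field_tangent[OF Y(1) q(2)] P.vector_field_tangent[OF Y(2) q(2)]
        P.vector_field_tangent[OF Y(3) q(2)] P.vector_field_tangent[OF Y(4) q(2)] unfolding us by blast
    have "snd y = snd c s" using q(3) us by simp
    then show ?thesis
      unfolding \<eta>_def using nu by (simp only: q(3) P.in_chart_at[OF C q(1)]) (simp add: c s us)
  qed
  show "y \<in> S \<Longrightarrow> in_chart ?C (\<lambda>q. nu A \<Omega> q (Y1 q) (Y2 q) (Y3 q) (Y4 q)) y
      = in_chart c (omega c) (snd y) * det4 (\<eta> Y1 y) (\<eta> Y2 y) (\<eta> Y3 y) (\<eta> Y4 y)" by (rule eq)
  have "S \<subseteq> U \<times> snd c ` fst c" unfolding S_def by force
  then have w: "smooth_on S (\<lambda>y. in_chart c (omega c) (snd y))"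
    by (rule smooth_on_subset[OF omega_chart_smooth[OF c]])
  show "smooth_on S (in_chart ?C (\<lambda>q. nu A \<Omega> q (Y1 q) (Y2 q) (Y3 q) (Y4 q)))"
  proof (rule smooth_on_cong[OF op])
    show "smooth_on S (\<lambda>y. in_chart c (omega c) (snd y) * det4 (\<eta> Y1 y) (\<eta> Y2 y) (\<eta> Y3 y) (\<eta> Y4 y))"
      unfolding \<eta>_def using P.coords_vector_field_smooth[OF _ N C] Y unfolding S_def[symmetric]
      by (intro smooth_on_mult[OF op w] smooth_on_det4[OF op]) auto
  qed (simp add: eq)
qed

lemma nu_smooth:
  assumes N: "open N" and Y: "vector_field P N Y1" "vector_field P N Y2" "vector_field P N Y3" "vector_field P N Y4"
  shows "smooth_fun P N (\<lambda>q. nu A \<Omega> q (Y1 q) (Y2 q) (Y3 q) (Y4 q))"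
  unfolding smooth_fun_def
proof
  fix C assume "C \<in> P"
  then obtain c where "c \<in> A" "C = prod_chart U c" by (auto simp: prod_atlas_eq)
  then show "smooth_on (snd C ` (fst C \<inter> N)) (in_chart C (\<lambda>q. nu A \<Omega> q (Y1 q) (Y2 q) (Y3 q) (Y4 q)))"
    using nu_in_chart_smooth[OF N Y] by simp
qed

text \<open>The fields \<open>reduced_field d H\<close> are divergence free with respect to \<open>\<nu>\<close>.\<close>

lemma reduced_coords_divergence:
  fixes d :: "real \<times> real"
  assumes c: "c \<in> A" "s \<in> fst c" "u \<in> U" and H: "smooth_fun P (carrier P) H"
  defines "x \<equiv> (u, snd c s)" and "w \<equiv> \<lambda>y :: r4. in_chart c (omega c) (snd y)"
  defines "T \<equiv> frechet_derivative (reduced_coords c d H) (at x)"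
  shows "w x * (fst (fst (T ((1,0),0))) + snd (fst (T ((0,1),0))) + fst (snd (T (0,(1,0)))) + snd (snd (T (0,(0,1)))))
    + frechet_derivative w (at x) (reduced_coords c d H x) = 0"
proof -
  let ?C = "prod_chart U c" and ?S = "U \<times> snd c ` fst c"
  note C = prod_chart_in[OF c(1)]
  have S: "open ?S" "x \<in> ?S" using open_chart_range[OF c(1)] c by (auto simp: x_def)
  have "smooth_fun P (fst ?C) H"
    using P.smooth_fun_subset[OF H] P.chart_sub_carrier[OF C] by blast
  then have Hs: "smooth_on ?S (in_chart ?C H)"
    using P.smooth_funD[OF _ C order_refl] unfolding prod_chart_range by blast
  define G where "G a y = frechet_derivative (in_chart ?C H) (at y) (0, a)" for a :: "real \<times> real" and y
  have Gs: "smooth_on ?S (G a)" for a unfolding G_def using smooth_on_deriv[OF Hs] .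
  define G' where "G' a = frechet_derivative (G a) (at x)" for a
  have G': "(G a has_derivative G' a) (at x)" for a
    unfolding G'_def using smooth_on_differentiable[OF Gs S(2)] by (simp add: frechet_derivative_works)
  \<comment> \<open>Multiplied by omega, the fibre components become - H_2 and H_1, whose divergence
    is a difference of mixed derivatives.\<close>
  have sym: "G' (0, 1) (0, (1, 0)) = G' (1, 0) (0, (0, 1))"
    unfolding G'_def G_def by (rule symmetric_second_derivatives[OF S Hs])
  have ws: "smooth_on ?S w" unfolding w_def by (rule omega_chart_smooth[OF c(1)])
  define w' where "w' = frechet_derivative w (at x)"
  have w': "(w has_derivative w') (at x)"
    unfolding w'_def using smooth_on_differentiable[OF ws S(2)] by (simp add: frechet_derivative_works)
  have wd: "in_chart c (omega c) differentiable (at (snd x))"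
    using smooth_on_differentiable[OF smooth_funD[OF omega_smooth[OF c(1)] c(1) order_refl]] c by (simp add: x_def)
  then have "(in_chart c (omega c) has_derivative frechet_derivative (in_chart c (omega c)) (at (snd x))) (at (snd x))"
    by (simp add: frechet_derivative_works)
  from diff_chain_at[OF has_derivative_snd[OF has_derivative_ident] this]
  have "(w has_derivative (\<lambda>h. frechet_derivative (in_chart c (omega c)) (at (snd x)) (snd h))) (at x)"
    by (simp add: o_def w_def)
  then have w'h: "w' h = frechet_derivative (in_chart c (omega c)) (at (snd x)) (snd h)" for h
    using has_derivative_unique[OF w'] by metis
  interpret w: bounded_linear "frechet_derivative (in_chart c (omega c)) (at (snd x))"
    using wd by (rule frechet_derivative_bounded_linear)
  \<comment> \<open>The density depends on the fibre coordinates only, so the base part of the field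
    does not differentiate it.\<close>
  have w'lin: "w' (a, (b, b')) = b * w' (0, (1, 0)) + b' * w' (0, (0, 1))" for a b b'
  proof -
    have "(b, b') = b *\<^sub>R (1, 0) + b' *\<^sub>R (0, 1 :: real)" by simp
    then show ?thesis unfolding w'h snd_conv by (metis w.add w.scaleR real_scaleR_def)
  qed
  have nz: "w x \<noteq> 0" unfolding w_def x_def using omega_nonzero[OF c(1,2)] c by simp
  have rc: "reduced_coords c d H = (\<lambda>y. (d, (- (G (0, 1) y * inverse (w y)), G (1, 0) y * inverse (w y))))"
    by (simp add: reduced_coords_def G_def w_def fun_eq_iff)
  define i' where "i' h = - (inverse (w x) * w' h * inverse (w x))" for h
  have i': "((\<lambda>y. inverse (w y)) has_derivative i') (at x)"
    unfolding i'_def by (rule Deriv.has_derivative_inverse[OF nz w'])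
  have "(reduced_coords c d H has_derivative
    (\<lambda>h. (0, (- (G (0, 1) x * i' h + G' (0, 1) h * inverse (w x)), G (1, 0) x * i' h + G' (1, 0) h * inverse (w x))))) (at x)"
    unfolding rc
    by (intro has_derivative_Pair has_derivative_const has_derivative_minus has_derivative_mult G' i')
  from fun_cong[OF frechet_derivative_at[OF this], symmetric]
  have T: "T h = (0, (- (G (0, 1) x * i' h + G' (0, 1) h * inverse (w x)), G (1, 0) x * i' h + G' (1, 0) h * inverse (w x)))" for h
    unfolding T_def .
  have w'\<xi>: "w' (reduced_coords c d H x) = - (G (0, 1) x * inverse (w x)) * w' (0, (1, 0))
      + G (1, 0) x * inverse (w x) * w' (0, (0, 1))"
    unfolding rc by (rule w'lin)
  show ?thesis
    unfolding T w'_def[symmetric] w'\<xi> using nz sym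
    by (simp add: i'_def field_simps)
qed

text \<open>The Lie derivative of \<nu> along X vanishes. With \<xi> and \<eta> the components of X
  and Y, the bracket has components \<eta>'(\<xi>) - \<xi>'(\<eta>). The product rule for omega
  times the determinant gives the terms \<eta>'(\<xi>); the terms \<xi>'(\<eta>) add up to the trace
  of \<xi>' and cancel against the derivative of omega by divergence freedom. X is zero off N, hence
  the comparison with \<open>reduced_field\<close> on N only.\<close>

lemma nu_derivative:
  assumes N: "open N" "p \<in> N"
    and Y: "vector_field P N Y1" "vector_field P N Y2" "vector_field P N Y3" "vector_field P N Y4"
    and X: "vector_field P N X" "\<And>q. q \<in> N \<Longrightarrow> X q = reduced_field d H q" and H: "smooth_fun P (carrier P) H"
  shows "X p (\<lambda>q. nu A \<Omega> q (Y1 q) (Y2 q) (Y3 q) (Y4 q))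
    = nu A \<Omega> p (bracket P X Y1 p) (Y2 p) (Y3 p) (Y4 p) + nu A \<Omega> p (Y1 p) (bracket P X Y2 p) (Y3 p) (Y4 p)
    + nu A \<Omega> p (Y1 p) (Y2 p) (bracket P X Y3 p) (Y4 p) + nu A \<Omega> p (Y1 p) (Y2 p) (Y3 p) (bracket P X Y4 p)"
proof -
  have pc: "p \<in> carrier P" using P.vector_field_carrier[OF X(1)] N by blast
  obtain u s where us: "p = (u, s)" "u \<in> U" "s \<in> carrier A" using pc by (auto simp: carrier_P)
  obtain c where c: "c \<in> A" "s \<in> fst c" using carrier_chart us by blast
  let ?C = "prod_chart U c"
  note C = prod_chart_in[OF c(1)]
  have pC: "p \<in> fst ?C" using us c by simp
  define x where "x = (u, snd c s)"
  have x: "snd ?C p = x" by (simp add: us x_def)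
  define S where "S = snd ?C ` (fst ?C \<inter> N)"
  have S: "open S" "x \<in> S" using P.chart_open_image[OF C N(1)] N(2) pC x unfolding S_def by auto
  have SU: "S \<subseteq> U \<times> snd c ` fst c" unfolding S_def by force
  define \<eta> where "\<eta> Y = in_chart ?C (\<lambda>q. coords ?C (Y q))" for Y
  have \<eta>s: "smooth_on S (\<eta> Y)" if "vector_field P N Y" for Y
    unfolding \<eta>_def S_def by (rule P.coords_vector_field_smooth[OF that N(1) C])
  have Yp: "Y p = dir_deriv P ?C p (\<eta> Y x)" if "vector_field P N Y" for Y
    using P.vector_field_chart[OF that N(1) C pC N(2)] unfolding \<eta>_def x .
  define \<eta>' where "\<eta>' Y = frechet_derivative (\<eta> Y) (at x)" for Y
  have \<eta>': "(\<eta> Y has_derivative \<eta>' Y) (at x)" if "vector_field P N Y" for Y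
    unfolding \<eta>'_def using smooth_on_differentiable[OF \<eta>s[OF that] S(2)] by (simp add: frechet_derivative_works)
  define w where "w = (\<lambda>y :: r4. in_chart c (omega c) (snd y))"
  have ws: "smooth_on S w" unfolding w_def by (rule smooth_on_subset[OF omega_chart_smooth[OF c(1)] SU])
  define w' where "w' = frechet_derivative w (at x)"
  have w': "(w has_derivative w') (at x)"
    unfolding w'_def using smooth_on_differentiable[OF ws S(2)] by (simp add: frechet_derivative_works)
  have wx: "w x = omega c s" by (simp add: w_def x_def c)
  have \<xi>: "\<eta> X y = reduced_coords c d H y" if y: "y \<in> S" for y
  proof -
    obtain q where q: "q \<in> fst ?C" "q \<in> N" "y = snd ?C q" using y unfolding S_def by blast
    obtain u s where us: "q = (u, s)" by (cases q)
    have "smooth_at P q H"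
      using P.smooth_fun_at[OF H P.open_carrier order_refl] P.vector_field_carrier[OF X(1)] q by blast
    then have "X q = dir_deriv P ?C q (reduced_coords c d H y)"
      using X(2)[OF q(2)] reduced_field_chart[OF _ c(1), of u s H d] q us by simp
    then have "coords ?C (X q) = reduced_coords c d H y" by (simp only: P.coords_dir_deriv[OF C q(1)])
    then show ?thesis unfolding \<eta>_def q(3) P.in_chart_at[OF C q(1)] .
  qed
  have \<xi>': "\<eta>' X = frechet_derivative (reduced_coords c d H) (at x)"
    unfolding \<eta>'_def by (rule frechet_derivative_cong_open[OF S \<xi>])
  let ?n = "\<lambda>q. nu A \<Omega> q (Y1 q) (Y2 q) (Y3 q) (Y4 q)"
  have "smooth_at P p ?n"
    by (rule P.smooth_fun_at[OF nu_smooth[OF N(1) Y] N(1) P.vector_field_carrier[OF X(1)] N(2)])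
  then have "X p ?n = frechet_derivative (in_chart ?C ?n) (at x) (\<eta> X x)"
    unfolding Yp[OF X(1)] by (simp only: P.dir_deriv_apply x)
  also have "\<dots> = frechet_derivative (\<lambda>y. w y * det4 (\<eta> Y1 y) (\<eta> Y2 y) (\<eta> Y3 y) (\<eta> Y4 y)) (at x) (\<eta> X x)"
    by (rule fun_cong[OF frechet_derivative_cong_open[OF S]])
      (use nu_in_chart[OF N(1) Y c(1)] in \<open>auto simp: S_def \<eta>_def w_def\<close>)
  also have "\<dots> = w x * (det4 (\<eta>' Y1 (\<eta> X x)) (\<eta> Y2 x) (\<eta> Y3 x) (\<eta> Y4 x) + det4 (\<eta> Y1 x) (\<eta>' Y2 (\<eta> X x)) (\<eta> Y3 x) (\<eta> Y4 x)
      + det4 (\<eta> Y1 x) (\<eta> Y2 x) (\<eta>' Y3 (\<eta> X x)) (\<eta> Y4 x) + det4 (\<eta> Y1 x) (\<eta> Y2 x) (\<eta> Y3 x) (\<eta>' Y4 (\<eta> X x)))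
      + w' (\<eta> X x) * det4 (\<eta> Y1 x) (\<eta> Y2 x) (\<eta> Y3 x) (\<eta> Y4 x)"
    using fun_cong[OF frechet_derivative_at[OF has_derivative_mult[OF w'
          has_derivative_det4[OF \<eta>'[OF Y(1)] \<eta>'[OF Y(2)] \<eta>'[OF Y(3)] \<eta>'[OF Y(4)] refl]]], of "\<eta> X x"] by simp
  finally have lhs: "X p ?n = \<dots>" .
  have br: "bracket P X Y p = dir_deriv P ?C p (\<eta>' Y (\<eta> X x) - \<eta>' X (\<eta> Y x))" if "vector_field P N Y" for Y
    using P.bracket_chart[OF X(1) that N C pC] unfolding x \<eta>_def[symmetric] \<eta>'_def .
  have lin: "linear (\<eta>' X)"
    using \<eta>'[OF X(1)] has_derivative_bounded_linear bounded_linear.linear by blast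
  have div: "w x * (fst (fst (\<eta>' X ((1,0),0))) + snd (fst (\<eta>' X ((0,1),0))) + fst (snd (\<eta>' X (0,(1,0)))) + snd (snd (\<eta>' X (0,(0,1)))))
    + w' (\<eta> X x) = 0"
    unfolding \<xi>[OF S(2)] \<xi>' unfolding w'_def w_def x_def by (rule reduced_coords_divergence[OF c us(2) H])
  have nu: "nu A \<Omega> p (dir_deriv P ?C p a) (dir_deriv P ?C p b) (dir_deriv P ?C p a') (dir_deriv P ?C p b') = w x * det4 a b a' b'"
    for a b a' b' unfolding us wx by (rule nu_chart[OF c us(2)])
  let ?d = "det4 (\<eta> Y1 x) (\<eta> Y2 x) (\<eta> Y3 x) (\<eta> Y4 x)"
  let ?t = "fst (fst (\<eta>' X ((1,0),0))) + snd (fst (\<eta>' X ((0,1),0))) + fst (snd (\<eta>' X (0,(1,0)))) + snd (snd (\<eta>' X (0,(0,1))))"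
  have tr: "w x * (det4 (\<eta>' X (\<eta> Y1 x)) (\<eta> Y2 x) (\<eta> Y3 x) (\<eta> Y4 x) + det4 (\<eta> Y1 x) (\<eta>' X (\<eta> Y2 x)) (\<eta> Y3 x) (\<eta> Y4 x)
      + det4 (\<eta> Y1 x) (\<eta> Y2 x) (\<eta>' X (\<eta> Y3 x)) (\<eta> Y4 x) + det4 (\<eta> Y1 x) (\<eta> Y2 x) (\<eta> Y3 x) (\<eta>' X (\<eta> Y4 x)))
      = - w' (\<eta> X x) * ?d"
  proof -
    have "w x * (?t * ?d) = (w x * ?t) * ?d" by simp
    also have "\<dots> = - w' (\<eta> X x) * ?d" using div by (metis add.inverse_unique minus_equation_iff add.commute)
    finally show ?thesis unfolding det4_trace[OF lin] .
  qed
  show ?thesis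
    unfolding lhs br[OF Y(1)] br[OF Y(2)] br[OF Y(3)] br[OF Y(4)]
    unfolding Yp[OF Y(1)] Yp[OF Y(2)] Yp[OF Y(3)] Yp[OF Y(4)] nu det4_diff
    using tr by (simp add: algebra_simps)
qed

section \<open>Frames with nonvanishing volume\<close>

lemma lincomb_4: "lincomb a b = scal (a 1) (b 1) + scal (a 2) (b 2) + scal (a 3) (b 3) + scal (a (4 :: 4)) (b 4)"
  by (simp add: lincomb_def sum_4)

text \<open>Cramer's rule in a chart; the density cancels in the quotients, so the components are
  expressed by \<nu> without reference to charts. Existence, uniqueness and smoothness of the
  coframe all come from this formula.\<close>

lemma lincomb_iff_cramer:
  fixes b :: "4 \<Rightarrow> ((real \<times> real) \<times> 's) tangent"
  assumes b: "\<And>i. b i \<in> tangent_space P p" and v: "v \<in> tangent_space P p"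
    and n: "n = nu A \<Omega> p (b 1) (b 2) (b 3) (b 4)" "n \<noteq> 0"
  shows "v = lincomb a b \<longleftrightarrow> a = frame4 (nu A \<Omega> p v (b 2) (b 3) (b 4) / n) (nu A \<Omega> p (b 1) v (b 3) (b 4) / n)
    (nu A \<Omega> p (b 1) (b 2) v (b 4) / n) (nu A \<Omega> p (b 1) (b 2) (b 3) v / n)"
proof -
  obtain u s where us: "p = (u, s)" "u \<in> U" "s \<in> carrier A" using P.tangent_carrier[OF v] by (auto simp: carrier_P)
  obtain c where c: "c \<in> A" "s \<in> fst c" using carrier_chart us by blast
  let ?C = "prod_chart U c"
  define X where "X = coords ?C"
  have pC: "p \<in> fst ?C" using us c by simp
  have nu: "nu A \<Omega> p v1 v2 v3 v4 = omega c s * det4 (X v1) (X v2) (X v3) (X v4)"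
    if "v1 \<in> tangent_space P p" "v2 \<in> tangent_space P p" "v3 \<in> tangent_space P p" "v4 \<in> tangent_space P p" for v1 v2 v3 v4
    using nu_coords[OF c(1)] pC that unfolding us X_def by blast
  note nz = omega_nonzero[OF c]
  define D where "D = det4 (X (b 1)) (X (b 2)) (X (b 3)) (X (b 4))"
  have D: "D \<noteq> 0" "n = omega c s * D" using n nu b by (auto simp: D_def)
  have sum: "X (lincomb a b) = a 1 *\<^sub>R X (b 1) + a 2 *\<^sub>R X (b 2) + a 3 *\<^sub>R X (b 3) + a 4 *\<^sub>R X (b 4)" for a
    unfolding lincomb_4 X_def using coords_lincomb2[where a = 1 and v = "_ + _"] coords_lincomb2
    by (metis (no_types) scal_simps(1) scaleR_one)
  have "lincomb a b \<in> tangent_space P p" unfolding lincomb_4 using b by (intro P.tangent_add P.tangent_scal)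
  then have "v = lincomb a b \<longleftrightarrow> X v = X (lincomb a b)"
    using P.tangent_eqI[OF prod_chart_in[OF c(1)] pC v] unfolding X_def by blast
  also have "\<dots> \<longleftrightarrow> a 1 = det4 (X v) (X (b 2)) (X (b 3)) (X (b 4)) / D \<and> a 2 = det4 (X (b 1)) (X v) (X (b 3)) (X (b 4)) / D
    \<and> a 3 = det4 (X (b 1)) (X (b 2)) (X v) (X (b 4)) / D \<and> a 4 = det4 (X (b 1)) (X (b 2)) (X (b 3)) (X v) / D"
    (is "_ \<longleftrightarrow> ?cr")
  proof
    assume "X v = X (lincomb a b)"
    then have v: "X v = a 1 *\<^sub>R X (b 1) + a 2 *\<^sub>R X (b 2) + a 3 *\<^sub>R X (b 3) + a 4 *\<^sub>R X (b 4)" using sum by simp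
    show ?cr unfolding v det4_add det4_scale using D(1) by (simp add: D_def)
  next
    assume cr: ?cr
    have "D *\<^sub>R X v = D *\<^sub>R X (lincomb a b)"
      unfolding sum det4_cramer[of "X (b 1)" "X (b 2)" "X (b 3)" "X (b 4)" "X v", folded D_def]
      using cr D(1) by (simp add: scaleR_add_right)
    then show "X v = X (lincomb a b)" using D(1) by simp
  qed
  also have "\<dots> \<longleftrightarrow> a = frame4 (nu A \<Omega> p v (b 2) (b 3) (b 4) / n) (nu A \<Omega> p (b 1) v (b 3) (b 4) / n)
    (nu A \<Omega> p (b 1) (b 2) v (b 4) / n) (nu A \<Omega> p (b 1) (b 2) (b 3) v / n)"
    unfolding fun_eq_iff forall_4 frame4_simps using b v nz D by (simp add: nu)
  finally show ?thesis .
qed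

end

section \<open>Connections given by coefficients in a frame\<close>

lemma lincomb_apply: "lincomb a b f = a 1 * b 1 f + a 2 * b 2 f + a 3 * b 3 f + a (4 :: 4) * b 4 f"
  by (simp add: lincomb_def sum_4 scal_def)

lemma sum_fun_apply: "(\<Sum>i\<in>I. f i) x = (\<Sum>i\<in>I. f i x)"
  by (induction I rule: infinite_finite_induct) auto

lemma lincomb_apply': "lincomb a b f = (\<Sum>i\<in>UNIV. a i * b i f)"
  by (simp add: lincomb_def sum_fun_apply scal_def)

lemma fscal_apply: "fscal h X p f = h p * X p f"
  by (simp add: fscal_def scal_def)

text \<open>\<open>coframe\<close> is a unique choice at each point, so its smooth dependence on the
  point is a separate assumption; for the reduced fields Cramer's rule supplies it.\<close>

locale framed = manifold A
  for A :: "('m::{t2_space, second_countable_topology}, 'e::euclidean_space) atlas" +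
  fixes N :: "'m set" and E :: "4 \<Rightarrow> 'm field"
  assumes open_N: "open N" and frame: "frame A N E"
    and coframe_smooth: "\<And>M X i. open M \<Longrightarrow> M \<subseteq> N \<Longrightarrow> vector_field A M X
      \<Longrightarrow> smooth_fun A M (\<lambda>p. coframe E i p (X p))"
begin

lemma E_field: "vector_field A N (E i)"
  using frame unfolding frame_def by blast

lemma N_carrier: "N \<subseteq> carrier A"
  using vector_field_carrier[OF E_field] .

lemma E_tangent: "p \<in> N \<Longrightarrow> E i p \<in> tangent_space A p"
  using vector_field_tangent[OF E_field] .

lemma lincomb_tangent: "p \<in> N \<Longrightarrow> lincomb a (\<lambda>i. E i p) \<in> tangent_space A p"
  unfolding lincomb_def using N_carrier by (intro tangent_sum tangent_scal E_tangent) auto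

lemma basis: "p \<in> N \<Longrightarrow> v \<in> tangent_space A p \<Longrightarrow> \<exists>!a. v = lincomb a (\<lambda>i. E i p)"
  using frame unfolding frame_def basis_at_def by blast

lemma coframe_lincomb: "p \<in> N \<Longrightarrow> coframe E i p (lincomb a (\<lambda>i. E i p)) = a i"
  unfolding coframe_def using the1_equality[OF basis[OF _ lincomb_tangent] refl] by simp

lemma lincomb_coframe: "p \<in> N \<Longrightarrow> v \<in> tangent_space A p \<Longrightarrow> lincomb (\<lambda>i. coframe E i p v) (\<lambda>i. E i p) = v"
  unfolding coframe_def using theI'[OF basis] by auto

lemma coframe_add_scal:
  assumes "p \<in> N" "u \<in> tangent_space A p" "v \<in> tangent_space A p"
  shows "coframe E i p (scal s u + scal t v) = s * coframe E i p u + t * coframe E i p v"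
proof -
  have "scal s u + scal t v = lincomb (\<lambda>i. s * coframe E i p u + t * coframe E i p v) (\<lambda>i. E i p)"
    by (subst lincomb_coframe[OF assms(1,2), symmetric], subst lincomb_coframe[OF assms(1,3), symmetric])
      (simp add: fun_eq_iff lincomb_apply scal_def algebra_simps)
  then show ?thesis using coframe_lincomb[OF assms(1)] by simp
qed

lemma coframe_add:
  "p \<in> N \<Longrightarrow> u \<in> tangent_space A p \<Longrightarrow> v \<in> tangent_space A p
    \<Longrightarrow> coframe E i p (u + v) = coframe E i p u + coframe E i p v"
  using coframe_add_scal[of p u v i 1 1] by simp

lemma coframe_scal: "p \<in> N \<Longrightarrow> u \<in> tangent_space A p \<Longrightarrow> coframe E i p (scal s u) = s * coframe E i p u"
  using coframe_add_scal[of p u u i s 0] by simp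

lemma coframe_zero: "p \<in> N \<Longrightarrow> coframe E i p 0 = 0"
  using coframe_scal[of p "E i p" i 0] E_tangent by simp

lemma coframe_sum_scal:
  assumes p: "p \<in> N" and "\<And>j. j \<in> J \<Longrightarrow> b j \<in> tangent_space A p"
  shows "coframe E i p (\<Sum>j\<in>J. scal (a j) (b j)) = (\<Sum>j\<in>J. a j * coframe E i p (b j))"
  using assms(2)
proof (induction J rule: infinite_finite_induct)
  case (insert j J)
  have "(\<Sum>j\<in>J. scal (a j) (b j)) \<in> tangent_space A p"
    using insert.prems N_carrier p by (intro tangent_sum tangent_scal) auto
  moreover have "scal (a j) (b j) \<in> tangent_space A p" using insert.prems by (intro tangent_scal) simp
  moreover have "coframe E i p (scal (a j) (b j)) = a j * coframe E i p (b j)"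
    using insert.prems p by (intro coframe_scal) simp_all
  moreover have "coframe E i p (\<Sum>j\<in>J. scal (a j) (b j)) = (\<Sum>j\<in>J. a j * coframe E i p (b j))"
    using insert.prems by (intro insert.IH) simp
  ultimately show ?case
    unfolding sum.insert[OF insert.hyps] by (simp only: coframe_add[OF p])
qed (simp_all add: coframe_zero p)

lemma coframe_E: "p \<in> N \<Longrightarrow> coframe E i p (E j p) = (if i = j then 1 else 0)"
proof -
  assume p: "p \<in> N"
  have "E j p = lincomb (\<lambda>i. if i = j then 1 else 0) (\<lambda>i. E i p)"
    using exhaust_4[of j] by (auto simp: fun_eq_iff lincomb_apply)
  then show ?thesis using coframe_lincomb[OF p, of i "\<lambda>i. if i = j then 1 else 0"] by simp
qed

text \<open>Off N the frame vectors vanish, so such a field is zero there whatever its components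
  are. Identities need checking on N only (\<open>field_of_cong\<close>) and then hold as equalities
  of fields, the form that \<open>levi_civita\<close> asks for.\<close>

definition field_of :: "(4 \<Rightarrow> 'm \<Rightarrow> real) \<Rightarrow> 'm field" where
  "field_of a = (\<lambda>p. lincomb (\<lambda>i. a i p) (\<lambda>i. E i p))"

definition comps :: "4 \<Rightarrow> 'm field \<Rightarrow> 'm \<Rightarrow> real" where
  "comps i X = (\<lambda>p. coframe E i p (X p))"

lemma field_of_eq: "field_of a = fscal (a 1) (E 1) + fscal (a 2) (E 2) + fscal (a 3) (E 3) + fscal (a 4) (E 4)"
  by (simp add: fun_eq_iff field_of_def lincomb_apply fscal_def scal_def)

lemma field_of_apply: "field_of a p f = (\<Sum>i\<in>UNIV. a i p * E i p f)"
  by (simp add: field_of_def lincomb_apply')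

lemma field_of_field: "(\<And>i. smooth_fun A N (a i)) \<Longrightarrow> vector_field A N (field_of a)"
  unfolding field_of_eq by (intro vector_field_add vector_field_fscal open_N E_field)

lemma comps_field_of: "p \<in> N \<Longrightarrow> comps i (field_of a) p = a i p"
  by (simp add: comps_def field_of_def coframe_lincomb)

lemma field_of_outside: "p \<notin> N \<Longrightarrow> field_of a p = 0"
  using vector_field_outside[OF E_field] by (simp add: fun_eq_iff field_of_apply)

lemma field_of_comps: "vector_field A N X \<Longrightarrow> field_of (\<lambda>i. comps i X) = X"
proof
  fix p assume X: "vector_field A N X"
  show "field_of (\<lambda>i. comps i X) p = X p"
  proof (cases "p \<in> N")
    case True
    then show ?thesis unfolding field_of_def comps_def using lincomb_coframe vector_field_tangent[OF X] by blast
  next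
    case False
    then show ?thesis using field_of_outside vector_field_outside[OF X] by metis
  qed
qed

lemma field_of_cong: "(\<And>i p. p \<in> N \<Longrightarrow> a i p = b i p) \<Longrightarrow> field_of a = field_of b"
proof
  fix p assume "\<And>i p. p \<in> N \<Longrightarrow> a i p = b i p"
  then show "field_of a p = field_of b p"
    by (cases "p \<in> N") (simp_all add: field_of_outside, simp add: field_of_def)
qed

lemma field_of_add: "field_of a + field_of b = field_of (\<lambda>i p. a i p + b i p)"
  by (simp add: fun_eq_iff field_of_apply sum.distrib algebra_simps)

lemma field_of_diff: "field_of a - field_of b = field_of (\<lambda>i p. a i p - b i p)"
  by (simp add: fun_eq_iff field_of_apply sum_subtractf algebra_simps)

lemma fscal_field_of: "fscal h (field_of a) = field_of (\<lambda>i p. h p * a i p)"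
  by (simp add: fun_eq_iff field_of_apply fscal_def scal_def sum_distrib_left mult.assoc)

lemma comps_smooth: "vector_field A N X \<Longrightarrow> smooth_fun A N (comps i X)"
  unfolding comps_def using coframe_smooth[OF open_N order_refl] .

lemma smooth_at_N: "smooth_fun A N f \<Longrightarrow> p \<in> N \<Longrightarrow> smooth_at A p f"
  using smooth_fun_at open_N N_carrier by blast

lemma tangent_cong_N: "v \<in> tangent_space A p \<Longrightarrow> p \<in> N \<Longrightarrow> (\<And>q. q \<in> N \<Longrightarrow> f q = g q) \<Longrightarrow> v f = v g"
  using tangent_cong[OF _ open_N] by blast

lemma vector_field_diff:
  assumes "vector_field A N X" "vector_field A N Y" shows "vector_field A N (X - Y)"
proof -
  have eq: "X - Y = X + fscal (\<lambda>p. -1) Y" by (simp add: fun_eq_iff fscal_apply)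
  show ?thesis unfolding eq by (intro vector_field_add open_N assms vector_field_fscal smooth_fun_const)
qed

definition struct :: "4 \<Rightarrow> 4 \<Rightarrow> 4 \<Rightarrow> 'm \<Rightarrow> real" where
  "struct i j k = comps k (bracket A (E i) (E j))"

lemma struct_smooth: "smooth_fun A N (struct i j k)"
  unfolding struct_def by (intro comps_smooth vector_field_bracket E_field open_N)

lemma bracket_struct: "bracket A (E i) (E j) = field_of (struct i j)"
  using field_of_comps[OF vector_field_bracket[OF E_field E_field open_N], of i j] by (simp add: struct_def[abs_def])

lemma field_apply_expand:
  assumes X: "vector_field A N X" shows "X p f = (\<Sum>i\<in>UNIV. comps i X p * E i p f)"
  using fun_cong[OF fun_cong[OF field_of_comps[OF X]], of p f] by (simp add: field_of_apply)

text \<open>Leibniz rule in both arguments: the second-order terms in the frame occur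
  antisymmetrically and combine into the structure functions.\<close>

lemma bracket_expand:
  assumes X: "vector_field A N X" and Y: "vector_field A N Y"
  shows "bracket A X Y = field_of (\<lambda>k p. X p (comps k Y) - Y p (comps k X)
    + (\<Sum>i\<in>UNIV. \<Sum>j\<in>UNIV. comps i X p * comps j Y p * struct i j k p))"
proof (rule ext, rule ext)
  fix p f
  show "bracket A X Y p f = field_of (\<lambda>k p. X p (comps k Y) - Y p (comps k X)
    + (\<Sum>i\<in>UNIV. \<Sum>j\<in>UNIV. comps i X p * comps j Y p * struct i j k p)) p f"
  proof (cases "p \<in> N \<and> smooth_at A p f")
    case True
    then have p: "p \<in> N" and f: "smooth_at A p f" by auto
    have *: "V p (\<lambda>q. W q f) = (\<Sum>k\<in>UNIV. V p (comps k W) * E k p f)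
      + (\<Sum>i\<in>UNIV. \<Sum>j\<in>UNIV. comps i V p * comps j W p * E i p (\<lambda>q. E j q f))"
      if V: "vector_field A N V" and W: "vector_field A N W" for V W
    proof -
      have T: "V p \<in> tangent_space A p" by (rule vector_field_tangent[OF V p])
      have sc: "smooth_at A p (comps j W)" for j by (rule smooth_at_N[OF comps_smooth[OF W] p])
      have sE: "smooth_at A p (\<lambda>q. E j q f)" for j by (rule smooth_at_vector_field[OF E_field open_N p f])
      have "V p (\<lambda>q. W q f) = V p (\<lambda>q. \<Sum>j\<in>UNIV. comps j W q * E j q f)"
        using field_apply_expand[OF W] by simp
      also have "\<dots> = (\<Sum>j\<in>UNIV. V p (\<lambda>q. comps j W q * E j q f))"
        by (rule tangent_fun_sum[OF T smooth_at_mult[OF sc sE]])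
      also have "\<dots> = (\<Sum>j\<in>UNIV. V p (comps j W) * E j p f + comps j W p * V p (\<lambda>q. E j q f))"
        by (simp add: tangent_fun_mult[OF T sc sE])
      also have "\<dots> = (\<Sum>k\<in>UNIV. V p (comps k W) * E k p f)
        + (\<Sum>j\<in>UNIV. \<Sum>i\<in>UNIV. comps i V p * comps j W p * E i p (\<lambda>q. E j q f))"
        by (simp add: sum.distrib field_apply_expand[OF V] sum_distrib_left algebra_simps)
      finally show ?thesis by (subst sum.swap)
    qed
    have E: "E i p (\<lambda>q. E j q f) - E j p (\<lambda>q. E i q f) = (\<Sum>k\<in>UNIV. struct i j k p * E k p f)" for i j
      using fun_cong[OF fun_cong[OF bracket_struct[of i j]], of p f] f by (simp add: bracket_def field_of_apply)
    have "bracket A X Y p f = (\<Sum>k\<in>UNIV. (X p (comps k Y) - Y p (comps k X)) * E k p f)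
      + ((\<Sum>i\<in>UNIV. \<Sum>j\<in>UNIV. comps i X p * comps j Y p * E i p (\<lambda>q. E j q f))
       - (\<Sum>j\<in>UNIV. \<Sum>i\<in>UNIV. comps j Y p * comps i X p * E j p (\<lambda>q. E i q f)))"
      using f by (simp add: bracket_def *[OF X Y] *[OF Y X] left_diff_distrib sum_subtractf)
    also have "(\<Sum>j\<in>UNIV. \<Sum>i\<in>UNIV. comps j Y p * comps i X p * E j p (\<lambda>q. E i q f))
      = (\<Sum>i\<in>UNIV. \<Sum>j\<in>UNIV. comps j Y p * comps i X p * E j p (\<lambda>q. E i q f))" by (rule sum.swap)
    also have "(\<Sum>i\<in>UNIV. \<Sum>j\<in>UNIV. comps i X p * comps j Y p * E i p (\<lambda>q. E j q f)) - \<dots>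
      = (\<Sum>i\<in>UNIV. \<Sum>j\<in>UNIV. comps i X p * comps j Y p * (E i p (\<lambda>q. E j q f) - E j p (\<lambda>q. E i q f)))"
      by (simp add: sum_subtractf[symmetric] algebra_simps)
    also have "\<dots> = (\<Sum>i\<in>UNIV. \<Sum>j\<in>UNIV. \<Sum>k\<in>UNIV. comps i X p * comps j Y p * struct i j k p * E k p f)"
      by (simp add: E sum_distrib_left mult.assoc)
    also have "\<dots> = (\<Sum>k\<in>UNIV. (\<Sum>i\<in>UNIV. \<Sum>j\<in>UNIV. comps i X p * comps j Y p * struct i j k p) * E k p f)"
      by (simp add: sum_4 algebra_simps)
    finally show ?thesis by (simp add: field_of_apply sum.distrib distrib_right)
  next
    case False
    \<comment> \<open>Off N, and on functions not smooth at p, every field gives 0, so both sides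
      vanish.\<close>
    have z: "dir p f = 0" if "vector_field A N dir" for dir
    proof (cases "p \<in> N")
      case True
      then have "\<not> smooth_at A p f" "dir p \<in> tangent_space A p" using False vector_field_tangent[OF that] by auto
      then show ?thesis by (metis dir_deriv_def tangentE)
    qed (simp add: vector_field_outside[OF that])
    show ?thesis
      unfolding field_of_apply using z[OF E_field] z[OF vector_field_bracket[OF X Y open_N]] by simp
  qed
qed

text \<open>\<open>\<Gamma> i j k\<close> is the \<open>E k\<close>-component of \<open>\<nabla>\<^bsub>E i\<^esub> (E j)\<close>, and \<open>riem \<Gamma> i j k m\<close> below is the
  \<open>E m\<close>-component of \<open>R(E i, E j)(E k)\<close>.\<close>

definition conn :: "(4 \<Rightarrow> 4 \<Rightarrow> 4 \<Rightarrow> 'm \<Rightarrow> real) \<Rightarrow> 'm field \<Rightarrow> 'm field \<Rightarrow> 'm field" where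
  "conn \<Gamma> X Y = field_of (\<lambda>k p. X p (comps k Y)
     + (\<Sum>i\<in>UNIV. \<Sum>j\<in>UNIV. comps i X p * comps j Y p * \<Gamma> i j k p))"

lemma comps_add:
  "vector_field A N X \<Longrightarrow> vector_field A N Y \<Longrightarrow> p \<in> N \<Longrightarrow> comps i (X + Y) p = comps i X p + comps i Y p"
  by (simp add: comps_def coframe_add vector_field_tangent)

lemma comps_fscal: "vector_field A N X \<Longrightarrow> p \<in> N \<Longrightarrow> comps i (fscal h X) p = h p * comps i X p"
  by (simp add: comps_def fscal_def coframe_scal vector_field_tangent)

lemma conn_field:
  assumes "\<And>i j k. smooth_fun A N (\<Gamma> i j k)" "vector_field A N X" "vector_field A N Y"
  shows "vector_field A N (conn \<Gamma> X Y)"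
  unfolding conn_def
  by (intro field_of_field smooth_fun_add smooth_fun_sum smooth_fun_mult open_N assms comps_smooth
      vector_field_smooth[OF assms(2) open_N order_refl])

lemma conn_torsion:
  assumes tor: "\<And>i j k p. p \<in> N \<Longrightarrow> \<Gamma> i j k p - \<Gamma> j i k p = struct i j k p"
    and X: "vector_field A N X" and Y: "vector_field A N Y"
  shows "conn \<Gamma> X Y - conn \<Gamma> Y X = bracket A X Y"
  unfolding conn_def bracket_expand[OF X Y] field_of_diff
proof (rule field_of_cong)
  fix k p assume p: "p \<in> N"
  have "(\<Sum>i\<in>UNIV. \<Sum>j\<in>UNIV. comps i Y p * comps j X p * \<Gamma> i j k p)
    = (\<Sum>i\<in>UNIV. \<Sum>j\<in>UNIV. comps j Y p * comps i X p * \<Gamma> j i k p)" by (rule sum.swap)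
  then show "X p (comps k Y) + (\<Sum>i\<in>UNIV. \<Sum>j\<in>UNIV. comps i X p * comps j Y p * \<Gamma> i j k p) -
      (Y p (comps k X) + (\<Sum>i\<in>UNIV. \<Sum>j\<in>UNIV. comps i Y p * comps j X p * \<Gamma> i j k p)) =
      X p (comps k Y) - Y p (comps k X) + (\<Sum>i\<in>UNIV. \<Sum>j\<in>UNIV. comps i X p * comps j Y p * struct i j k p)"
    by (simp add: tor[OF p, symmetric] sum_subtractf algebra_simps)
qed

lemma conn_add_left:
  assumes X: "vector_field A N X" and Y: "vector_field A N Y"
  shows "conn \<Gamma> (X + Y) Z = conn \<Gamma> X Z + conn \<Gamma> Y Z"
  unfolding conn_def field_of_add
  by (rule field_of_cong) (simp add: comps_add[OF X Y] distrib_right sum.distrib)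

lemma conn_add_right:
  assumes X: "vector_field A N X" and Y: "vector_field A N Y" and Z: "vector_field A N Z"
  shows "conn \<Gamma> Z (X + Y) = conn \<Gamma> Z X + conn \<Gamma> Z Y"
  unfolding conn_def field_of_add
proof (rule field_of_cong)
  fix k p assume p: "p \<in> N"
  have T: "Z p \<in> tangent_space A p" by (rule vector_field_tangent[OF Z p])
  have "Z p (comps k (X + Y)) = Z p (\<lambda>q. comps k X q + comps k Y q)"
    by (rule tangent_cong_N[OF T p]) (rule comps_add[OF X Y])
  also have "\<dots> = Z p (comps k X) + Z p (comps k Y)"
    by (rule tangent_fun_add[OF T smooth_at_N[OF comps_smooth[OF X] p] smooth_at_N[OF comps_smooth[OF Y] p]])
  finally show "Z p (comps k (X + Y)) + (\<Sum>i\<in>UNIV. \<Sum>j\<in>UNIV. comps i Z p * comps j (X + Y) p * \<Gamma> i j k p) =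
      Z p (comps k X) + (\<Sum>i\<in>UNIV. \<Sum>j\<in>UNIV. comps i Z p * comps j X p * \<Gamma> i j k p) +
      (Z p (comps k Y) + (\<Sum>i\<in>UNIV. \<Sum>j\<in>UNIV. comps i Z p * comps j Y p * \<Gamma> i j k p))"
    by (simp add: comps_add[OF X Y p] distrib_right distrib_left sum.distrib)
qed

lemma conn_fscal_left:
  assumes X: "vector_field A N X"
  shows "conn \<Gamma> (fscal h X) Y = fscal h (conn \<Gamma> X Y)"
  unfolding conn_def fscal_field_of
  by (rule field_of_cong)
    (simp add: comps_fscal[OF X] fscal_apply distrib_left sum_distrib_left mult.assoc)

lemma conn_fscal_right:
  assumes X: "vector_field A N X" and Y: "vector_field A N Y" and h: "smooth_fun A N h"
  shows "conn \<Gamma> X (fscal h Y) = fscal h (conn \<Gamma> X Y) + fscal (\<lambda>p. X p h) Y"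
proof -
  have "conn \<Gamma> X (fscal h Y) = fscal h (conn \<Gamma> X Y) + fscal (\<lambda>p. X p h) (field_of (\<lambda>i. comps i Y))"
    unfolding conn_def fscal_field_of field_of_add
  proof (rule field_of_cong)
    fix k p assume p: "p \<in> N"
    have T: "X p \<in> tangent_space A p" by (rule vector_field_tangent[OF X p])
    have "X p (comps k (fscal h Y)) = X p (\<lambda>q. h q * comps k Y q)"
      by (rule tangent_cong_N[OF T p]) (rule comps_fscal[OF Y])
    also have "\<dots> = X p h * comps k Y p + h p * X p (comps k Y)"
      by (rule tangent_fun_mult[OF T smooth_at_N[OF h p] smooth_at_N[OF comps_smooth[OF Y] p]])
    finally show "X p (comps k (fscal h Y)) + (\<Sum>i\<in>UNIV. \<Sum>j\<in>UNIV. comps i X p * comps j (fscal h Y) p * \<Gamma> i j k p) =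
        h p * (X p (comps k Y) + (\<Sum>i\<in>UNIV. \<Sum>j\<in>UNIV. comps i X p * comps j Y p * \<Gamma> i j k p)) + X p h * comps k Y p"
      by (simp add: comps_fscal[OF Y p] algebra_simps sum_distrib_left)
  qed
  then show ?thesis by (simp add: field_of_comps[OF Y])
qed

text \<open>Compatibility on the frame, \<open>met\<close>, extends to all fields because the
  derivatives of the components of X and Y match by the product rule; the remaining terms differ
  only in the order of summation.\<close>

lemma conn_metric:
  assumes \<Gamma>: "\<And>i j k. smooth_fun A N (\<Gamma> i j k)"
    and G: "\<And>i j. smooth_fun A N (G i j)"
    and met: "\<And>l i j p. p \<in> N \<Longrightarrow> E l p (G i j) = (\<Sum>k\<in>UNIV. \<Gamma> l i k p * G k j p + \<Gamma> l j k p * G i k p)"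
    and g: "\<And>p v w. p \<in> N \<Longrightarrow> v \<in> tangent_space A p \<Longrightarrow> w \<in> tangent_space A p \<Longrightarrow>
      g p v w = (\<Sum>i\<in>UNIV. \<Sum>j\<in>UNIV. G i j p * coframe E i p v * coframe E j p w)"
    and X: "vector_field A N X" and Y: "vector_field A N Y" and Z: "vector_field A N Z" and p: "p \<in> N"
  shows "Z p (\<lambda>q. g q (X q) (Y q)) = g p (conn \<Gamma> Z X p) (Y p) + g p (X p) (conn \<Gamma> Z Y p)"
proof -
  have T: "Z p \<in> tangent_space A p" by (rule vector_field_tangent[OF Z p])
  have gc: "g q (V q) (W q) = (\<Sum>i\<in>UNIV. \<Sum>j\<in>UNIV. G i j q * comps i V q * comps j W q)"
    if "vector_field A N V" "vector_field A N W" "q \<in> N" for q V W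
    using g[OF that(3) vector_field_tangent[OF that(1,3)] vector_field_tangent[OF that(2,3)]] by (simp add: comps_def)
  note s = smooth_at_N[OF G p] smooth_at_N[OF comps_smooth[OF X] p] smooth_at_N[OF comps_smooth[OF Y] p]
  have "Z p (\<lambda>q. g q (X q) (Y q)) = Z p (\<lambda>q. \<Sum>i\<in>UNIV. \<Sum>j\<in>UNIV. G i j q * comps i X q * comps j Y q)"
    by (rule tangent_cong_N[OF T p]) (rule gc[OF X Y])
  also have "\<dots> = (\<Sum>i\<in>UNIV. \<Sum>j\<in>UNIV. Z p (\<lambda>q. G i j q * comps i X q * comps j Y q))"
    using s tangent_carrier[OF T] by (simp add: tangent_fun_sum[OF T] smooth_at_sum smooth_at_mult)
  also have "\<dots> = (\<Sum>i\<in>UNIV. \<Sum>j\<in>UNIV. (Z p (G i j) * comps i X p + G i j p * Z p (comps i X)) * comps j Y p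
      + G i j p * comps i X p * Z p (comps j Y))"
    using s by (simp add: tangent_fun_mult[OF T] smooth_at_mult)
  also have "\<dots> = (\<Sum>i\<in>UNIV. \<Sum>j\<in>UNIV. ((\<Sum>l\<in>UNIV. comps l Z p * (\<Sum>k\<in>UNIV. \<Gamma> l i k p * G k j p + \<Gamma> l j k p * G i k p))
      * comps i X p + G i j p * Z p (comps i X)) * comps j Y p + G i j p * comps i X p * Z p (comps j Y))"
    by (simp add: field_apply_expand[OF Z, of p "G _ _"] met[OF p])
  finally have lhs: "Z p (\<lambda>q. g q (X q) (Y q)) = \<dots>" .
  have cc: "comps k (conn \<Gamma> Z W) p = Z p (comps k W) + (\<Sum>i\<in>UNIV. \<Sum>j\<in>UNIV. comps i Z p * comps j W p * \<Gamma> i j k p)" for k W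
    unfolding conn_def by (rule comps_field_of[OF p])
  \<comment> \<open>Values at p become opaque constants; what is left is the reindexing of two
    fourfold sums.\<close>
  define z where "z l = comps l Z p" for l
  define x where "x l = comps l X p" for l
  define y where "y l = comps l Y p" for l
  define \<gamma> where "\<gamma> i j k = \<Gamma> i j k p" for i j k
  define G' where "G' i j = G i j p" for i j
  have "(\<Sum>i\<in>UNIV. \<Sum>j\<in>UNIV. (\<Sum>l\<in>UNIV. z l * (\<Sum>k\<in>UNIV. \<gamma> l i k * G' k j + \<gamma> l j k * G' i k)) * x i * y j)
    = (\<Sum>i\<in>UNIV. \<Sum>j\<in>UNIV. \<Sum>l\<in>UNIV. \<Sum>k\<in>UNIV. z l * \<gamma> l i k * G' k j * x i * y j)
    + (\<Sum>i\<in>UNIV. \<Sum>j\<in>UNIV. \<Sum>l\<in>UNIV. \<Sum>k\<in>UNIV. z l * \<gamma> l j k * G' i k * x i * y j)"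
    by (simp add: sum_distrib_left sum_distrib_right sum.distrib algebra_simps)
  also have "(\<Sum>i\<in>UNIV. \<Sum>j\<in>UNIV. \<Sum>l\<in>UNIV. \<Sum>k\<in>UNIV. z l * \<gamma> l i k * G' k j * x i * y j)
      = (\<Sum>k\<in>UNIV. \<Sum>j\<in>UNIV. G' k j * (\<Sum>l\<in>UNIV. \<Sum>i\<in>UNIV. z l * x i * \<gamma> l i k) * y j)"
  proof -
    have "(\<Sum>i\<in>UNIV. \<Sum>j\<in>UNIV. \<Sum>l\<in>UNIV. \<Sum>k\<in>UNIV. z l * \<gamma> l i k * G' k j * x i * y j)
      = (\<Sum>i\<in>UNIV. \<Sum>j\<in>UNIV. \<Sum>k\<in>UNIV. \<Sum>l\<in>UNIV. z l * \<gamma> l i k * G' k j * x i * y j)"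
      by (intro sum.cong refl sum.swap)
    also have "\<dots> = (\<Sum>i\<in>UNIV. \<Sum>k\<in>UNIV. \<Sum>j\<in>UNIV. \<Sum>l\<in>UNIV. z l * \<gamma> l i k * G' k j * x i * y j)"
      by (intro sum.cong refl sum.swap)
    also have "\<dots> = (\<Sum>k\<in>UNIV. \<Sum>i\<in>UNIV. \<Sum>j\<in>UNIV. \<Sum>l\<in>UNIV. z l * \<gamma> l i k * G' k j * x i * y j)"
      by (rule sum.swap)
    also have "\<dots> = (\<Sum>k\<in>UNIV. \<Sum>j\<in>UNIV. \<Sum>i\<in>UNIV. \<Sum>l\<in>UNIV. z l * \<gamma> l i k * G' k j * x i * y j)"
      by (intro sum.cong refl sum.swap)
    also have "\<dots> = (\<Sum>k\<in>UNIV. \<Sum>j\<in>UNIV. \<Sum>l\<in>UNIV. \<Sum>i\<in>UNIV. z l * \<gamma> l i k * G' k j * x i * y j)"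
      by (intro sum.cong refl sum.swap)
    finally show ?thesis by (simp add: sum_distrib_left sum_distrib_right algebra_simps)
  qed
  also have "(\<Sum>i\<in>UNIV. \<Sum>j\<in>UNIV. \<Sum>l\<in>UNIV. \<Sum>k\<in>UNIV. z l * \<gamma> l j k * G' i k * x i * y j)
      = (\<Sum>i\<in>UNIV. \<Sum>k\<in>UNIV. G' i k * x i * (\<Sum>l\<in>UNIV. \<Sum>j\<in>UNIV. z l * y j * \<gamma> l j k))"
  proof -
    have "(\<Sum>i\<in>UNIV. \<Sum>j\<in>UNIV. \<Sum>l\<in>UNIV. \<Sum>k\<in>UNIV. z l * \<gamma> l j k * G' i k * x i * y j)
      = (\<Sum>i\<in>UNIV. \<Sum>j\<in>UNIV. \<Sum>k\<in>UNIV. \<Sum>l\<in>UNIV. z l * \<gamma> l j k * G' i k * x i * y j)"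
      by (intro sum.cong refl sum.swap)
    also have "\<dots> = (\<Sum>i\<in>UNIV. \<Sum>k\<in>UNIV. \<Sum>j\<in>UNIV. \<Sum>l\<in>UNIV. z l * \<gamma> l j k * G' i k * x i * y j)"
      by (intro sum.cong refl sum.swap)
    also have "\<dots> = (\<Sum>i\<in>UNIV. \<Sum>k\<in>UNIV. \<Sum>l\<in>UNIV. \<Sum>j\<in>UNIV. z l * \<gamma> l j k * G' i k * x i * y j)"
      by (intro sum.cong refl sum.swap)
    finally show ?thesis by (simp add: sum_distrib_left sum_distrib_right algebra_simps)
  qed
  finally have main: "(\<Sum>i\<in>UNIV. \<Sum>j\<in>UNIV. (\<Sum>l\<in>UNIV. z l * (\<Sum>k\<in>UNIV. \<gamma> l i k * G' k j + \<gamma> l j k * G' i k)) * x i * y j)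
    = (\<Sum>k\<in>UNIV. \<Sum>j\<in>UNIV. G' k j * (\<Sum>l\<in>UNIV. \<Sum>i\<in>UNIV. z l * x i * \<gamma> l i k) * y j)
    + (\<Sum>i\<in>UNIV. \<Sum>k\<in>UNIV. G' i k * x i * (\<Sum>l\<in>UNIV. \<Sum>j\<in>UNIV. z l * y j * \<gamma> l j k))" .
  show ?thesis
    unfolding lhs gc[OF conn_field[OF \<Gamma> Z X] Y p] gc[OF X conn_field[OF \<Gamma> Z Y] p] cc
    unfolding z_def[symmetric] x_def[symmetric] y_def[symmetric] \<gamma>_def[symmetric] G'_def[symmetric]
    using main by (simp add: distrib_left distrib_right sum.distrib)
qed

theorem levi_civita_conn:
  assumes "\<And>i j k. smooth_fun A N (\<Gamma> i j k)" "\<And>i j. smooth_fun A N (G i j)"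
    and "\<And>i j k p. p \<in> N \<Longrightarrow> \<Gamma> i j k p - \<Gamma> j i k p = struct i j k p"
    and "\<And>l i j p. p \<in> N \<Longrightarrow> E l p (G i j) = (\<Sum>k\<in>UNIV. \<Gamma> l i k p * G k j p + \<Gamma> l j k p * G i k p)"
    and "\<And>p v w. p \<in> N \<Longrightarrow> v \<in> tangent_space A p \<Longrightarrow> w \<in> tangent_space A p \<Longrightarrow>
      g p v w = (\<Sum>i\<in>UNIV. \<Sum>j\<in>UNIV. G i j p * coframe E i p v * coframe E j p w)"
  shows "levi_civita A N g (conn \<Gamma>)"
  unfolding levi_civita_def
  using conn_field[of \<Gamma>, OF assms(1)] conn_torsion[of \<Gamma>, OF assms(3)] conn_add_left conn_add_right
    conn_metric[of \<Gamma> G g, OF assms(1,2,4,5)] conn_fscal_left conn_fscal_right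
  by (intro conjI allI impI ballI) (elim conjE; simp)+

section \<open>Curvature in a frame\<close>

definition riem :: "(4 \<Rightarrow> 4 \<Rightarrow> 4 \<Rightarrow> 'm \<Rightarrow> real) \<Rightarrow> 4 \<Rightarrow> 4 \<Rightarrow> 4 \<Rightarrow> 4 \<Rightarrow> 'm \<Rightarrow> real" where
  "riem \<Gamma> i j k m p = E i p (\<Gamma> j k m) - E j p (\<Gamma> i k m)
     + (\<Sum>l\<in>UNIV. \<Gamma> j k l p * \<Gamma> i l m p - \<Gamma> i k l p * \<Gamma> j l m p) - (\<Sum>l\<in>UNIV. struct i j l p * \<Gamma> l k m p)"

lemma extend_eq: "extend E p v = field_of (\<lambda>i q. coframe E i p v)"
  by (simp add: extend_def field_of_def)

lemma conn_field_of:
  assumes X: "vector_field A N X"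
  shows "conn \<Gamma> X (field_of a) = field_of (\<lambda>k p. X p (a k) + (\<Sum>i\<in>UNIV. \<Sum>j\<in>UNIV. comps i X p * a j p * \<Gamma> i j k p))"
  unfolding conn_def
proof (rule field_of_cong)
  fix k p assume p: "p \<in> N"
  have "X p (comps k (field_of a)) = X p (a k)"
    by (rule tangent_cong_N[OF vector_field_tangent[OF X p] p]) (rule comps_field_of)
  then show "X p (comps k (field_of a)) + (\<Sum>i\<in>UNIV. \<Sum>j\<in>UNIV. comps i X p * comps j (field_of a) p * \<Gamma> i j k p)
    = X p (a k) + (\<Sum>i\<in>UNIV. \<Sum>j\<in>UNIV. comps i X p * a j p * \<Gamma> i j k p)"
    by (simp add: comps_field_of[OF p])
qed

text \<open>\<open>extend\<close> has constant components, so only the connection coefficients get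
  differentiated. It sees x, y, z through their coframe values alone, so these may be arbitrary
  operators.\<close>

lemma curv_coframe:
  assumes \<Gamma>: "\<And>i j k. smooth_fun A N (\<Gamma> i j k)" and p: "p \<in> N"
  shows "coframe E m p (curv A (conn \<Gamma>) E p x y z)
    = (\<Sum>i\<in>UNIV. \<Sum>j\<in>UNIV. \<Sum>k\<in>UNIV. coframe E i p x * coframe E j p y * coframe E k p z * riem \<Gamma> i j k m p)"
proof -
  define cf where "cf a = field_of (\<lambda>i q. a i)" for a :: "4 \<Rightarrow> real"
  have cf: "vector_field A N (cf a)" for a unfolding cf_def by (intro field_of_field smooth_fun_const)
  have cfc: "comps i (cf a) q = a i" if "q \<in> N" for i a q unfolding cf_def by (rule comps_field_of[OF that])
  have cf0: "cf a q (\<lambda>r. b) = 0" if "q \<in> N" for a q and b :: real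
    by (rule tangent_const[OF vector_field_tangent[OF cf that]])
  define a where "a i = coframe E i p x" for i
  define b where "b i = coframe E i p y" for i
  define c where "c i = coframe E i p z" for i
  have ext: "extend E p x = cf a" "extend E p y = cf b" "extend E p z = cf c"
    by (simp_all add: extend_eq cf_def a_def b_def c_def)
  have cc: "conn \<Gamma> (cf a) (cf b) = field_of (\<lambda>k p. \<Sum>i\<in>UNIV. \<Sum>j\<in>UNIV. a i * b j * \<Gamma> i j k p)" for a b
  proof -
    have "conn \<Gamma> (cf a) (cf b) = conn \<Gamma> (cf a) (field_of (\<lambda>i q. b i))" by (simp add: cf_def)
    also have "\<dots> = field_of (\<lambda>k p. \<Sum>i\<in>UNIV. \<Sum>j\<in>UNIV. a i * b j * \<Gamma> i j k p)"
      unfolding conn_field_of[OF cf] by (rule field_of_cong) (simp add: cfc cf0)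
    finally show ?thesis .
  qed
  have br: "bracket A (cf a) (cf b) = field_of (\<lambda>k p. \<Sum>i\<in>UNIV. \<Sum>j\<in>UNIV. a i * b j * struct i j k p)" for a b
  proof -
    have "cf a q (comps k (cf b)) = 0" if "q \<in> N" for q k a b
      using tangent_cong_N[OF vector_field_tangent[OF cf that] that cfc] cf0[OF that] by simp
    then show ?thesis unfolding bracket_expand[OF cf cf] by (intro field_of_cong) (simp add: cfc)
  qed
  have Ec: "E i p (\<lambda>q. \<Sum>j\<in>UNIV. \<Sum>k\<in>UNIV. b j * c k * \<Gamma> j k m q) = (\<Sum>j\<in>UNIV. \<Sum>k\<in>UNIV. b j * c k * E i p (\<Gamma> j k m))" for i b c
  proof -
    note T = E_tangent[OF p, of i]
    have s: "smooth_at A p (\<lambda>q. b j * c k * \<Gamma> j k m q)" for j k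
      by (intro smooth_at_mult smooth_at_const tangent_carrier[OF T] smooth_at_N[OF \<Gamma> p])
    have "E i p (\<lambda>q. \<Sum>j\<in>UNIV. \<Sum>k\<in>UNIV. b j * c k * \<Gamma> j k m q) = (\<Sum>j\<in>UNIV. \<Sum>k\<in>UNIV. E i p (\<lambda>q. b j * c k * \<Gamma> j k m q))"
      using s tangent_carrier[OF T] by (simp add: tangent_fun_sum[OF T] smooth_at_sum)
    then show ?thesis by (simp add: tangent_fun_cmult[OF T smooth_at_N[OF \<Gamma> p]])
  qed
  have d: "comps m (conn \<Gamma> (cf a) (conn \<Gamma> (cf b) (cf c))) p
    = (\<Sum>i\<in>UNIV. \<Sum>j\<in>UNIV. \<Sum>k\<in>UNIV. a i * b j * c k * (E i p (\<Gamma> j k m) + (\<Sum>l\<in>UNIV. \<Gamma> j k l p * \<Gamma> i l m p)))" for a b c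
  proof -
    have "comps m (conn \<Gamma> (cf a) (conn \<Gamma> (cf b) (cf c))) p = cf a p (\<lambda>q. \<Sum>j\<in>UNIV. \<Sum>k\<in>UNIV. b j * c k * \<Gamma> j k m q)
      + (\<Sum>i\<in>UNIV. \<Sum>l\<in>UNIV. a i * (\<Sum>j\<in>UNIV. \<Sum>k\<in>UNIV. b j * c k * \<Gamma> j k l p) * \<Gamma> i l m p)"
      unfolding cc conn_field_of[OF cf] comps_field_of[OF p] cfc[OF p] ..
    also have "cf a p (\<lambda>q. \<Sum>j\<in>UNIV. \<Sum>k\<in>UNIV. b j * c k * \<Gamma> j k m q)
      = (\<Sum>i\<in>UNIV. \<Sum>j\<in>UNIV. \<Sum>k\<in>UNIV. a i * b j * c k * E i p (\<Gamma> j k m))"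
      unfolding cf_def field_of_apply Ec by (simp add: sum_distrib_left mult.assoc)
    also have "(\<Sum>i\<in>UNIV. \<Sum>l\<in>UNIV. a i * (\<Sum>j\<in>UNIV. \<Sum>k\<in>UNIV. b j * c k * \<Gamma> j k l p) * \<Gamma> i l m p)
      = (\<Sum>i\<in>UNIV. \<Sum>j\<in>UNIV. \<Sum>k\<in>UNIV. a i * b j * c k * (\<Sum>l\<in>UNIV. \<Gamma> j k l p * \<Gamma> i l m p))"
      by (simp add: sum_4 algebra_simps)
    finally show ?thesis by (simp add: distrib_left sum.distrib)
  qed
  have e: "comps m (conn \<Gamma> (bracket A (cf a) (cf b)) (cf c)) p
    = (\<Sum>i\<in>UNIV. \<Sum>j\<in>UNIV. \<Sum>k\<in>UNIV. a i * b j * c k * (\<Sum>l\<in>UNIV. struct i j l p * \<Gamma> l k m p))" for a b c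
  proof -
    have v: "vector_field A N (bracket A (cf a) (cf b))" by (rule vector_field_bracket[OF cf cf open_N])
    have "comps m (conn \<Gamma> (bracket A (cf a) (cf b)) (cf c)) p
      = (\<Sum>l\<in>UNIV. \<Sum>k\<in>UNIV. comps l (bracket A (cf a) (cf b)) p * c k * \<Gamma> l k m p)"
      unfolding cf_def[of c] conn_field_of[OF v] comps_field_of[OF p]
      using tangent_const[OF vector_field_tangent[OF v p]] by simp
    also have "\<dots> = (\<Sum>i\<in>UNIV. \<Sum>j\<in>UNIV. \<Sum>k\<in>UNIV. a i * b j * c k * (\<Sum>l\<in>UNIV. struct i j l p * \<Gamma> l k m p))"
      unfolding br comps_field_of[OF p] by (simp add: sum_4 algebra_simps)
    finally show ?thesis .
  qed
  have d': "comps m (conn \<Gamma> (cf b) (conn \<Gamma> (cf a) (cf c))) p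
    = (\<Sum>i\<in>UNIV. \<Sum>j\<in>UNIV. \<Sum>k\<in>UNIV. a i * b j * c k * (E j p (\<Gamma> i k m) + (\<Sum>l\<in>UNIV. \<Gamma> i k l p * \<Gamma> j l m p)))"
    unfolding d by (subst sum.swap) (simp add: mult.commute mult.left_commute)
  have vf: "vector_field A N (conn \<Gamma> X Y)" if "vector_field A N X" "vector_field A N Y" for X Y
    by (rule conn_field[OF \<Gamma> that])
  have diff: "comps m (X - Y) p = comps m X p - comps m Y p" if "vector_field A N X" "vector_field A N Y" for X Y
  proof -
    have eq: "(X - Y) p = scal 1 (X p) + scal (-1) (Y p)" by (simp add: scal_def fun_eq_iff)
    show ?thesis
      unfolding comps_def eq coframe_add_scal[OF p vector_field_tangent[OF that(1) p] vector_field_tangent[OF that(2) p]]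
      by simp
  qed
  have r: "riem \<Gamma> i j k m p = (E i p (\<Gamma> j k m) + (\<Sum>l\<in>UNIV. \<Gamma> j k l p * \<Gamma> i l m p))
      - (E j p (\<Gamma> i k m) + (\<Sum>l\<in>UNIV. \<Gamma> i k l p * \<Gamma> j l m p)) - (\<Sum>l\<in>UNIV. struct i j l p * \<Gamma> l k m p)" for i j k
    by (simp add: riem_def sum_subtractf)
  have "coframe E m p (curv A (conn \<Gamma>) E p x y z) = comps m (conn \<Gamma> (cf a) (conn \<Gamma> (cf b) (cf c)) - conn \<Gamma> (cf b) (conn \<Gamma> (cf a) (cf c))
      - conn \<Gamma> (bracket A (cf a) (cf b)) (cf c)) p"
    by (simp only: curv_def curv_field_def ext comps_def)
  also have "\<dots> = comps m (conn \<Gamma> (cf a) (conn \<Gamma> (cf b) (cf c))) p - comps m (conn \<Gamma> (cf b) (conn \<Gamma> (cf a) (cf c))) p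
      - comps m (conn \<Gamma> (bracket A (cf a) (cf b)) (cf c)) p"
    using vf cf vector_field_bracket[OF cf cf open_N] by (simp add: diff vector_field_diff)
  also have "\<dots> = (\<Sum>i\<in>UNIV. \<Sum>j\<in>UNIV. \<Sum>k\<in>UNIV. a i * b j * c k * riem \<Gamma> i j k m p)"
    unfolding d[of a b c] d' e r by (simp add: right_diff_distrib sum_subtractf)
  finally show ?thesis by (simp only: a_def b_def c_def)
qed

end

section \<open>Matrices of size four\<close>

text \<open>Used as an induction rule that splits a frame index into its four values.\<close>

lemma all_4I: "P 1 \<Longrightarrow> P 2 \<Longrightarrow> P 3 \<Longrightarrow> P 4 \<Longrightarrow> P (i :: 4)"
  using exhaust_4[of i] by auto

lemma det_4:
  "det (A :: 'a::comm_ring_1^4^4) =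
    A$1$1 * (A$2$2 * (A$3$3 * A$4$4 - A$3$4 * A$4$3) - A$2$3 * (A$3$2 * A$4$4 - A$3$4 * A$4$2) + A$2$4 * (A$3$2 * A$4$3 - A$3$3 * A$4$2))
  - A$1$2 * (A$2$1 * (A$3$3 * A$4$4 - A$3$4 * A$4$3) - A$2$3 * (A$3$1 * A$4$4 - A$3$4 * A$4$1) + A$2$4 * (A$3$1 * A$4$3 - A$3$3 * A$4$1))
  + A$1$3 * (A$2$1 * (A$3$2 * A$4$4 - A$3$4 * A$4$2) - A$2$2 * (A$3$1 * A$4$4 - A$3$4 * A$4$1) + A$2$4 * (A$3$1 * A$4$2 - A$3$2 * A$4$1))
  - A$1$4 * (A$2$1 * (A$3$2 * A$4$3 - A$3$3 * A$4$2) - A$2$2 * (A$3$1 * A$4$3 - A$3$3 * A$4$1) + A$2$3 * (A$3$1 * A$4$2 - A$3$2 * A$4$1))"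
proof -
  have f1234: "finite {2::4, 3, 4}" "1 \<notin> {2::4, 3, 4}" by auto
  have f234: "finite {3::4, 4}" "2 \<notin> {3::4, 4}" by auto
  have f34: "finite {4::4}" "3 \<notin> {4::4}" by auto
  show ?thesis
    unfolding det_def UNIV_4
    unfolding sum_over_permutations_insert[OF f1234]
    unfolding sum_over_permutations_insert[OF f234]
    unfolding sum_over_permutations_insert[OF f34]
    unfolding permutes_sing
    by (simp add: sign_swap_id permutation_swap_id sign_compose sign_id swap_id_eq permutation_compose)
      (simp add: algebra_simps)
qed

lemma vector_4 [simp]:
  "(vector [a, b, c, d] :: 'a::zero^4) $ 1 = a" "(vector [a, b, c, d] :: 'a^4) $ 2 = b"
  "(vector [a, b, c, d] :: 'a^4) $ 3 = c" "(vector [a, b, c, d] :: 'a^4) $ 4 = d"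
  unfolding vector_def by simp_all

lemma matrix_inv_eqI:
  fixes A B :: "'a::semiring_1^'n^'n"
  assumes "A ** B = mat 1" "B ** A = mat 1" shows "matrix_inv A = B"
proof -
  have "A ** matrix_inv A = mat 1 \<and> matrix_inv A ** A = mat 1"
    unfolding matrix_inv_def by (rule someI[of _ B]) (use assms in simp)
  then show ?thesis by (metis assms(1) matrix_mul_assoc matrix_mul_lid matrix_mul_rid)
qed

lemma sum3_delta:
  fixes r :: "'a::finite \<Rightarrow> 'a \<Rightarrow> 'a \<Rightarrow> real"
  shows "(\<Sum>i\<in>UNIV. \<Sum>j\<in>UNIV. \<Sum>k\<in>UNIV.
    (if i = a then 1 else 0) * (if j = b then 1 else 0) * (if k = c then 1 else 0) * r i j k) = r a b c"
proof -
  have "(\<Sum>i\<in>UNIV. \<Sum>j\<in>UNIV. \<Sum>k\<in>UNIV. d i a * d j b * d k c * r i j k)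
    = (\<Sum>i\<in>UNIV. d i a * (\<Sum>j\<in>UNIV. d j b * (\<Sum>k\<in>UNIV. d k c * r i j k)))" for d :: "'a \<Rightarrow> 'a \<Rightarrow> real"
    by (simp add: sum_distrib_left mult.assoc)
  from this[of "\<lambda>i j. if i = j then 1 else 0"] show ?thesis by (simp add: mult_delta_left)
qed

section \<open>Self-dual frames\<close>

context framed
begin

lemma conn_diff_right:
  assumes "vector_field A N X" "vector_field A N Y" "vector_field A N Z"
  shows "conn \<Gamma> Z (X - Y) = conn \<Gamma> Z X - conn \<Gamma> Z Y"
  using conn_add_right[OF vector_field_diff[OF assms(1,2)] assms(2,3), of \<Gamma>] by simp

lemma extend_E: "p \<in> N \<Longrightarrow> extend E p (E i p) = E i"
  using exhaust_4[of i] by (auto simp: extend_eq fun_eq_iff field_of_apply coframe_E sum_4)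

text \<open>Zero torsion, used twice, turns the part of the cyclic sum belonging to i into [E i,
  [E j, E k]]; the Jacobi identity finishes.\<close>

lemma first_bianchi:
  assumes \<Gamma>: "\<And>i j k. smooth_fun A N (\<Gamma> i j k)"
    and tor: "\<And>i j k p. p \<in> N \<Longrightarrow> \<Gamma> i j k p - \<Gamma> j i k p = struct i j k p" and p: "p \<in> N"
  shows "riem \<Gamma> i j k m p + riem \<Gamma> j k i m p + riem \<Gamma> k i j m p = 0"
proof -
  note v = conn_field[of \<Gamma>, OF \<Gamma>] vector_field_bracket[OF _ _ open_N] E_field
  note t = conn_torsion[of \<Gamma>, OF tor]
  let ?R = "curv_field A (conn \<Gamma>)"
  have R: "coframe E m p (?R (E i) (E j) (E k) p) = riem \<Gamma> i j k m p" for i j k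
  proof -
    have "coframe E m p (?R (E i) (E j) (E k) p) = coframe E m p (curv A (conn \<Gamma>) E p (E i p) (E j p) (E k p))"
      by (simp only: curv_def extend_E[OF p])
    then show ?thesis
      unfolding curv_coframe[of \<Gamma>, OF \<Gamma> p] coframe_E[OF p] sum3_delta .
  qed
  have vR: "vector_field A N (?R (E i) (E j) (E k))" for i j k
    unfolding curv_field_def by (intro vector_field_diff v)
  have step: "conn \<Gamma> (E i) (conn \<Gamma> (E j) (E k)) - conn \<Gamma> (E i) (conn \<Gamma> (E k) (E j)) - conn \<Gamma> (bracket A (E j) (E k)) (E i)
    = bracket A (E i) (bracket A (E j) (E k))" for i j k
  proof -
    have "conn \<Gamma> (E i) (conn \<Gamma> (E j) (E k)) - conn \<Gamma> (E i) (conn \<Gamma> (E k) (E j))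
      = conn \<Gamma> (E i) (conn \<Gamma> (E j) (E k) - conn \<Gamma> (E k) (E j))"
      by (rule conn_diff_right[symmetric]) (intro v)+
    also have "\<dots> = conn \<Gamma> (E i) (bracket A (E j) (E k))" using t[OF _ E_field E_field] by simp
    finally show ?thesis using t[OF _ E_field v(2)[OF E_field E_field], of i j k] by simp
  qed
  have "?R (E i) (E j) (E k) + ?R (E j) (E k) (E i) + ?R (E k) (E i) (E j) = 0"
    using step[of i j k] step[of j k i] step[of k i j] jacobi[OF E_field E_field E_field open_N, of i j k]
    unfolding curv_field_def by (simp add: algebra_simps)
  from fun_cong[OF this, of p]
  have "?R (E i) (E j) (E k) p + ?R (E j) (E k) (E i) p + ?R (E k) (E i) (E j) p = 0"
    by (simp only: plus_fun_apply zero_fun_apply)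
  then have "coframe E m p (?R (E i) (E j) (E k) p + ?R (E j) (E k) (E i) p + ?R (E k) (E i) (E j) p) = 0"
    using coframe_zero[OF p] by simp
  then show ?thesis
    using vector_field_tangent[OF vR p] by (simp only: coframe_add[OF p] tangent_add R)
qed

end

text \<open>The fields \<open>E 1, E 2, E 3, E 4\<close> are \<open>W, W\<^sup>~, Z, Z\<^sup>~\<close>. In spinor notation \<open>E\<^bsub>AA'\<^esub>\<close> they are
  \<open>E\<^bsub>00'\<^esub>, E\<^bsub>11'\<^esub>, E\<^bsub>10'\<^esub>, E\<^bsub>01'\<^esub>\<close>.\<close>

locale self_dual_frame = framed A N E
  for A :: "('m::{t2_space, second_countable_topology}, 'e::euclidean_space) atlas" and N E +
  fixes f2 :: "'m \<Rightarrow> real"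
  assumes f2_smooth: "smooth_fun A N f2" and f2_nonzero: "\<And>p. p \<in> N \<Longrightarrow> f2 p \<noteq> 0"
    and bracket_13: "\<And>p. p \<in> N \<Longrightarrow> bracket A (E 1) (E 3) p = 0"
    and bracket_24: "\<And>p. p \<in> N \<Longrightarrow> bracket A (E 2) (E 4) p = 0"
    and bracket_12: "\<And>p. p \<in> N \<Longrightarrow> bracket A (E 1) (E 2) p = bracket A (E 3) (E 4) p"
    and divergence: "\<And>p i. p \<in> N \<Longrightarrow> E i p f2 = f2 p * (\<Sum>k\<in>UNIV. struct i k k p)"
begin

lemma struct_antisym: "p \<in> N \<Longrightarrow> struct i j k p = - struct j i k p"
proof -
  assume p: "p \<in> N"
  have "bracket A (E i) (E j) p = scal (-1) (bracket A (E j) (E i) p)"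
    by (simp add: bracket_def scal_def fun_eq_iff)
  then show ?thesis
    using coframe_scal[OF p vector_field_tangent[OF vector_field_bracket[OF E_field E_field open_N] p], of k "-1" j i]
    by (simp add: struct_def comps_def)
qed

text \<open>In spinor notation [E_AA', E_BB'] = \<epsilon>_A'B' B_AB with B symmetric. Three fields
  remain: B_00 = [E 1, E 4], B_01 = [E 1, E 2] and B_11 = [E 3, E 2].\<close>

lemma struct_simps:
  assumes p: "p \<in> N"
  shows "struct i i k p = 0" "struct 1 3 k p = 0" "struct 3 1 k p = 0" "struct 2 4 k p = 0" "struct 4 2 k p = 0"
    "struct 2 1 k p = - struct 1 2 k p" "struct 3 4 k p = struct 1 2 k p" "struct 4 3 k p = - struct 1 2 k p"
    "struct 4 1 k p = - struct 1 4 k p" "struct 2 3 k p = - struct 3 2 k p"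
proof -
  have z: "struct 1 3 k p = 0" "struct 2 4 k p = 0"
    by (simp_all add: struct_def comps_def bracket_13[OF p] bracket_24[OF p] coframe_zero[OF p])
  have e: "struct 3 4 k p = struct 1 2 k p" by (simp add: struct_def comps_def bracket_12[OF p])
  show "struct i i k p = 0" using struct_antisym[OF p, of i i k] by simp
  show "struct 1 3 k p = 0" "struct 3 1 k p = 0" "struct 2 4 k p = 0" "struct 4 2 k p = 0"
    "struct 2 1 k p = - struct 1 2 k p" "struct 3 4 k p = struct 1 2 k p" "struct 4 3 k p = - struct 1 2 k p"
    "struct 4 1 k p = - struct 1 4 k p" "struct 2 3 k p = - struct 3 2 k p"
    using z e struct_antisym[OF p, of 3 1 k] struct_antisym[OF p, of 4 2 k] struct_antisym[OF p, of 2 1 k]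
      struct_antisym[OF p, of 4 3 k] struct_antisym[OF p, of 4 1 k] struct_antisym[OF p, of 2 3 k] by simp_all
qed

text \<open>The Levi-Civita connection acts on the unprimed spinor index only:
  \<open>\<nabla>\<^sub>i E\<^bsub>BB'\<^esub> = \<theta>\<^bsub>iB\<^esub>\<^sup>C E\<^bsub>CB'\<^esub>\<close>. Vanishing torsion determines the matrices \<open>\<theta>\<^sub>i\<close>.\<close>

definition \<theta>00 where "\<theta>00 = frame4 (struct 1 4 4) (\<lambda>p. - struct 1 2 1 p) (struct 1 2 4) (\<lambda>p. - struct 1 4 1 p)"
definition \<theta>01 where "\<theta>01 = frame4 (struct 1 4 2) (\<lambda>p. - struct 1 2 3 p) (struct 1 2 2) (\<lambda>p. - struct 1 4 3 p)"
definition \<theta>10 where "\<theta>10 = frame4 (struct 1 2 4) (\<lambda>p. - struct 3 2 1 p) (struct 3 2 4) (\<lambda>p. - struct 1 2 1 p)"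
definition \<theta>11 where "\<theta>11 = frame4 (struct 1 2 2) (\<lambda>p. - struct 3 2 3 p) (struct 3 2 2) (\<lambda>p. - struct 1 2 3 p)"

lemmas \<theta>_defs = \<theta>00_def \<theta>01_def \<theta>10_def \<theta>11_def

text \<open>Of the frame vectors, in the order 00', 11', 10', 01', the first and third share 0' and
  the others share 1'. Entries mixing the two pairs are zero, and both pairs carry the same 2 x 2
  matrix \<theta>.\<close>

definition \<Gamma> :: "4 \<Rightarrow> 4 \<Rightarrow> 4 \<Rightarrow> 'm \<Rightarrow> real" where
  "\<Gamma> i j k = frame4
     (frame4 (\<theta>00 i) (\<lambda>p. 0) (\<theta>01 i) (\<lambda>p. 0)) (frame4 (\<lambda>p. 0) (\<theta>11 i) (\<lambda>p. 0) (\<theta>10 i))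
     (frame4 (\<theta>10 i) (\<lambda>p. 0) (\<theta>11 i) (\<lambda>p. 0)) (frame4 (\<lambda>p. 0) (\<theta>01 i) (\<lambda>p. 0) (\<theta>00 i)) j k"

lemma \<Gamma>_simps:
  "\<Gamma> i 1 1 = \<theta>00 i" "\<Gamma> i 1 2 = (\<lambda>p. 0)" "\<Gamma> i 1 3 = \<theta>01 i" "\<Gamma> i 1 4 = (\<lambda>p. 0)"
  "\<Gamma> i 2 1 = (\<lambda>p. 0)" "\<Gamma> i 2 2 = \<theta>11 i" "\<Gamma> i 2 3 = (\<lambda>p. 0)" "\<Gamma> i 2 4 = \<theta>10 i"
  "\<Gamma> i 3 1 = \<theta>10 i" "\<Gamma> i 3 2 = (\<lambda>p. 0)" "\<Gamma> i 3 3 = \<theta>11 i" "\<Gamma> i 3 4 = (\<lambda>p. 0)"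
  "\<Gamma> i 4 1 = (\<lambda>p. 0)" "\<Gamma> i 4 2 = \<theta>01 i" "\<Gamma> i 4 3 = (\<lambda>p. 0)" "\<Gamma> i 4 4 = \<theta>00 i"
  by (simp_all add: \<Gamma>_def)

lemma \<theta>_smooth: "smooth_fun A N (\<theta>00 i)" "smooth_fun A N (\<theta>01 i)" "smooth_fun A N (\<theta>10 i)" "smooth_fun A N (\<theta>11 i)"
  unfolding \<theta>_defs by (induct i rule: all_4I; simp add: struct_smooth smooth_fun_minus open_N)+

lemma \<Gamma>_smooth: "smooth_fun A N (\<Gamma> i j k)"
  by (induct j rule: all_4I; induct k rule: all_4I; simp add: \<Gamma>_simps \<theta>_smooth smooth_fun_const)

text \<open>The definitions say \<theta>_A0'B^C = B_AB^C1' and \<theta>_A1'B^C = - B_AB^C0', that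
  is, the primed index of B_AB lowered with \<epsilon>. Since B is symmetric, the torsion equation
  becomes the vanishing of an expression skew in three primed indices, each of which takes two
  values.\<close>

lemma \<Gamma>_torsion: "p \<in> N \<Longrightarrow> \<Gamma> i j k p - \<Gamma> j i k p = struct i j k p"
  by (induct i rule: all_4I; induct j rule: all_4I; induct k rule: all_4I; simp add: \<Gamma>_simps \<theta>_defs struct_simps)

lemma \<theta>_trace: "p \<in> N \<Longrightarrow> \<theta>00 i p + \<theta>11 i p = (\<Sum>k\<in>UNIV. struct i k k p)"
  by (induct i rule: all_4I; simp add: sum_4 \<theta>_defs struct_simps)

text \<open>This makes the connection metric: it multiplies the area form on the unprimed index by
  minus the trace of \<theta>, and the derivative of \<open>f2\<close> compensates.\<close>

lemma E_f2: "p \<in> N \<Longrightarrow> E i p f2 = f2 p * (\<theta>00 i p + \<theta>11 i p)"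
  using divergence \<theta>_trace by simp

abbreviation "R i j k m p \<equiv> riem \<Gamma> i j k m p"

lemma R_antisym: "p \<in> N \<Longrightarrow> R i j k m p = - R j i k m p"
  using struct_antisym[of p i j] by (simp add: riem_def sum_4)

text \<open>The primed index stays inert in the curvature too, so zero entries and the repeated 2 x
  2 block carry over from \<Gamma>.\<close>

lemma R_simps:
  assumes p: "p \<in> N"
  shows "R i j 1 2 p = 0" "R i j 1 4 p = 0" "R i j 3 2 p = 0" "R i j 3 4 p = 0"
    "R i j 2 1 p = 0" "R i j 2 3 p = 0" "R i j 4 1 p = 0" "R i j 4 3 p = 0"
    "R i j 4 4 p = R i j 1 1 p" "R i j 4 2 p = R i j 1 3 p" "R i j 2 4 p = R i j 3 1 p" "R i j 2 2 p = R i j 3 3 p"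
  by (simp_all add: riem_def \<Gamma>_simps sum_4 tangent_const[OF E_tangent[OF p]])

text \<open>The trace of \<open>\<theta>\<close> is \<open>d (log f2)\<close>, so the curvature is trace free.\<close>

lemma R_trace:
  assumes p: "p \<in> N" shows "R i j 3 3 p = - R i j 1 1 p"
proof -
  define t where "t i q = \<theta>00 i q + \<theta>11 i q" for i q
  have sm: "smooth_at A p (\<theta>00 i)" "smooth_at A p (\<theta>11 i)" "smooth_at A p f2" for i
    using \<theta>_smooth f2_smooth smooth_at_N p by blast+
  have st: "smooth_at A p (t i)" for i unfolding t_def using sm by (intro smooth_at_add)
  have EE: "E i p (\<lambda>q. E j q f2) = f2 p * (t i p * t j p + E i p (t j))" for i j
  proof -
    have "E i p (\<lambda>q. E j q f2) = E i p (\<lambda>q. f2 q * t j q)"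
      by (rule tangent_cong_N[OF E_tangent[OF p] p]) (simp add: E_f2 t_def)
    also have "\<dots> = E i p f2 * t j p + f2 p * E i p (t j)"
      by (rule tangent_fun_mult[OF E_tangent[OF p] sm(3) st])
    finally show ?thesis by (simp add: E_f2[OF p] t_def algebra_simps)
  qed
  have "E i p (\<lambda>q. E j q f2) - E j p (\<lambda>q. E i q f2) = (\<Sum>l\<in>UNIV. struct i j l p * E l p f2)"
    using fun_cong[OF fun_cong[OF bracket_struct[of i j]], of p f2] sm(3) by (simp add: bracket_def field_of_apply)
  also have "\<dots> = f2 p * (\<Sum>l\<in>UNIV. struct i j l p * t l p)"
    by (simp add: E_f2[OF p] t_def sum_distrib_left algebra_simps)
  finally have "f2 p * (E i p (t j) - E j p (t i)) = f2 p * (\<Sum>l\<in>UNIV. struct i j l p * t l p)"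
    unfolding EE by (simp add: algebra_simps)
  then have "E i p (t j) - E j p (t i) = (\<Sum>l\<in>UNIV. struct i j l p * t l p)" using f2_nonzero[OF p] by simp
  moreover have "E i p (t j) = E i p (\<theta>00 j) + E i p (\<theta>11 j)" for i j
    unfolding t_def by (rule tangent_fun_add[OF E_tangent[OF p] sm(1,2)])
  ultimately show ?thesis by (simp add: riem_def \<Gamma>_simps sum_4 t_def algebra_simps)
qed

lemma R_bianchi: "p \<in> N \<Longrightarrow> R i j k m p + R j k i m p + R k i j m p = 0"
  by (rule first_bianchi[of \<Gamma>, OF \<Gamma>_smooth \<Gamma>_torsion])

text \<open>The first three equations say that the part \<phi>_A'B' of the curvature, symmetric in
  the primed pair, vanishes. What is left is \<psi>_AB from \<open>R 1 4\<close>,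
  \<open>R 1 2\<close>, \<open>R 3 2\<close>, and Bianchi with the trace condition makes it
  symmetric also in the index it acts on; every Ricci contraction then cancels.\<close>

lemma
  assumes p: "p \<in> N"
  shows R_13: "R 1 3 k m p = 0" and R_24: "R 2 4 k m p = 0" and R_34: "R 3 4 k m p = R 1 2 k m p"
    and R_ricci: "(\<Sum>i\<in>UNIV. R i j k i p) = 0"
proof -
  note a = R_antisym[OF p, of 2 1] R_antisym[OF p, of 3 1] R_antisym[OF p, of 4 1] R_antisym[OF p, of 3 2]
    R_antisym[OF p, of 4 2] R_antisym[OF p, of 4 3]
  note s = R_simps[OF p] R_trace[OF p]
  note B = R_bianchi[OF p, of 1 2 3] R_bianchi[OF p, of 1 2 4] R_bianchi[OF p, of 1 3 4] R_bianchi[OF p, of 2 3 4]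
  \<comment> \<open>All components reduce to the entries 11, 13, 31 of trace-free 2 x 2 blocks; the
    sixteen Bianchi equations, four index triples with four values of m, give these
    relations.\<close>
  have b: "R 1 3 1 1 p = 0" "R 1 3 1 3 p = 0" "R 1 3 3 1 p = 0" "R 2 4 1 1 p = 0" "R 2 4 1 3 p = 0" "R 2 4 3 1 p = 0"
    "R 3 4 1 1 p = R 1 2 1 1 p" "R 3 4 1 3 p = R 1 2 1 3 p" "R 3 4 3 1 p = R 1 2 3 1 p"
    "R 2 3 1 1 p = - R 1 2 3 1 p" "R 2 3 1 3 p = R 1 2 1 1 p"
    "R 1 4 3 1 p = R 1 2 1 1 p" "R 1 4 1 1 p = - R 1 2 1 3 p"
    using B[of 1] B[of 2] B[of 3] B[of 4] by (simp_all add: a s)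
  show "R 1 3 k m p = 0" by (induct k rule: all_4I; induct m rule: all_4I; simp add: s b)
  show "R 2 4 k m p = 0" by (induct k rule: all_4I; induct m rule: all_4I; simp add: s b)
  show "R 3 4 k m p = R 1 2 k m p" by (induct k rule: all_4I; induct m rule: all_4I; simp add: s b)
  have d: "R i i k m p = 0" for i k m using R_antisym[OF p, of i i k m] by simp
  show "(\<Sum>i\<in>UNIV. R i j k i p) = 0"
    by (induct j rule: all_4I; induct k rule: all_4I; simp add: sum_4 a d s b)
qed

end

section \<open>The metric and its signature\<close>

context self_dual_frame
begin

definition frame_metric :: "'m tensor2" where
  "frame_metric = (\<lambda>p v w. f2 p * (sym_prod (coframe E 1 p) (coframe E 2 p) v w - sym_prod (coframe E 3 p) (coframe E 4 p) v w))"

text \<open>The Gram matrix of the frame, with 1/2 from \<open>sym_prod\<close>. Nonzero entries are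
  literal constant multiples of \<open>f2\<close>, so that \<open>tangent_fun_cmult\<close>
  differentiates them.\<close>

definition G :: "4 \<Rightarrow> 4 \<Rightarrow> 'm \<Rightarrow> real" where
  "G i j = frame4
     (frame4 (\<lambda>p. 0) (\<lambda>p. 1/2 * f2 p) (\<lambda>p. 0) (\<lambda>p. 0)) (frame4 (\<lambda>p. 1/2 * f2 p) (\<lambda>p. 0) (\<lambda>p. 0) (\<lambda>p. 0))
     (frame4 (\<lambda>p. 0) (\<lambda>p. 0) (\<lambda>p. 0) (\<lambda>p. -1/2 * f2 p)) (frame4 (\<lambda>p. 0) (\<lambda>p. 0) (\<lambda>p. -1/2 * f2 p) (\<lambda>p. 0)) i j"

lemma G_simps:
  "G 1 1 = (\<lambda>p. 0)" "G 1 2 = (\<lambda>p. 1/2 * f2 p)" "G 1 3 = (\<lambda>p. 0)" "G 1 4 = (\<lambda>p. 0)"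
  "G 2 1 = (\<lambda>p. 1/2 * f2 p)" "G 2 2 = (\<lambda>p. 0)" "G 2 3 = (\<lambda>p. 0)" "G 2 4 = (\<lambda>p. 0)"
  "G 3 1 = (\<lambda>p. 0)" "G 3 2 = (\<lambda>p. 0)" "G 3 3 = (\<lambda>p. 0)" "G 3 4 = (\<lambda>p. -1/2 * f2 p)"
  "G 4 1 = (\<lambda>p. 0)" "G 4 2 = (\<lambda>p. 0)" "G 4 3 = (\<lambda>p. -1/2 * f2 p)" "G 4 4 = (\<lambda>p. 0)"
  unfolding G_def by (simp_all only: frame4_simps)

lemma frame_metric_G: "frame_metric p v w = (\<Sum>i\<in>UNIV. \<Sum>j\<in>UNIV. G i j p * coframe E i p v * coframe E j p w)"
  by (simp add: frame_metric_def sym_prod_def sum_4 G_simps field_simps)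

lemma G_smooth: "smooth_fun A N (G i j)"
  by (induct i rule: all_4I; induct j rule: all_4I; simp only: G_simps)
    (intro smooth_fun_mult smooth_fun_const open_N f2_smooth)+

lemma G_compatible:
  assumes p: "p \<in> N"
  shows "E l p (G i j) = (\<Sum>k\<in>UNIV. \<Gamma> l i k p * G k j p + \<Gamma> l j k p * G i k p)"
proof -
  have E: "E l p (\<lambda>q. a * f2 q) = a * (f2 p * (\<theta>00 l p + \<theta>11 l p))" for a
    by (simp only: tangent_fun_cmult[OF E_tangent[OF p] smooth_at_N[OF f2_smooth p]] E_f2[OF p])
  show ?thesis
    by (induct i rule: all_4I; induct j rule: all_4I; simp only: G_simps E tangent_const[OF E_tangent[OF p]] sum_4 \<Gamma>_simps)
      (simp_all add: algebra_simps)
qed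

lemma levi_civita_metric: "levi_civita A N frame_metric (conn \<Gamma>)"
  by (rule levi_civita_conn[of \<Gamma> G, OF \<Gamma>_smooth G_smooth \<Gamma>_torsion G_compatible frame_metric_G])

lemma metric_smooth_tensor2: "smooth_tensor2 A N frame_metric"
  unfolding smooth_tensor2_def
proof (intro conjI ballI allI impI)
  fix p assume p: "p \<in> N"
  show "bilinear_on (tangent_space A p) (frame_metric p)"
    unfolding bilinear_on_def frame_metric_def sym_prod_def
    by (simp add: coframe_add_scal[OF p] algebra_simps add_divide_distrib)
next
  fix M X Y assume M: "open M \<and> M \<subseteq> N \<and> vector_field A M X \<and> vector_field A M Y"
  have "smooth_fun A M (\<lambda>p. \<Sum>i\<in>UNIV. \<Sum>j\<in>UNIV. G i j p * coframe E i p (X p) * coframe E j p (Y p))"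
    using M by (intro smooth_fun_sum smooth_fun_mult coframe_smooth smooth_fun_subset[OF G_smooth]) auto
  then show "smooth_fun A M (\<lambda>p. frame_metric p (X p) (Y p))" by (simp only: frame_metric_G)
qed

lemma lincomb_eq_iff:
  assumes p: "p \<in> N" and v: "v \<in> tangent_space A p" and b: "\<And>j :: 4. b j \<in> tangent_space A p"
  shows "v = lincomb a b \<longleftrightarrow> (\<forall>i. coframe E i p v = (\<Sum>j\<in>UNIV. a j * coframe E i p (b j)))"
proof -
  have T: "lincomb a b \<in> tangent_space A p"
    unfolding lincomb_def using N_carrier p b by (intro tangent_sum tangent_scal) auto
  have c: "coframe E i p (lincomb a b) = (\<Sum>j\<in>UNIV. a j * coframe E i p (b j))" for i
    unfolding lincomb_def by (rule coframe_sum_scal[OF p b])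
  show ?thesis
  proof
    assume "\<forall>i. coframe E i p v = (\<Sum>j\<in>UNIV. a j * coframe E i p (b j))"
    then have "(\<lambda>i. coframe E i p v) = (\<lambda>i. coframe E i p (lincomb a b))" by (simp add: c)
    then show "v = lincomb a b" using lincomb_coframe[OF p v] lincomb_coframe[OF p T] by metis
  qed (simp add: c)
qed

lemma metric_neutral: "neutral_metric A N frame_metric"
  unfolding neutral_metric_def
proof (intro conjI ballI metric_smooth_tensor2)
  fix p v w
  show "frame_metric p v w = frame_metric p w v" by (simp add: frame_metric_def sym_prod_def algebra_simps)
next
  fix p assume p: "p \<in> N"
  \<comment> \<open>E 1 + \<epsilon> E 2 and E 3 - \<epsilon> E 4 both have square \<epsilon> f2 >
    0, and k normalises them to 1; with the opposite signs the squares become -1. The factor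
    \<epsilon> keeps this order also where f2 < 0.\<close>
  define \<epsilon> where "\<epsilon> = sgn (f2 p)"
  define k where "k = 1 / sqrt \<bar>f2 p\<bar>"
  have \<epsilon>: "\<epsilon> * \<epsilon> = 1" "\<epsilon> \<noteq> 0" using f2_nonzero[OF p] by (auto simp: \<epsilon>_def sgn_if)
  have k: "k \<noteq> 0" using f2_nonzero[OF p] by (simp add: k_def)
  have "k * k * \<bar>f2 p\<bar> = 1" using f2_nonzero[OF p] by (simp add: k_def)
  then have fk: "f2 p * \<epsilon> * k * k = 1" using f2_nonzero[OF p]
    by (simp add: \<epsilon>_def sgn_if abs_if mult.commute mult.left_commute split: if_splits)
  define b where "b = frame4 (scal k (E 1 p) + scal (k * \<epsilon>) (E 2 p)) (scal k (E 3 p) + scal (- k * \<epsilon>) (E 4 p))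
    (scal k (E 1 p) + scal (- k * \<epsilon>) (E 2 p)) (scal k (E 3 p) + scal (k * \<epsilon>) (E 4 p))"
  have bT: "b j \<in> tangent_space A p" for j
    by (induct j rule: all_4I; simp only: b_def frame4_simps; intro tangent_lincomb2 E_tangent[OF p])
  have c: "coframe E 1 p (b 1) = k" "coframe E 2 p (b 1) = k * \<epsilon>" "coframe E 3 p (b 1) = 0" "coframe E 4 p (b 1) = 0"
    "coframe E 1 p (b 2) = 0" "coframe E 2 p (b 2) = 0" "coframe E 3 p (b 2) = k" "coframe E 4 p (b 2) = - k * \<epsilon>"
    "coframe E 1 p (b 3) = k" "coframe E 2 p (b 3) = - k * \<epsilon>" "coframe E 3 p (b 3) = 0" "coframe E 4 p (b 3) = 0"
    "coframe E 1 p (b 4) = 0" "coframe E 2 p (b 4) = 0" "coframe E 3 p (b 4) = k" "coframe E 4 p (b 4) = k * \<epsilon>"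
    by (simp_all add: b_def coframe_add_scal[OF p E_tangent[OF p] E_tangent[OF p]] coframe_E[OF p])
  have basis: "basis_at A p b"
    unfolding basis_at_def
  proof (intro conjI allI ballI bT)
    fix v assume v: "v \<in> tangent_space A p"
    have eq: "v = lincomb a b \<longleftrightarrow> coframe E 1 p v = k * (a 1 + a 3) \<and> coframe E 2 p v = k * \<epsilon> * (a 1 - a 3)
      \<and> coframe E 3 p v = k * (a 2 + a 4) \<and> coframe E 4 p v = k * \<epsilon> * (a 4 - a 2)" for a
      unfolding lincomb_eq_iff[of p v b, OF p v bT] forall_4 sum_4 c by (simp add: algebra_simps)
    let ?a = "frame4 ((coframe E 1 p v + \<epsilon> * coframe E 2 p v) / (2 * k)) ((coframe E 3 p v - \<epsilon> * coframe E 4 p v) / (2 * k))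
      ((coframe E 1 p v - \<epsilon> * coframe E 2 p v) / (2 * k)) ((coframe E 3 p v + \<epsilon> * coframe E 4 p v) / (2 * k))"
    have h: "k * ((x + y) / (2 * k) + (x - y) / (2 * k)) = x" "k * \<epsilon> * ((x + \<epsilon> * y) / (2 * k) - (x - \<epsilon> * y) / (2 * k)) = y"
      "k * ((x - y) / (2 * k) + (x + y) / (2 * k)) = x" for x y
      using k \<epsilon>(1) by (simp_all add: add_divide_distrib[symmetric] diff_divide_distrib[symmetric] mult.assoc[symmetric])
    show "\<exists>!a. v = lincomb a b"
    proof (rule ex1I[of _ ?a])
      show "v = lincomb ?a b" unfolding eq frame4_simps h by simp
      fix a assume "v = lincomb a b"
      then have a: "coframe E 1 p v = k * (a 1 + a 3)" "\<epsilon> * coframe E 2 p v = k * (a 1 - a 3)"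
        "coframe E 3 p v = k * (a 2 + a 4)" "\<epsilon> * coframe E 4 p v = k * (a 4 - a 2)"
        unfolding eq using \<epsilon>(1) by (simp_all add: mult.left_commute[of \<epsilon>] mult.assoc[symmetric])
      show "a = ?a" unfolding fun_eq_iff forall_4 frame4_simps a using k by (simp add: field_simps)
    qed
  qed
  have "frame_metric p (b i) (b j) = (if i \<noteq> j then 0 else if i = 1 \<or> i = 2 then 1 else -1)" for i j
    by (induct i rule: all_4I; induct j rule: all_4I; simp add: frame_metric_def sym_prod_def c)
      (use fk in \<open>simp_all add: algebra_simps\<close>)
  with basis show "\<exists>b :: 4 \<Rightarrow> 'm tangent. basis_at A p b \<and>
      (\<forall>i j. frame_metric p (b i) (b j) = (if i \<noteq> j then 0 else if i = 1 \<or> i = 2 then 1 else -1))" by blast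
qed

section \<open>Weyl tensor and Hodge star in the frame\<close>

lemma curv_self_dual:
  assumes p: "p \<in> N"
  shows "ricci A (conn \<Gamma>) E p y z = 0"
    and "weyl A frame_metric (conn \<Gamma>) E p x y z v = frame_metric p (curv A (conn \<Gamma>) E p x y z) v"
proof -
  have ric: "ricci A (conn \<Gamma>) E p y z = 0" for y z
  proof -
    have "ricci A (conn \<Gamma>) E p y z = (\<Sum>i\<in>UNIV. \<Sum>j\<in>UNIV. \<Sum>k\<in>UNIV. coframe E j p y * coframe E k p z * R i j k i p)"
      unfolding ricci_def curv_coframe[of \<Gamma>, OF \<Gamma>_smooth p] coframe_E[OF p]
    proof (rule sum.cong[OF refl])
      fix a :: 4
      have "(\<Sum>i\<in>UNIV. (if i = a then 1 else 0) * x i) = x a" for x :: "4 \<Rightarrow> real"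
        by (simp add: mult_delta_left)
      from this[of "\<lambda>i. \<Sum>j\<in>UNIV. \<Sum>k\<in>UNIV. coframe E j p y * coframe E k p z * R i j k a p"]
      show "(\<Sum>i\<in>UNIV. \<Sum>j\<in>UNIV. \<Sum>k\<in>UNIV. (if i = a then 1 else 0) * coframe E j p y * coframe E k p z * R i j k a p)
        = (\<Sum>j\<in>UNIV. \<Sum>k\<in>UNIV. coframe E j p y * coframe E k p z * R a j k a p)"
        by (simp only: sum_distrib_left mult.assoc)
    qed
    also have "\<dots> = (\<Sum>j\<in>UNIV. \<Sum>i\<in>UNIV. \<Sum>k\<in>UNIV. coframe E j p y * coframe E k p z * R i j k i p)"
      by (rule sum.swap)
    also have "\<dots> = (\<Sum>j\<in>UNIV. \<Sum>k\<in>UNIV. \<Sum>i\<in>UNIV. coframe E j p y * coframe E k p z * R i j k i p)"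
      by (intro sum.cong refl sum.swap)
    also have "\<dots> = 0" by (simp add: sum_distrib_left[symmetric] R_ricci[OF p])
    finally show ?thesis .
  qed
  show "ricci A (conn \<Gamma>) E p y z = 0" by (rule ric)
  show "weyl A frame_metric (conn \<Gamma>) E p x y z v = frame_metric p (curv A (conn \<Gamma>) E p x y z) v"
    by (simp add: weyl_def ric scalar_curv_def)
qed

text \<open>The determinant is positive for either sign of \<open>f2\<close>, so the volume density
  is f2^2 / 4 and a constant orientation sign serves on all of N.\<close>

lemma gram_inverse:
  assumes p: "p \<in> N"
  shows "matrix_inv (gram E frame_metric p) = (\<chi> i j. frame4
     (frame4 0 (2 / f2 p) 0 0) (frame4 (2 / f2 p) 0 0 0) (frame4 0 0 0 (- 2 / f2 p)) (frame4 0 0 (- 2 / f2 p) 0) i j)"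
    and "det (gram E frame_metric p) = (f2 p) ^ 4 / 16"
proof -
  have gram: "gram E frame_metric p $ i $ j = G i j p" for i j
    by (induct i rule: all_4I; induct j rule: all_4I; simp add: gram_def frame_metric_def sym_prod_def coframe_E[OF p] G_simps)
  show "det (gram E frame_metric p) = (f2 p) ^ 4 / 16"
    by (simp add: det_4 gram G_simps power4_eq_xxxx)
  show "matrix_inv (gram E frame_metric p) = (\<chi> i j. frame4
     (frame4 0 (2 / f2 p) 0 0) (frame4 (2 / f2 p) 0 0 0) (frame4 0 0 0 (- 2 / f2 p)) (frame4 0 0 (- 2 / f2 p) 0) i j)"
    using f2_nonzero[OF p]
    by (intro matrix_inv_eqI; simp add: matrix_matrix_mult_def vec_eq_iff forall_4 sum_4 gram G_simps mat_def)
qed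

text \<open>With two slots filled by frame vectors, the determinant reduces to a signed minor in the
  two complementary indices.\<close>

lemma volume_form_frame:
  assumes p: "p \<in> N"
  defines "X i j x y \<equiv> coframe E i p x * coframe E j p y - coframe E j p x * coframe E i p y"
  shows "volume_form E frame_metric (\<lambda>p. -1) p (E k p) (E l p) x y = - ((f2 p)\<^sup>2 / 4) * frame4
     (frame4 0 (X 3 4 x y) (- X 2 4 x y) (X 2 3 x y)) (frame4 (- X 3 4 x y) 0 (X 1 4 x y) (- X 1 3 x y))
     (frame4 (X 2 4 x y) (- X 1 4 x y) 0 (X 1 2 x y)) (frame4 (- X 2 3 x y) (X 1 3 x y) (- X 1 2 x y) 0) k l"
proof -
  have "(f2 p) ^ 4 / 16 = ((f2 p)\<^sup>2 / 4)\<^sup>2" by (simp add: power_divide flip: power_mult)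
  then have "sqrt \<bar>det (gram E frame_metric p)\<bar> = (f2 p)\<^sup>2 / 4"
    unfolding gram_inverse(2)[OF p] by (simp only: abs_power2 real_sqrt_abs) simp
  moreover have "det (\<chi> i. vector [coframe E i p (E k p), coframe E i p (E l p), coframe E i p x, coframe E i p y] :: real^4^4)
    = frame4
     (frame4 0 (X 3 4 x y) (- X 2 4 x y) (X 2 3 x y)) (frame4 (- X 3 4 x y) 0 (X 1 4 x y) (- X 1 3 x y))
     (frame4 (X 2 4 x y) (- X 1 4 x y) 0 (X 1 2 x y)) (frame4 (- X 2 3 x y) (X 1 3 x y) (- X 1 2 x y) 0) k l"
    by (induct k rule: all_4I; induct l rule: all_4I; simp add: det_4 coframe_E[OF p] X_def algebra_simps)
  ultimately show ?thesis by (simp add: volume_form_def)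
qed

text \<open>The factors of size 2 / f2 from raising two indices cancel the density f2^2 / 4, so the
  star has constant coefficients: conformal invariance in dimension four. Its self-dual forms are
  those with a 1 3 = a 2 4 = 0 and a 3 4 = a 1 2, with a 1 4 and a 2 3 free.\<close>

lemma hodge_frame:
  assumes p: "p \<in> N" and anti: "\<And>i j. \<alpha> (E j p) (E i p) = - \<alpha> (E i p) (E j p)"
  defines "X i j x y \<equiv> coframe E i p x * coframe E j p y - coframe E j p x * coframe E i p y"
    and "a i j \<equiv> \<alpha> (E i p) (E j p)"
  shows "hodge E frame_metric (\<lambda>p. -1) p \<alpha> x y
    = a 1 2 * X 3 4 x y + a 3 4 * X 1 2 x y - a 1 3 * X 1 3 x y - a 2 4 * X 2 4 x y + a 1 4 * X 1 4 x y + a 2 3 * X 2 3 x y"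
proof -
  have d: "\<alpha> (E i p) (E i p) = 0" for i using anti[of i i] by simp
  note an = anti[of 2 1] anti[of 3 1] anti[of 4 1] anti[of 3 2] anti[of 4 2] anti[of 4 3]
  show ?thesis
    unfolding hodge_def gram_inverse(1)[OF p] volume_form_frame[OF p]
    using f2_nonzero[OF p]
    by (simp add: sum_4 d an a_def X_def) (simp add: field_simps power2_eq_square)
qed

lemma expand_form:
  assumes "\<And>i j. a i j = - a j i"
  shows "(\<Sum>i\<in>UNIV. \<Sum>j\<in>UNIV. x i * y j * a i j) = a 1 2 * (x 1 * y 2 - x 2 * y 1) + a 1 3 * (x 1 * y 3 - x 3 * y 1)
    + a 1 4 * (x 1 * y 4 - x 4 * y 1) + a 2 3 * (x 2 * y 3 - x 3 * y 2) + a 2 4 * (x 2 * y 4 - x 4 * y 2)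
    + a 3 4 * (x 3 * y 4 - x (4 :: 4) * y 3 :: real)"
proof -
  have d: "a i i = 0" for i using assms[of i i] by simp
  show ?thesis
    using assms[of 2 1] assms[of 3 1] assms[of 4 1] assms[of 3 2] assms[of 4 2] assms[of 4 3]
    by (simp add: sum_4 d algebra_simps)
qed

lemma half_flat_metric: "half_flat A N E frame_metric (\<lambda>p. -1)"
  unfolding half_flat_def
proof (intro exI conjI)
  show "levi_civita A N frame_metric (conn \<Gamma>)" by (rule levi_civita_metric)
  show "ricci_flat A N E (conn \<Gamma>)" unfolding ricci_flat_def using curv_self_dual(1) by blast
  show "weyl_self_dual A N E frame_metric (\<lambda>p. -1) (conn \<Gamma>)"
    unfolding weyl_self_dual_def
  proof (intro ballI)
    fix p x y z v assume p: "p \<in> N"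
    define a where "a i j = (\<Sum>m\<in>UNIV. \<Sum>n\<in>UNIV. G m n p * (\<Sum>k\<in>UNIV. coframe E k p z * R i j k m p) * coframe E n p v)" for i j
    have w: "weyl A frame_metric (conn \<Gamma>) E p x y z v = (\<Sum>i\<in>UNIV. \<Sum>j\<in>UNIV. coframe E i p x * coframe E j p y * a i j)" for x y
    proof -
      have "weyl A frame_metric (conn \<Gamma>) E p x y z v = (\<Sum>m\<in>UNIV. \<Sum>n\<in>UNIV. G m n p *
        (\<Sum>i\<in>UNIV. \<Sum>j\<in>UNIV. coframe E i p x * coframe E j p y * (\<Sum>k\<in>UNIV. coframe E k p z * R i j k m p)) * coframe E n p v)"
        unfolding curv_self_dual(2)[OF p] frame_metric_G curv_coframe[of \<Gamma>, OF \<Gamma>_smooth p] by (simp add: sum_distrib_left mult.assoc)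
      also have "\<dots> = (\<Sum>i\<in>UNIV. \<Sum>j\<in>UNIV. coframe E i p x * coframe E j p y * a i j)"
        unfolding a_def by (simp add: sum_4 G_simps algebra_simps)
      finally show ?thesis .
    qed
    have anti: "a i j = - a j i" for i j
      unfolding a_def by (subst R_antisym[OF p, of i j]) (simp add: sum_negf)
    have aE: "weyl A frame_metric (conn \<Gamma>) E p (E i p) (E j p) z v = a i j" for i j
      unfolding w by (induct i rule: all_4I; induct j rule: all_4I; simp add: coframe_E[OF p] sum_4)
    \<comment> \<open>Exactly the equations that cut out the self-dual forms in
      \<open>hodge_frame\<close>; they are inherited from the curvature components.\<close>
    have rel: "a 1 3 = 0" "a 2 4 = 0" "a 3 4 = a 1 2"
      by (simp_all add: a_def R_13[OF p] R_24[OF p] R_34[OF p])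
    have "hodge E frame_metric (\<lambda>p. -1) p (\<lambda>x y. weyl A frame_metric (conn \<Gamma>) E p x y z v) x y = weyl A frame_metric (conn \<Gamma>) E p x y z v"
      unfolding hodge_frame[of p "\<lambda>x y. weyl A frame_metric (conn \<Gamma>) E p x y z v", OF p, unfolded aE, OF anti]
      unfolding w expand_form[of a, OF anti] rel by simp
    then show "hodge E frame_metric (\<lambda>p. -1) p (\<lambda>a b. weyl A frame_metric (conn \<Gamma>) E p a b z v) x y = weyl A frame_metric (conn \<Gamma>) E p x y z v" .
  qed
qed

text \<open>This accounts for the sign -1: in the prescribed orientation the frame W, W~, Z, Z~ is
  negatively oriented.\<close>

lemma anti_self_dual_forms:
  "anti_self_dual A N E frame_metric (\<lambda>p. -1) (\<lambda>p v w. f2 p * wedge11 (coframe E 1 p) (coframe E 3 p) v w)"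
  "anti_self_dual A N E frame_metric (\<lambda>p. -1)
     (\<lambda>p v w. f2 p * (wedge11 (coframe E 1 p) (coframe E 2 p) v w - wedge11 (coframe E 3 p) (coframe E 4 p) v w))"
  "anti_self_dual A N E frame_metric (\<lambda>p. -1) (\<lambda>p v w. f2 p * wedge11 (coframe E 2 p) (coframe E 4 p) v w)"
  by (simp_all add: anti_self_dual_def hodge_frame wedge11_def coframe_E algebra_simps)

end

section \<open>The reduced fields form a self-dual frame\<close>

context reduced
begin

text \<open>A derivative in direction 0 vanishes by linearity, which presupposes differentiability;
  for functions smooth at the point a product chart provides it, on all others both sides are zero
  by convention.\<close>

lemma minus_ham_field: "- ham_field U A \<Omega> H = reduced_field 0 H"
proof -
  have "base_field U A 0 p = 0" for p
  proof (cases "p \<in> carrier P")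
    case True
    obtain u s where us: "p = (u, s)" "u \<in> U" "s \<in> carrier A" using True by (auto simp: carrier_P)
    obtain c where c: "c \<in> A" "s \<in> fst c" using carrier_chart us by blast
    have "(u, s) \<in> fst (prod_chart U c)" using us c by simp
    from P.dir_deriv_lincomb[OF prod_chart_in[OF c(1)] this, of 0 0 0 0] show ?thesis
      by (simp add: us(1) base_field_chart[OF c us(2)] flip: zero_prod_def)
  next
    case False
    then have "\<not> smooth_at P p f" for f using P.smooth_at_carrier by blast
    then show ?thesis by (cases p) (simp add: base_field_def fun_eq_iff)
  qed
  then have "base_field U A 0 = 0" by (simp add: fun_eq_iff)
  then show ?thesis by (simp add: reduced_field_def)
qed

text \<open>In (i) only the last two fields have base parts, and these form the identity matrix. In
  (ii) the first two share their base part, so their difference is vertical and pairs with the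
  fourth field, while the base parts of the second and third contribute 1. The minus signs of the
  two Hamiltonian arguments cancel.\<close>

lemma
  assumes p: "p \<in> carrier P"
    and H: "smooth_fun P (carrier P) H1" "smooth_fun P (carrier P) H2" "smooth_fun P (carrier P) H3" "smooth_fun P (carrier P) H4"
  shows nu_situation_i: "nu A \<Omega> p (reduced_field 0 H1 p) (reduced_field 0 H2 p) (reduced_field (1, 0) H3 p) (reduced_field (0, 1) H4 p)
      = pullback_form A \<Omega> p (ham_field U A \<Omega> H1 p) (ham_field U A \<Omega> H2 p)"
    and nu_situation_ii: "nu A \<Omega> p (reduced_field (1, 0) H1 p) (reduced_field (1, 0) H2 p) (reduced_field (0, 1) H3 p) (reduced_field 0 H4 p)
      = pullback_form A \<Omega> p (ham_field U A \<Omega> H1 p - ham_field U A \<Omega> H2 p) (ham_field U A \<Omega> H4 p)"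
proof -
  obtain u s where us: "p = (u, s)" "u \<in> U" "s \<in> carrier A" using p by (auto simp: carrier_P)
  obtain c where c: "c \<in> A" "s \<in> fst c" using carrier_chart us by blast
  let ?C = "prod_chart U c"
  have pC: "(u, s) \<in> fst ?C" using us c by simp
  have sm: "smooth_at P (u, s) H1" "smooth_at P (u, s) H2" "smooth_at P (u, s) H3" "smooth_at P (u, s) H4"
    using P.smooth_fun_at[OF _ P.open_carrier order_refl p] H by (simp_all add: us)
  note r = reduced_field_chart[OF sm(1) c] reduced_field_chart[OF sm(2) c]
    reduced_field_chart[OF sm(3) c] reduced_field_chart[OF sm(4) c]
  note h = ham_field_chart[OF sm(1) c] ham_field_chart[OF sm(2) c] ham_field_chart[OF sm(4) c]
  have "dir_deriv P ?C (u, s) a - dir_deriv P ?C (u, s) b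
    = scal 1 (dir_deriv P ?C (u, s) a) + scal (-1) (dir_deriv P ?C (u, s) b)" for a b
    by (simp add: scal_def fun_eq_iff)
  then have diff: "dir_deriv P ?C (u, s) a - dir_deriv P ?C (u, s) b = dir_deriv P ?C (u, s) (a - b)" for a b
    unfolding P.dir_deriv_lincomb[OF prod_chart_in[OF c(1)] pC] by simp
  show "nu A \<Omega> p (reduced_field 0 H1 p) (reduced_field 0 H2 p) (reduced_field (1, 0) H3 p) (reduced_field (0, 1) H4 p)
      = pullback_form A \<Omega> p (ham_field U A \<Omega> H1 p) (ham_field U A \<Omega> H2 p)"
    unfolding us(1) r h nu_chart[OF c us(2)] pullback_chart[OF c us(2)]
    by (simp add: det4_def wedge22_def wedge11_def reduced_coords_def)
  show "nu A \<Omega> p (reduced_field (1, 0) H1 p) (reduced_field (1, 0) H2 p) (reduced_field (0, 1) H3 p) (reduced_field 0 H4 p)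
      = pullback_form A \<Omega> p (ham_field U A \<Omega> H1 p - ham_field U A \<Omega> H2 p) (ham_field U A \<Omega> H4 p)"
    unfolding us(1) r h diff nu_chart[OF c us(2)] pullback_chart[OF c us(2)]
    by (simp add: det4_def wedge22_def wedge11_def reduced_coords_def algebra_simps)
qed

text \<open>Families d and H indexed by 4 treat both situations at once. The fields are restricted
  to N because \<open>vector_field P N\<close> demands that they vanish outside.\<close>

lemma
  fixes d :: "4 \<Rightarrow> real \<times> real" and H :: "4 \<Rightarrow> (real \<times> real) \<times> 's \<Rightarrow> real"
  assumes H: "\<And>i. smooth_fun P (carrier P) (H i)"
  defines "F i \<equiv> reduced_field (d i) (H i)"
  defines "f2 \<equiv> \<lambda>p. nu A \<Omega> p (F 1 p) (F 2 p) (F 3 p) (F 4 p)"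
  defines "N \<equiv> {p \<in> carrier P. f2 p \<noteq> 0}"
  defines "E i \<equiv> restr N (F i)"
  assumes br: "\<forall>p\<in>carrier P. bracket P (F 1) (F 3) p = 0" "\<forall>p\<in>carrier P. bracket P (F 2) (F 4) p = 0"
    "\<forall>p\<in>carrier P. bracket P (F 1) (F 2) p - bracket P (F 3) (F 4) p = 0"
  shows open_nondegenerate: "open N" and self_dual_frame_reduced: "self_dual_frame P N E f2"
proof -
  have F: "vector_field P (carrier P) (F i)" for i unfolding F_def by (rule reduced_field_vector_field[OF H])
  have f2: "smooth_fun P (carrier P) f2"
    unfolding f2_def by (rule nu_smooth[OF P.open_carrier F F F F])
  have "N = carrier P \<inter> f2 -` (- {0})" by (auto simp: N_def)
  then show N: "open N"
    using continuous_open_preimage[OF P.smooth_fun_continuous[OF f2 P.open_carrier order_refl] P.open_carrier, of "- {0}"]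
    by auto
  have NP: "N \<subseteq> carrier P" by (auto simp: N_def)
  have E: "vector_field P N (E i)" for i unfolding E_def by (rule P.vector_field_restr[OF F NP])
  have EF: "E i p = F i p" if "p \<in> N" for i p using that by (simp add: E_def restr_def)
  have f2E: "f2 p = nu A \<Omega> p (E 1 p) (E 2 p) (E 3 p) (E 4 p)" if "p \<in> N" for p using that by (simp add: f2_def EF)
  have nz: "f2 p \<noteq> 0" if "p \<in> N" for p using that by (simp add: N_def)
  have cramer: "v = lincomb a (\<lambda>i. E i p) \<longleftrightarrow> a = frame4 (nu A \<Omega> p v (E 2 p) (E 3 p) (E 4 p) / f2 p) (nu A \<Omega> p (E 1 p) v (E 3 p) (E 4 p) / f2 p)
    (nu A \<Omega> p (E 1 p) (E 2 p) v (E 4 p) / f2 p) (nu A \<Omega> p (E 1 p) (E 2 p) (E 3 p) v / f2 p)"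
    if "p \<in> N" "v \<in> tangent_space P p" for p v a
    using lincomb_iff_cramer[of "\<lambda>i. E i p", OF P.vector_field_tangent[OF E that(1)] that(2) f2E[OF that(1)] nz[OF that(1)]] .
  have co: "coframe E i p v = frame4 (nu A \<Omega> p v (E 2 p) (E 3 p) (E 4 p) / f2 p) (nu A \<Omega> p (E 1 p) v (E 3 p) (E 4 p) / f2 p)
    (nu A \<Omega> p (E 1 p) (E 2 p) v (E 4 p) / f2 p) (nu A \<Omega> p (E 1 p) (E 2 p) (E 3 p) v / f2 p) i"
    if "p \<in> N" "v \<in> tangent_space P p" for p v i
    unfolding coframe_def cramer[OF that] by simp
  have fr: "frame P N E"
    unfolding frame_def basis_at_def using E P.vector_field_tangent[OF E] cramer by auto
  have co_smooth: "smooth_fun P M (\<lambda>p. coframe E i p (X p))"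
    if M: "open M" "M \<subseteq> N" and X: "vector_field P M X" for M X i
  proof -
    \<comment> \<open>\<open>nu_smooth\<close> asks for fields on M, so the frame is cut down
      further, from N to M.\<close>
    have e: "vector_field P M (restr M (E j))" for j by (rule P.vector_field_restr[OF E M(2)])
    have q: "smooth_fun P M (\<lambda>p. nu A \<Omega> p (Y1 p) (Y2 p) (Y3 p) (Y4 p) / f2 p)"
      if "vector_field P M Y1" "vector_field P M Y2" "vector_field P M Y3" "vector_field P M Y4" for Y1 Y2 Y3 Y4
      using P.smooth_fun_subset[OF f2, of M] M NP nz by (intro P.smooth_fun_divide M(1) nu_smooth that) auto
    have "smooth_fun P M (\<lambda>p. frame4
      (nu A \<Omega> p (X p) (restr M (E 2) p) (restr M (E 3) p) (restr M (E 4) p) / f2 p)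
      (nu A \<Omega> p (restr M (E 1) p) (X p) (restr M (E 3) p) (restr M (E 4) p) / f2 p)
      (nu A \<Omega> p (restr M (E 1) p) (restr M (E 2) p) (X p) (restr M (E 4) p) / f2 p)
      (nu A \<Omega> p (restr M (E 1) p) (restr M (E 2) p) (restr M (E 3) p) (X p) / f2 p) i)"
      using exhaust_4[of i] by (elim disjE; hypsubst; simp only: frame4_simps; intro q X e)
    then show ?thesis
      by (rule P.smooth_fun_cong[OF M(1), rotated])
        (use M(2) P.vector_field_tangent[OF X] in \<open>auto simp: co restr_def subset_iff\<close>)
  qed
  interpret fr: framed P N E by unfold_locales (fact N fr co_smooth)+
  have brE: "bracket P (E i) (E j) p = bracket P (F i) (F j) p" if p: "p \<in> N" for i j p
    by (rule P.bracket_cong[OF N p]) (use p EF P.vector_field_tangent[OF E] in auto)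
  show "self_dual_frame P N E f2"
  proof
    show "smooth_fun P N f2" by (rule P.smooth_fun_subset[OF f2 NP])
    show "f2 p \<noteq> 0" if "p \<in> N" for p by (rule nz[OF that])
    fix p assume p: "p \<in> N"
    then have pc: "p \<in> carrier P" using NP by blast
    show "bracket P (E 1) (E 3) p = 0" "bracket P (E 2) (E 4) p = 0"
      "bracket P (E 1) (E 2) p = bracket P (E 3) (E 4) p"
      using br pc by (simp_all add: brE[OF p])
    fix i
    have T: "bracket P (E i) (E k) p \<in> tangent_space P p" for k
      by (rule P.vector_field_tangent[OF P.vector_field_bracket[OF E E N] p])
    have "E i p f2 = E i p (\<lambda>q. nu A \<Omega> q (E 1 q) (E 2 q) (E 3 q) (E 4 q))"
      by (rule P.tangent_cong[OF P.vector_field_tangent[OF E p] N p f2E])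
    also have "\<dots> = nu A \<Omega> p (bracket P (E i) (E 1) p) (E 2 p) (E 3 p) (E 4 p)
      + nu A \<Omega> p (E 1 p) (bracket P (E i) (E 2) p) (E 3 p) (E 4 p)
      + nu A \<Omega> p (E 1 p) (E 2 p) (bracket P (E i) (E 3) p) (E 4 p)
      + nu A \<Omega> p (E 1 p) (E 2 p) (E 3 p) (bracket P (E i) (E 4) p)"
      by (rule nu_derivative[OF N p E E E E E _ H]) (simp add: EF F_def)
    \<comment> \<open>By Cramer's rule the term with [E i, E k] in slot k is \<open>f2\<close> times
      the E k component of that bracket; the four terms add up to the trace.\<close>
    also have "\<dots> = f2 p * (\<Sum>k\<in>UNIV. fr.struct i k k p)"
      unfolding fr.struct_def fr.comps_def sum_4 co[OF p T] frame4_simps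
      using nz[OF p] by (simp add: field_simps)
    finally show "E i p f2 = f2 p * (\<Sum>k\<in>UNIV. fr.struct i k k p)" .
  qed
qed

end

theorem mainTheorem1:
  fixes A :: "('s::{t2_space, second_countable_topology}, real \<times> real) atlas"
    and \<Omega> :: "'s tensor2"
    and U :: "(real \<times> real) set"
    and Hw Hwt Hz Hzt :: "(real \<times> real) \<times> 's \<Rightarrow> real"
    and W Wt Z Zt :: "((real \<times> real) \<times> 's) field"
    and P :: "((real \<times> real) \<times> 's, (real \<times> real) \<times> (real \<times> real)) atlas"
    and f2 :: "(real \<times> real) \<times> 's \<Rightarrow> real"
    and N :: "((real \<times> real) \<times> 's) set"
    and E :: "4 \<Rightarrow> ((real \<times> real) \<times> 's) field"
    and eW eWt eZ eZt :: "(real \<times> real) \<times> 's \<Rightarrow> ((real \<times> real) \<times> 's) tangent \<Rightarrow> real"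
    and g :: "((real \<times> real) \<times> 's) tensor2"
  assumes "smooth_manifold A" and "symplectic_form A \<Omega>" and "open U"
    and P: "P = prod_atlas U A"
    and "smooth_fun P (carrier P) Hw" and "smooth_fun P (carrier P) Hwt"
    and "smooth_fun P (carrier P) Hz" and "smooth_fun P (carrier P) Hzt"
    and "situation_i U A \<Omega> Hw Hwt Hz Hzt W Wt Z Zt \<or> situation_ii U A \<Omega> Hw Hwt Hz Hzt W Wt Z Zt"
    and "\<forall>p\<in>carrier P. bracket P W Z p = 0"
    and "\<forall>p\<in>carrier P. bracket P Wt Zt p = 0"
    and "\<forall>p\<in>carrier P. bracket P W Wt p - bracket P Z Zt p = 0"
    and f2: "f2 = (\<lambda>p. nu A \<Omega> p (W p) (Wt p) (Z p) (Zt p))"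
    and N: "N = {p \<in> carrier P. f2 p \<noteq> 0}"
    and E: "E = frame4 (restr N W) (restr N Wt) (restr N Z) (restr N Zt)"
    and "eW = coframe E 1" and "eWt = coframe E 2" and "eZ = coframe E 3" and "eZt = coframe E 4"
    and g: "g = (\<lambda>p v w. f2 p * (sym_prod (eW p) (eWt p) v w - sym_prod (eZ p) (eZt p) v w))"
  shows "(situation_i U A \<Omega> Hw Hwt Hz Hzt W Wt Z Zt \<longrightarrow>
            (\<forall>p\<in>carrier P. f2 p =
               pullback_form A \<Omega> p (ham_field U A \<Omega> Hw p) (ham_field U A \<Omega> Hwt p))) \<and>
         (situation_ii U A \<Omega> Hw Hwt Hz Hzt W Wt Z Zt \<longrightarrow>
            (\<forall>p\<in>carrier P. f2 p =
               pullback_form A \<Omega> p (ham_field U A \<Omega> Hw p - ham_field U A \<Omega> Hwt p)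
                 (ham_field U A \<Omega> Hzt p))) \<and>
         open N \<and> frame P N E \<and> neutral_metric P N g \<and>
         (\<exists>\<sigma>. orientation_sign N \<sigma> \<and>
            anti_self_dual P N E g \<sigma> (\<lambda>p v w. f2 p * wedge11 (eW p) (eZ p) v w) \<and>
            anti_self_dual P N E g \<sigma>
              (\<lambda>p v w. f2 p * (wedge11 (eW p) (eWt p) v w - wedge11 (eZ p) (eZt p) v w)) \<and>
            anti_self_dual P N E g \<sigma> (\<lambda>p v w. f2 p * wedge11 (eWt p) (eZt p) v w) \<and>
            half_flat P N E g \<sigma>)"
proof -
  interpret red: reduced A \<Omega> U
    by unfold_locales (fact assms(1-3))+
  define H where "H = frame4 Hw Hwt Hz Hzt"
  have H: "smooth_fun P (carrier P) (H i)" for i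
    unfolding H_def by (rule red.P.smooth_fun_subset[OF _ order_refl, folded P], induct i rule: all_4I)
      (simp_all add: assms(5-8))
  let ?i = "situation_i U A \<Omega> Hw Hwt Hz Hzt W Wt Z Zt" and ?ii = "situation_ii U A \<Omega> Hw Hwt Hz Hzt W Wt Z Zt"
  have F_i: "W = red.reduced_field 0 Hw" "Wt = red.reduced_field 0 Hwt"
    "Z = red.reduced_field (1, 0) Hz" "Zt = red.reduced_field (0, 1) Hzt" if ?i
    using that unfolding situation_i_def red.minus_ham_field by (simp_all add: red.reduced_field_def)
  have F_ii: "W = red.reduced_field (1, 0) Hw" "Wt = red.reduced_field (1, 0) Hwt"
    "Z = red.reduced_field (0, 1) Hz" "Zt = red.reduced_field 0 Hzt" if ?ii
    using that unfolding situation_ii_def red.minus_ham_field by (simp_all add: red.reduced_field_def)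
  have i: "f2 p = pullback_form A \<Omega> p (ham_field U A \<Omega> Hw p) (ham_field U A \<Omega> Hwt p)"
    if ?i "p \<in> carrier P" for p
    unfolding f2 F_i[OF that(1)] using that(2) assms(5-8) unfolding P by (rule red.nu_situation_i)
  have ii: "f2 p = pullback_form A \<Omega> p (ham_field U A \<Omega> Hw p - ham_field U A \<Omega> Hwt p) (ham_field U A \<Omega> Hzt p)"
    if ?ii "p \<in> carrier P" for p
    unfolding f2 F_ii[OF that(1)] using that(2) assms(5-8) unfolding P by (rule red.nu_situation_ii)
  \<comment> \<open>From here on the situations differ only in the constant base directions
    d.\<close>
  obtain d where d: "W = red.reduced_field (d 1) (H 1)" "Wt = red.reduced_field (d 2) (H 2)"
    "Z = red.reduced_field (d 3) (H 3)" "Zt = red.reduced_field (d (4 :: 4)) (H 4)"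
  proof (cases ?i)
    case True
    show thesis
      by (rule that[of "frame4 0 0 (1, 0) (0, 1)"]) (simp_all add: H_def F_i[OF True])
  next
    case False
    with assms(9) have ?ii by blast
    show thesis
      by (rule that[of "frame4 (1, 0) (1, 0) (0, 1) 0"]) (simp_all add: H_def F_ii[OF \<open>?ii\<close>])
  qed
  have E': "E = (\<lambda>i. restr N (red.reduced_field (d i) (H i)))"
  proof
    fix i show "E i = restr N (red.reduced_field (d i) (H i))"
      unfolding E by (induct i rule: all_4I) (simp_all add: d)
  qed
  note sd = red.open_nondegenerate[of H d, folded P, OF H] red.self_dual_frame_reduced[of H d, folded P, OF H]
  have "open N"
    using sd(1) assms(10-12) unfolding N f2 d by blast
  have "self_dual_frame P N E f2"
    using sd(2) assms(10-12) unfolding E' unfolding N f2 d by blast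
  then interpret sdf: self_dual_frame P N E f2 .
  have g': "g = sdf.frame_metric"
    unfolding g sdf.frame_metric_def assms(16-19) ..
  show ?thesis
  proof (intro conjI)
    show "\<exists>\<sigma>. orientation_sign N \<sigma> \<and>
        anti_self_dual P N E g \<sigma> (\<lambda>p v w. f2 p * wedge11 (eW p) (eZ p) v w) \<and>
        anti_self_dual P N E g \<sigma>
          (\<lambda>p v w. f2 p * (wedge11 (eW p) (eWt p) v w - wedge11 (eZ p) (eZt p) v w)) \<and>
        anti_self_dual P N E g \<sigma> (\<lambda>p v w. f2 p * wedge11 (eWt p) (eZt p) v w) \<and>
        half_flat P N E g \<sigma>"
      unfolding g' assms(16-19)
      using sdf.anti_self_dual_forms sdf.half_flat_metric
      by (intro exI[of _ "\<lambda>p. -1"]) (simp add: orientation_sign_def)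
  qed (use i ii \<open>open N\<close> sdf.frame sdf.metric_neutral g' in auto)
qed

end
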